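(* Let $K$ and $L$ be the boundaries of two simplicial polytopes. Then the simplicial join $K\star L$ is almost cohomologically symplectic if and only if both $K$ and $L$ are almost cohomologically symplectic.
   Context: The join $K\star L$ of boundaries of simplicial polytopes is again the boundary of a simplicial polytope. Almost cohomologically symplectic: let $K$ be the boundary of a simplicial polytope with $m$ vertices labelled by $[m]$. $K$ is almost cohomologically symplectic (almost c-symplectic) if for some $\ell$ there are homogeneous classes $\alpha_1,\dots,\alpha_\ell$ with $\alpha_i\in H^{d_i,\omega_i}(\mathbb{R}\mathcal{Z}_K;\mathbb{Q})$, each $d_i\in\{1,2\}$ and $\omega_i\subseteq[m]$, such that $\alpha_1\smile\dots\smile\alpha_\ell\neq0$ and $\omega_1\triangle\dots\triangle\omega_\ell=[m]$ (symmetric difference). Here $\mathbb{R}\mathcal{Z}_K=\bigcup_{\sigma\in K}\{(x_1,\dots,x_m)\in[0,1]^m: x_i\in\{0,1\}\text{ when }i\notin\sigma\}$, and the grading $H^{p,\omega}$ is as follows. Let $\mathcal{R}$ be the differential graded $\mathbb{Q}$-algebra generated by $u_i$ (degree 1), $t_i$ (degree 0), $1\le i\le m$, with $du_i=0$, $dt_i=u_i$, the graded Leibniz rule, and relations $u_iu_i=0$, $u_it_i=u_i$, $t_iu_i=-u_i$, $t_it_i=1$, and for $i\ne j$: $u_iu_j=-u_ju_i$, $u_it_j=t_ju_i$, $t_it_j=t_jt_i$. For $\sigma=\{i_1<\dots<i_k\}$ put $u_\sigma=u_{i_1}\cdots u_{i_k}$, $t_\sigma=t_{i_1}\cdots t_{i_k}$;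 $\mathcal{R}^K$ is the quotient of $\mathcal{R}$ by the ideal generated by the $u_\sigma$ with $\sigma\notin K$. For $\omega\subseteq[m]$, $\mathcal{R}^K_\omega$ is the subcomplex spanned by $u_\sigma t_{\omega\setminus\sigma}$ with $\sigma\subseteq\omega$, $\sigma\in K$. There is a graded algebra isomorphism $H^*(\mathbb{R}\mathcal{Z}_K;\mathbb{Q})\cong H(\mathcal{R}^K,d)$ (induced from cellular cochains of the cube by $u_i=2\cdot\underline{01}_i^*$, $t_i=1_i^*-0_i^*$, where $0_i^*,1_i^*,\underline{01}_i^*$ are dual to the cells of the $i$th interval), and $H^{p,\omega}(\mathbb{R}\mathcal{Z}_K;\mathbb{Q})$ is the summand corresponding to $H^p(\mathcal{R}^K_\omega,d)$. A class is homogeneous if it lies in some $H^{p,\omega}$. *)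

theory Defs
  imports "HOL-Analysis.Analysis" "HOL-Algebra.QuotRing" "HOL-Library.Poly_Mapping"
begin

section \<open>Boundaries of simplicial polytopes and their joins\<close>

definition simplicial_polytope :: "'a::euclidean_space set \<Rightarrow> bool" where
  "simplicial_polytope P \<longleftrightarrow>
     polytope P \<and> P \<noteq> {} \<and> (\<forall>F. F facet_of P \<longrightarrow> (\<exists>k. k simplex F))"

definition boundary_complex :: "'a::euclidean_space set \<Rightarrow> 'a set set" where
  "boundary_complex P = {{v. v extreme_point_of F} | F. F face_of P \<and> F \<noteq> P}"

text \<open>
  The labelled vertices are the vertices of the boundary complex, i.e. the singletons that are
  faces of it. They are the vertices of \<open>P\<close>, except when \<open>P\<close> is a single point: then the
  boundary is the complex \<open>{{}}\<close>, which has no vertices (\<open>m = 0\<close>).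
\<close>

definition labelled_boundary :: "nat \<Rightarrow> nat set set \<Rightarrow> 'a::euclidean_space set \<Rightarrow> bool" where
  "labelled_boundary m K P \<longleftrightarrow>
     (\<exists>v. bij_betw v {1..m} (\<Union>(boundary_complex P)) \<and>
          K = {\<sigma>. \<sigma> \<subseteq> {1..m} \<and> v ` \<sigma> \<in> boundary_complex P})"

text \<open>For \<open>K\<close> on \<open>{1..m}\<close> and \<open>L\<close> on \<open>{1..n}\<close>, the vertex \<open>j\<close> of \<open>L\<close> becomes the vertex
  \<open>m + j\<close> of the join, which is therefore a complex on \<open>{1..m+n}\<close>.\<close>

definition simplicial_join :: "nat \<Rightarrow> nat set set \<Rightarrow> nat set set \<Rightarrow> nat set set" where
  "simplicial_join m K L = {\<sigma> \<union> (\<lambda>j. m + j) ` \<tau> | \<sigma> \<tau>. \<sigma> \<in> K \<and> \<tau> \<in> L}"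


section \<open>The free algebra on the generators \<open>u\<^sub>i\<close>, \<open>t\<^sub>i\<close>\<close>

datatype generator = UGen nat | TGen nat

fun gen_index :: "generator \<Rightarrow> nat" where
  "gen_index (UGen i) = i"
| "gen_index (TGen i) = i"

text \<open>Words with concatenation, written additively, so that the convolution product of
  \<^theory>\<open>HOL-Library.Poly_Mapping\<close> makes \<open>gen_word \<Rightarrow>\<^sub>0 rat\<close> the free associative
  \<open>rat\<close>-algebra on the generators.\<close>

datatype gen_word = GWord (letters: "generator list")

instantiation gen_word :: monoid_add
begin

definition zero_gen_word :: gen_word where
  "zero_gen_word = GWord []"

definition plus_gen_word :: "gen_word \<Rightarrow> gen_word \<Rightarrow> gen_word" where
  "plus_gen_word v w = GWord (letters v @ letters w)"

instance
  by standard (simp_all add: zero_gen_word_def plus_gen_word_def)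

end

type_synonym free_alg = "gen_word \<Rightarrow>\<^sub>0 rat"

definition scal :: "rat \<Rightarrow> free_alg \<Rightarrow> free_alg" where
  "scal c x = Poly_Mapping.single 0 c * x"

interpretation free_alg: vector_space scal
  by standard
    (simp_all add: scal_def distrib_left distrib_right single_add mult_single
      flip: mult.assoc)

definition word_elt :: "generator list \<Rightarrow> free_alg" where
  "word_elt w = Poly_Mapping.single (GWord w) 1"

definition u_gen :: "nat \<Rightarrow> free_alg" where "u_gen i = word_elt [UGen i]"
definition t_gen :: "nat \<Rightarrow> free_alg" where "t_gen i = word_elt [TGen i]"

text \<open>The derivation with \<open>d u\<^sub>i = 0\<close>, \<open>d t\<^sub>i = u\<^sub>i\<close> and
  \<open>d (x y) = (d x) y + (-1)\<^bsup>deg x\<^esup> x (d y)\<close>, where \<open>deg u\<^sub>i = 1\<close> and \<open>deg t\<^sub>i = 0\<close>.\<close>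

fun diff_word :: "generator list \<Rightarrow> free_alg" where
  "diff_word [] = 0"
| "diff_word (UGen i # w) = - (u_gen i * diff_word w)"
| "diff_word (TGen i # w) = u_gen i * word_elt w + t_gen i * diff_word w"

definition free_diff :: "free_alg \<Rightarrow> free_alg" where
  "free_diff x = (\<Sum>w\<in>Poly_Mapping.keys x. scal (Poly_Mapping.lookup x w) (diff_word (letters w)))"

lemma free_diff_word_elt: "free_diff (word_elt w) = diff_word w"
  by (simp add: free_diff_def word_elt_def scal_def)

lemma free_diff_gen: "free_diff (u_gen i) = 0" "free_diff (t_gen i) = u_gen i"
  by (simp_all add: u_gen_def t_gen_def free_diff_word_elt)
    (simp_all add: u_gen_def t_gen_def word_elt_def mult_single plus_gen_word_def)

lemma diff_word_append:
  "diff_word (v @ w) =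
     diff_word v * word_elt w + (-1) ^ length (filter (\<lambda>g. g \<in> range UGen) v) * word_elt v * diff_word w"
proof (induction v rule: diff_word.induct)
  case 1
  show ?case
    by (simp add: word_elt_def flip: zero_gen_word_def)
next
  case (2 i v)
  have "word_elt (UGen i # v) = u_gen i * word_elt v"
    by (simp add: u_gen_def word_elt_def mult_single plus_gen_word_def)
  moreover have "u_gen i * (-1) ^ k = (-1) ^ k * u_gen i" for k
    by (cases "even k") simp_all
  ultimately show ?case
    using 2 by (simp add: algebra_simps) (simp flip: mult.assoc)
next
  case (3 i v)
  have "word_elt (TGen i # v) = t_gen i * word_elt v"
       "word_elt (v @ w) = word_elt v * word_elt w"
    by (simp_all add: t_gen_def word_elt_def mult_single plus_gen_word_def)
  moreover have "t_gen i * (-1) ^ k = (-1) ^ k * t_gen i" for k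
    by (cases "even k") simp_all
  moreover have "TGen i \<notin> range UGen"
    by auto
  ultimately show ?case
    using 3 by (simp add: algebra_simps) (simp flip: mult.assoc)
qed

definition free_ring :: "nat \<Rightarrow> free_alg ring" where
  "free_ring m =
     \<lparr>carrier = {x. \<forall>w\<in>Poly_Mapping.keys x. gen_index ` set (letters w) \<subseteq> {1..m}},
      mult = (*), one = 1, zero = 0, add = (+)\<rparr>"


section \<open>The algebra \<open>R\<^sup>K\<close>\<close>

definition u_prod :: "nat set \<Rightarrow> free_alg" where
  "u_prod \<sigma> = prod_list (map u_gen (sorted_list_of_set \<sigma>))"

definition t_prod :: "nat set \<Rightarrow> free_alg" where
  "t_prod \<sigma> = prod_list (map t_gen (sorted_list_of_set \<sigma>))"

definition R_relations :: "nat \<Rightarrow> free_alg set" where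
  "R_relations m =
     (\<Union>i\<in>{1..m}. {u_gen i * u_gen i, u_gen i * t_gen i - u_gen i, t_gen i * u_gen i + u_gen i, t_gen i * t_gen i - 1}) \<union>
     (\<Union>i\<in>{1..m}. \<Union>j\<in>{1..m} - {i}.
        {u_gen i * u_gen j + u_gen j * u_gen i, u_gen i * t_gen j - t_gen j * u_gen i, t_gen i * t_gen j - t_gen j * t_gen i})"

text \<open>The relations of \<open>R\<close> and the elements \<open>u\<^sub>\<sigma>\<close>, \<open>\<sigma> \<notin> K\<close>, are divided out in one step.\<close>

definition RK_ideal :: "nat \<Rightarrow> nat set set \<Rightarrow> free_alg set" where
  "RK_ideal m K =
     Idl\<^bsub>free_ring m\<^esub> (R_relations m \<union> {u_prod \<sigma> | \<sigma>. \<sigma> \<subseteq> {1..m} \<and> \<sigma> \<notin> K})"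

definition RK :: "nat \<Rightarrow> nat set set \<Rightarrow> free_alg set ring" where
  "RK m K = free_ring m Quot RK_ideal m K"

definition RK_class :: "nat \<Rightarrow> nat set set \<Rightarrow> free_alg \<Rightarrow> free_alg set" where
  "RK_class m K x = RK_ideal m K +>\<^bsub>free_ring m\<^esub> x"

definition RK_diff :: "nat \<Rightarrow> nat set set \<Rightarrow> free_alg set \<Rightarrow> free_alg set" where
  "RK_diff m K X = (\<Union>x\<in>X. RK_class m K (free_diff x))"

text \<open>The degree \<open>p\<close> part of the subcomplex \<open>R\<^sup>K\<^sub>\<omega>\<close>.\<close>

definition RK_part :: "nat \<Rightarrow> nat set set \<Rightarrow> nat \<Rightarrow> nat set \<Rightarrow> free_alg set set" where
  "RK_part m K p \<omega> =
     RK_class m K ` free_alg.span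
       {u_prod \<sigma> * t_prod (\<omega> - \<sigma>) | \<sigma>. \<sigma> \<subseteq> \<omega> \<and> \<sigma> \<in> K \<and> card \<sigma> = p}"


section \<open>The cohomology ring of the real moment-angle complex\<close>

definition cocycles :: "nat \<Rightarrow> nat set set \<Rightarrow> free_alg set set" where
  "cocycles m K = {X \<in> carrier (RK m K). RK_diff m K X = \<zero>\<^bsub>RK m K\<^esub>}"

definition coboundaries :: "nat \<Rightarrow> nat set set \<Rightarrow> free_alg set set" where
  "coboundaries m K = RK_diff m K ` carrier (RK m K)"

text \<open>
  The cohomology ring with rational coefficients of the real moment-angle complex
  \<open>\<Union>\<sigma>\<in>K. {x \<in> [0,1]\<^sup>m. \<forall>i. i \<notin> \<sigma> \<longrightarrow> x\<^sub>i \<in> {0,1}}\<close>, with the cup product, identified with the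
  cohomology of the differential graded algebra \<open>R\<^sup>K\<close>. The identification is induced by sending
  \<open>u\<^sub>i\<close> to twice the dual of the edge, and \<open>t\<^sub>i\<close> to the dual of \<open>1\<close> minus the dual of \<open>0\<close>, in the
  cellular cochains of the \<open>i\<close>-th interval; it is the one through which the grading by
  \<open>\<omega>\<close> is defined.
\<close>

definition H_RZ :: "nat \<Rightarrow> nat set set \<Rightarrow> free_alg set set ring" where
  "H_RZ m K = (RK m K)\<lparr>carrier := cocycles m K\<rparr> Quot coboundaries m K"

text \<open>The summand \<open>H\<^bsup>p,\<omega>\<^esup>\<close>: the image of \<open>H\<^sup>p(R\<^sup>K\<^sub>\<omega>)\<close>.\<close>

definition H_part :: "nat \<Rightarrow> nat set set \<Rightarrow> nat \<Rightarrow> nat set \<Rightarrow> free_alg set set set" where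
  "H_part m K p \<omega> = {coboundaries m K +>\<^bsub>RK m K\<^esub> X | X. X \<in> RK_part m K p \<omega> \<inter> cocycles m K}"

text \<open>\<open>l = 0\<close> gives the empty product \<open>1 \<noteq> 0\<close> and the empty symmetric difference, so it
  matters only for \<open>m = 0\<close>.\<close>

definition almost_c_symplectic :: "nat \<Rightarrow> nat set set \<Rightarrow> bool" where
  "almost_c_symplectic m K \<longleftrightarrow>
     (\<exists>l \<alpha> d \<omega>.
        (\<forall>i<l. d i \<in> {1, 2} \<and> \<omega> i \<subseteq> {1..m} \<and> \<alpha> i \<in> H_part m K (d i) (\<omega> i)) \<and>
        foldr (\<otimes>\<^bsub>H_RZ m K\<^esub>) (map \<alpha> [0..<l]) \<one>\<^bsub>H_RZ m K\<^esub> \<noteq> \<zero>\<^bsub>H_RZ m K\<^esub> \<and>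
        foldr sym_diff (map \<omega> [0..<l]) {} = {1..m})"

end

theory Submission
  imports Defs "HOL-Algebra.Subrings"
begin

text \<open>
  The polytopes enter through three properties of their labelled boundary complexes
  (\<open>labelled_boundary_complex\<close>): they are closed under passing to subsets, they contain the
  empty face, and every label is a vertex. Let \<open>K\<close> and \<open>L\<close> be such complexes and \<open>J\<close> their join.

  The faces of \<open>J\<close> are the unions of a face of \<open>K\<close> and a shifted face of \<open>L\<close>, and generators with
  indices in different blocks commute up to sign. So \<open>R\<^sup>J\<close> is the graded tensor product of
  \<open>R\<^sup>K\<close> and \<open>R\<^sup>L\<close>, and over the rationals the Kuenneth theorem writes \<open>H\<^bsup>d,\<omega>\<^esup>\<close> of the join as
  the sum of the products of \<open>H\<^bsup>p,\<omega>'\<^esup>\<close> and \<open>H\<^bsup>q,\<omega>''\<^esup>\<close> over \<open>p + q = d\<close>, where \<open>\<omega>'\<close> and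
  \<open>\<omega>''\<close> are the two blocks of \<open>\<omega>\<close>.

  If both complexes are almost c-symplectic, the witnesses for \<open>K\<close> and for \<open>L\<close> together are
  witnesses for \<open>J\<close>: the product is the exterior product of two nonzero classes, and that is nonzero
  (\<open>not_exact_block\<close>).

  Conversely, let a product of classes of degrees 1 and 2 of the join be nonzero. Each factor is a
  sum of exterior products \<open>a \<times> b\<close> of homogeneous classes (\<open>kunneth\<close>). By multilinearity some
  product of such \<open>a\<^sub>i \<times> b\<^sub>i\<close> is nonzero (\<open>product_expansion\<close>). Up to sign it is the exterior product of
  the products of the \<open>a\<^sub>i\<close> and of the \<open>b\<^sub>i\<close> (\<open>block_product\<close>), so both of these are nonzero.
  The \<open>a\<^sub>i\<close> have degree 0, 1 or 2. Since every label is a vertex, \<open>H\<^bsup>0,\<omega>\<^esup>\<close> vanishes for nonempty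
  \<open>\<omega>\<close> and consists of scalars for empty \<open>\<omega>\<close> (\<open>degree_zero\<close>). Hence factors of degree 0 can
  be removed without changing the symmetric difference of the index sets (\<open>drop_degree_zero\<close>), and
  \<open>K\<close> is almost c-symplectic. The argument for \<open>L\<close> is the same.

  All computations are made with representatives in the free algebra, modulo the ideal that
  defines \<open>R\<^sup>K\<close>; \<open>almost_c_symplectic_iff\<close> is the translation. Two facts about \<open>R\<^sup>K\<close> are behind
  them. The monomials \<open>u\<^sub>\<sigma> t\<^bsub>\<omega> - \<sigma>\<^esub>\<close> with \<open>\<sigma> \<in> K\<close> form a basis, which is seen from an explicit
  representation of the free algebra on coefficient functions (\<open>expansion\<close>, \<open>act_RK_ideal\<close>). And
  \<open>R\<^sup>K\<close> is contracted onto cocycles by a homotopy that respects the bigrading (\<open>contraction\<close>), from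
  which the Kuenneth theorem follows.
\<close>

section \<open>Linear maps on the free algebra\<close>

abbreviation F :: "nat \<Rightarrow> free_alg set" where "F m \<equiv> carrier (free_ring m)"

abbreviation words :: "nat \<Rightarrow> generator list set" where
  "words m \<equiv> {w. gen_index ` set w \<subseteq> {1..m}}"

abbreviation lin :: "(free_alg \<Rightarrow> free_alg) \<Rightarrow> bool" where
  "lin f \<equiv> Vector_Spaces.linear scal scal f"

interpretation pair: vector_space_pair scal scal
  by unfold_locales

lemma lin_iff: "lin f \<longleftrightarrow> (\<forall>x y. f (x + y) = f x + f y) \<and> (\<forall>c x. f (scal c x) = scal c (f x))"
  using pair.linear_add pair.linear_scale pair.linear_0
  by (auto simp: Vector_Spaces.linear_def module_hom_def module_hom_axioms_def
      free_alg.vector_space_axioms free_alg.module_axioms)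

lemma linI: "(\<And>x y. f (x + y) = f x + f y) \<Longrightarrow> (\<And>c x. f (scal c x) = scal c (f x)) \<Longrightarrow> lin f"
  by (simp add: lin_iff)

lemmas lin_simps = pair.linear_add pair.linear_scale pair.linear_diff pair.linear_neg
  pair.linear_0 pair.linear_sum

lemma word_elt_append: "word_elt (v @ w) = word_elt v * word_elt w"
  by (simp add: word_elt_def mult_single plus_gen_word_def)

lemma word_elt_Nil: "word_elt [] = 1"
  by (simp add: word_elt_def flip: zero_gen_word_def)

lemma word_elt_Cons: "word_elt (g # w) = word_elt [g] * word_elt w"
  using word_elt_append[of "[g]" w] by simp

lemma word_elt_in_F: "word_elt w \<in> F m \<longleftrightarrow> w \<in> words m"
  by (simp add: free_ring_def word_elt_def)

lemma lookup_scal: "Poly_Mapping.lookup (scal c x) w = c * Poly_Mapping.lookup x w"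
proof -
  have "scal c x = Poly_Mapping.map ((*) c) x"
    by (simp add: scal_def mult_map_scale_conv_mult)
  then show ?thesis
    by (simp add: Poly_Mapping.map.rep_eq when_def)
qed

lemma free_alg_expand: "x = (\<Sum>w\<in>Poly_Mapping.keys x. scal (Poly_Mapping.lookup x w) (word_elt (letters w)))"
proof (rule poly_mapping_eqI)
  fix v
  show "Poly_Mapping.lookup x v = Poly_Mapping.lookup (\<Sum>w\<in>Poly_Mapping.keys x. scal (Poly_Mapping.lookup x w) (word_elt (letters w))) v"
    by (simp add: lookup_sum lookup_scal word_elt_def lookup_single when_def in_keys_iff if_distrib cong: if_cong)
qed

lemma F_simps:
  "x \<in> F m \<Longrightarrow> y \<in> F m \<Longrightarrow> x + y \<in> F m"
  "x \<in> F m \<Longrightarrow> y \<in> F m \<Longrightarrow> x * y \<in> F m"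
  "x \<in> F m \<Longrightarrow> - x \<in> F m"
  "x \<in> F m \<Longrightarrow> y \<in> F m \<Longrightarrow> x - y \<in> F m"
  "0 \<in> F m" "1 \<in> F m"
  "x \<in> F m \<Longrightarrow> scal c x \<in> F m"
proof -
  show add: "x \<in> F m \<Longrightarrow> y \<in> F m \<Longrightarrow> x + y \<in> F m" for x y
    using keys_add[of x y] by (auto simp: free_ring_def)
  show mul: "x \<in> F m \<Longrightarrow> y \<in> F m \<Longrightarrow> x * y \<in> F m" for x y
    using keys_mult[of x y] by (fastforce simp: free_ring_def plus_gen_word_def)
  show neg: "x \<in> F m \<Longrightarrow> - x \<in> F m" for x
    by (auto simp: free_ring_def in_keys_iff)
  show "x \<in> F m \<Longrightarrow> y \<in> F m \<Longrightarrow> x - y \<in> F m" for x y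
    using add[of x "- y"] neg[of y] by simp
  show "0 \<in> F m" "1 \<in> F m"
    by (auto simp: free_ring_def zero_gen_word_def)
  show "x \<in> F m \<Longrightarrow> scal c x \<in> F m"
    by (auto simp: free_ring_def in_keys_iff lookup_scal)
qed

lemma F_sum: "(\<And>i. i \<in> A \<Longrightarrow> f i \<in> F m) \<Longrightarrow> sum f A \<in> F m"
  by (induction A rule: infinite_finite_induct) (auto simp: F_simps)

lemma F_prod_list: "set xs \<subseteq> F m \<Longrightarrow> prod_list xs \<in> F m"
  by (induction xs) (auto simp: F_simps)

lemma F_mono: "m \<le> n \<Longrightarrow> F m \<subseteq> F n"
  by (force simp: free_ring_def)

lemma F_induct [consumes 1, case_names word add scal]:
  assumes "x \<in> F m"
    and w: "\<And>w. w \<in> words m \<Longrightarrow> P (word_elt w)"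
    and a: "\<And>x y. x \<in> F m \<Longrightarrow> y \<in> F m \<Longrightarrow> P x \<Longrightarrow> P y \<Longrightarrow> P (x + y)"
    and s: "\<And>c x. x \<in> F m \<Longrightarrow> P x \<Longrightarrow> P (scal c x)"
  shows "P x"
proof -
  have z: "P 0"
    using s[of "word_elt []" 0] w[of "[]"] by (simp add: word_elt_in_F)
  have "finite A \<Longrightarrow> \<forall>w\<in>A. letters w \<in> words m \<Longrightarrow>
      (\<Sum>w\<in>A. scal (Poly_Mapping.lookup x w) (word_elt (letters w))) \<in> F m \<and>
      P (\<Sum>w\<in>A. scal (Poly_Mapping.lookup x w) (word_elt (letters w)))" for A
    by (induction A rule: finite_induct)
      (auto simp: z F_simps word_elt_in_F intro!: a s w)
  from this[of "Poly_Mapping.keys x"] assms(1) show ?thesis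
    by (subst free_alg_expand) (auto simp: free_ring_def)
qed

lemma free_alg_induct [case_names word add scal]:
  assumes w: "\<And>w. P (word_elt w)"
    and a: "\<And>x y. P x \<Longrightarrow> P y \<Longrightarrow> P (x + y)"
    and s: "\<And>c x. P x \<Longrightarrow> P (scal c x)"
  shows "P x"
proof -
  have z: "P 0"
    using s[of "word_elt []" 0] w[of "[]"] by simp
  have "finite A \<Longrightarrow> P (\<Sum>w\<in>A. scal (Poly_Mapping.lookup x w) (word_elt (letters w)))" for A
    by (induction A rule: finite_induct) (auto simp: z intro!: a s w)
  from this[of "Poly_Mapping.keys x"] show ?thesis
    by (subst free_alg_expand) auto
qed

lemma scal_mult_left: "scal c x * y = scal c (x * y)"
  by (simp add: scal_def mult.assoc)

lemma scal_mult_right: "x * scal c y = scal c (x * y)"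
proof (induction x rule: free_alg_induct)
  case (word w)
  have "word_elt w * Poly_Mapping.single 0 c = Poly_Mapping.single 0 c * word_elt w"
    by (simp add: word_elt_def mult_single)
  then show ?case
    by (metis mult.assoc scal_def)
next
  case (add x y)
  then show ?case by (simp add: distrib_right free_alg.scale_right_distrib)
next
  case (scal c x)
  then show ?case by (simp add: scal_mult_left free_alg.scale_left_commute)
qed

lemmas scal_mult = scal_mult_left scal_mult_right

lemma scal_conv_mult: "scal c x = scal c 1 * x"
  by (simp add: scal_mult)

lemma lin_agree:
  assumes "lin f" "lin g" "\<And>w. f (word_elt w) = g (word_elt w)"
  shows "f x = g x"
  by (induction x rule: free_alg_induct) (auto simp: assms lin_simps)

definition extend :: "(generator list \<Rightarrow> free_alg) \<Rightarrow> free_alg \<Rightarrow> free_alg" where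
  "extend f x = (\<Sum>w\<in>Poly_Mapping.keys x. scal (Poly_Mapping.lookup x w) (f (letters w)))"

lemma extend_superset:
  fixes x :: free_alg
  assumes "finite A" "Poly_Mapping.keys x \<subseteq> A"
  shows "extend f x = (\<Sum>w\<in>A. scal (Poly_Mapping.lookup x w) (f (letters w)))"
  unfolding extend_def
  by (rule sum.mono_neutral_left) (use assms in \<open>auto simp: in_keys_iff\<close>)

lemma lin_extend: "lin (extend f)"
proof (rule linI)
  fix x y :: free_alg
  let ?A = "Poly_Mapping.keys x \<union> Poly_Mapping.keys y"
  show "extend f (x + y) = extend f x + extend f y"
    using keys_add[of x y]
    by (simp add: extend_superset[of ?A] lookup_add free_alg.scale_left_distrib sum.distrib)
next
  fix c x
  show "extend f (scal c x) = scal c (extend f x)"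
    by (subst extend_superset[of "Poly_Mapping.keys x"])
      (auto simp: extend_def free_alg.scale_sum_right lookup_scal in_keys_iff)
qed

lemma extend_word_elt [simp]: "extend f (word_elt w) = f w"
  by (simp add: extend_def word_elt_def scal_def)

lemma free_diff_eq_extend: "free_diff = extend diff_word"
  by (simp add: fun_eq_iff free_diff_def extend_def)

lemma lin_free_diff: "lin free_diff"
  by (simp add: free_diff_eq_extend lin_extend)

lemmas free_diff_simps = lin_simps[OF lin_free_diff]

definition u_count :: "generator list \<Rightarrow> nat" where
  "u_count w = length (filter (\<lambda>g. g \<in> range UGen) w)"

lemma u_count_simps [simp]:
  "u_count [] = 0" "u_count (UGen i # w) = Suc (u_count w)" "u_count (TGen i # w) = u_count w"
  "u_count (v @ w) = u_count v + u_count w"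
  by (auto simp: u_count_def)

text \<open>
  The sign involution of the grading by the number of \<open>u\<close>'s. With it the Leibniz rule reads
  \<open>d (x y) = (d x) y + twist x (d y)\<close> for all elements, homogeneous or not.
\<close>

definition twist :: "free_alg \<Rightarrow> free_alg" where
  "twist = extend (\<lambda>w. scal ((-1) ^ u_count w) (word_elt w))"

lemma lin_twist: "lin twist"
  by (simp add: twist_def lin_extend)

lemma twist_word_elt: "twist (word_elt w) = scal ((-1) ^ u_count w) (word_elt w)"
  by (simp add: twist_def)

lemmas twist_simps = lin_simps[OF lin_twist]

text \<open>
  Words span the free algebra, so it suffices to compare two bilinear maps on pairs of words.
\<close>

lemma bilinear_on_words:
  assumes "\<And>y. lin (\<lambda>x. f x y)" "\<And>x. lin (\<lambda>y. f x y)"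
    and "\<And>y. lin (\<lambda>x. g x y)" "\<And>x. lin (\<lambda>y. g x y)"
    and "\<And>v w. f (word_elt v) (word_elt w) = g (word_elt v) (word_elt w)"
  shows "f x y = g x y"
  by (rule lin_agree[of "\<lambda>x. f x y" "\<lambda>x. g x y"], simp_all add: assms)
    (rule lin_agree[of "\<lambda>y. f (word_elt _) y" "\<lambda>y. g (word_elt _) y"], simp_all add: assms)

lemma lin_ident: "lin (\<lambda>x. x)"
  by (rule linI) simp_all

lemma lin_compose: "lin f \<Longrightarrow> lin g \<Longrightarrow> lin (\<lambda>x. f (g x))"
  by (rule linI) (simp_all add: lin_simps)

lemma lin_times: "lin f \<Longrightarrow> lin (\<lambda>x. f x * a)" "lin f \<Longrightarrow> lin (\<lambda>x. a * f x)"
  by (rule linI; simp add: lin_simps distrib_right distrib_left scal_mult)+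

lemma lin_plus: "lin f \<Longrightarrow> lin g \<Longrightarrow> lin (\<lambda>x. f x + g x)"
  by (rule linI) (simp_all add: lin_simps free_alg.scale_right_distrib)

lemma lin_minus: "lin f \<Longrightarrow> lin g \<Longrightarrow> lin (\<lambda>x. f x - g x)"
  by (rule linI) (simp_all add: lin_simps free_alg.scale_right_diff_distrib)

lemma lin_scal: "lin f \<Longrightarrow> lin (\<lambda>x. scal c (f x))"
  by (rule linI) (simp_all add: lin_simps free_alg.scale_right_distrib free_alg.scale_left_commute)


lemma twist_mult: "twist (x * y) = twist x * twist y"
proof (rule bilinear_on_words[of "\<lambda>x y. twist (x * y)" "\<lambda>x y. twist x * twist y"])
qed (auto intro!: lin_times lin_twist lin_ident lin_compose[OF lin_twist]
    simp: twist_word_elt scal_mult power_add simp flip: word_elt_append)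

lemma twist_twist [simp]: "twist (twist x) = x"
  by (rule lin_agree[of "\<lambda>x. twist (twist x)" "\<lambda>x. x"])
    (auto intro!: lin_compose[OF lin_twist lin_twist] lin_ident simp: twist_word_elt twist_simps
      simp flip: power_mult_distrib)

lemma twist_1 [simp]: "twist 1 = 1"
  using twist_word_elt[of "[]"] by (simp add: word_elt_Nil)

lemma twist_u_gen: "twist (u_gen i) = - u_gen i" and twist_t_gen: "twist (t_gen i) = t_gen i"
  by (simp_all add: u_gen_def t_gen_def twist_word_elt)

lemma free_diff_mult: "free_diff (x * y) = free_diff x * y + twist x * free_diff y"
proof (rule bilinear_on_words[of "\<lambda>x y. free_diff (x * y)" "\<lambda>x y. free_diff x * y + twist x * free_diff y"])
  fix v w
  have "(-1) ^ k * x = scal ((-1) ^ k) x" for k and x :: free_alg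
    by (cases "even k") simp_all
  then show "free_diff (word_elt v * word_elt w) =
      free_diff (word_elt v) * word_elt w + twist (word_elt v) * free_diff (word_elt w)"
    by (simp add: free_diff_word_elt twist_word_elt diff_word_append u_count_def flip: word_elt_append)
qed (auto intro!: lin_times lin_twist lin_ident lin_compose[OF lin_free_diff] lin_plus lin_free_diff)

lemma free_diff_1 [simp]: "free_diff 1 = 0"
  using free_diff_word_elt[of "[]"] by (simp add: word_elt_Nil)

lemma word_elt_gen: "word_elt [UGen i] = u_gen i" "word_elt [TGen i] = t_gen i"
  by (simp_all add: u_gen_def t_gen_def)

lemma word_induct [case_names Nil U T]:
  assumes "P []" "\<And>i w. P w \<Longrightarrow> P (UGen i # w)" "\<And>i w. P w \<Longrightarrow> P (TGen i # w)"
  shows "P w"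
proof (induction w)
  case (Cons g w)
  then show ?case using assms by (cases g) auto
qed (fact assms)

lemma free_diff_twist: "free_diff (twist x) = - twist (free_diff x)"
proof -
  have *: "free_diff (twist (word_elt w)) = - twist (free_diff (word_elt w))" for w
  proof (induction w rule: word_induct)
    case Nil
    then show ?case by (simp add: word_elt_Nil twist_simps)
  next
    case (U i w)
    then show ?case
      by (subst (1 2) word_elt_Cons)
        (simp add: word_elt_gen free_diff_mult twist_mult twist_u_gen free_diff_gen twist_simps free_diff_simps)
  next
    case (T i w)
    then show ?case
      by (subst (1 2) word_elt_Cons)
        (simp add: word_elt_gen free_diff_mult twist_mult twist_u_gen twist_t_gen free_diff_gen twist_simps free_diff_simps)
  qed
  show ?thesis
    by (induction x rule: free_alg_induct)
      (simp_all add: * twist_simps free_diff_simps)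
qed

text \<open>
  For a word \<open>t\<^sub>i w\<close> the Leibniz rule gives \<open>u\<^sub>i (d w)\<close> twice, with opposite signs because
  \<open>twist\<close> negates \<open>u\<^sub>i\<close>.
\<close>

lemma free_diff_free_diff [simp]: "free_diff (free_diff x) = 0"
proof -
  have *: "free_diff (free_diff (word_elt w)) = 0" for w
  proof (induction w rule: word_induct)
    case Nil
    then show ?case by (simp add: word_elt_Nil free_diff_simps)
  next
    case (U i w)
    then show ?case
      by (subst word_elt_Cons)
        (simp add: word_elt_gen free_diff_mult twist_mult twist_u_gen free_diff_gen twist_simps free_diff_simps)
  next
    case (T i w)
    then show ?case
      by (subst word_elt_Cons)
        (simp add: word_elt_gen free_diff_mult twist_mult twist_u_gen twist_t_gen free_diff_gen twist_simps free_diff_simps)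
  qed
  show ?thesis
    by (induction x rule: free_alg_induct)
      (simp_all add: * twist_simps free_diff_simps)
qed

lemma gens_in_F: "i \<in> {1..m} \<Longrightarrow> u_gen i \<in> F m" "i \<in> {1..m} \<Longrightarrow> t_gen i \<in> F m"
  by (simp_all add: u_gen_def t_gen_def word_elt_in_F)

lemma free_diff_in_F:
  assumes "x \<in> F m" shows "free_diff x \<in> F m"
proof -
  have "w \<in> words m \<Longrightarrow> diff_word w \<in> F m" for w
    by (induction w rule: word_induct) (auto intro!: F_simps gens_in_F simp: word_elt_in_F)
  with assms show ?thesis
    by (induction rule: F_induct) (auto simp: free_diff_simps free_diff_word_elt intro!: F_simps)
qed

lemma twist_in_F: "x \<in> F m \<Longrightarrow> twist x \<in> F m"
  by (induction rule: F_induct) (auto simp: twist_simps twist_word_elt word_elt_in_F intro!: F_simps)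

fun shift_gen :: "nat \<Rightarrow> generator \<Rightarrow> generator" where
  "shift_gen m (UGen i) = UGen (m + i)"
| "shift_gen m (TGen i) = TGen (m + i)"

text \<open>
  The embedding of the algebra of the second complex into that of the join, where the index
  \<open>j\<close> becomes \<open>m + j\<close>.
\<close>

definition shift :: "nat \<Rightarrow> free_alg \<Rightarrow> free_alg" where
  "shift m = extend (\<lambda>w. word_elt (map (shift_gen m) w))"

lemma lin_shift: "lin (shift m)"
  by (simp add: shift_def lin_extend)

lemma shift_word_elt: "shift m (word_elt w) = word_elt (map (shift_gen m) w)"
  by (simp add: shift_def)

lemmas shift_simps = lin_simps[OF lin_shift]

lemma shift_1 [simp]: "shift m 1 = 1"
  using shift_word_elt[of m "[]"] by (simp add: word_elt_Nil)

lemma shift_gens: "shift m (u_gen i) = u_gen (m + i)" "shift m (t_gen i) = t_gen (m + i)"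
  by (simp_all add: u_gen_def t_gen_def shift_word_elt)

lemma shift_mult: "shift m (x * y) = shift m x * shift m y"
proof (rule bilinear_on_words[of "\<lambda>x y. shift m (x * y)" "\<lambda>x y. shift m x * shift m y"])
qed (auto intro!: lin_times lin_shift lin_ident lin_compose[OF lin_shift]
    simp: shift_word_elt simp flip: word_elt_append)

lemma shift_prod_list: "shift m (prod_list xs) = prod_list (map (shift m) xs)"
  by (induction xs) (simp_all add: shift_mult)

lemma shift_in_F:
  assumes "x \<in> F n" shows "shift m x \<in> F (m + n)"
proof -
  have "gen_index (shift_gen m g) = m + gen_index g" for g
    by (cases g) auto
  then have "w \<in> words n \<Longrightarrow> map (shift_gen m) w \<in> words (m + n)" for w
    by (force simp: image_subset_iff)
  with assms show ?thesis
    by (induction rule: F_induct) (auto simp: shift_simps shift_word_elt word_elt_in_F intro!: F_simps)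
qed

lemma free_diff_shift: "free_diff (shift m x) = shift m (free_diff x)"
proof -
  have *: "free_diff (shift m (word_elt w)) = shift m (free_diff (word_elt w))" for w
    by (induction w rule: word_induct)
      (simp_all add: shift_word_elt free_diff_word_elt shift_simps shift_mult shift_gens)
  show ?thesis
    by (induction x rule: free_alg_induct) (simp_all add: * shift_simps free_diff_simps)
qed

section \<open>The defining ideal\<close>

lemma free_ring_ops [simp]:
  "x \<oplus>\<^bsub>free_ring m\<^esub> y = x + y" "x \<otimes>\<^bsub>free_ring m\<^esub> y = x * y"
  "\<zero>\<^bsub>free_ring m\<^esub> = 0" "\<one>\<^bsub>free_ring m\<^esub> = 1"
  by (simp_all add: free_ring_def)

lemma ring_free_ring: "ring (free_ring m)"
proof (intro ringI abelian_groupI monoidI)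
  fix x assume "x \<in> F m"
  then show "\<exists>y\<in>F m. y \<oplus>\<^bsub>free_ring m\<^esub> x = \<zero>\<^bsub>free_ring m\<^esub>"
    by (intro bexI[of _ "- x"] F_simps) simp_all
qed (auto simp: algebra_simps intro: F_simps)

lemma free_ring_a_inv: "x \<in> F m \<Longrightarrow> \<ominus>\<^bsub>free_ring m\<^esub> x = - x"
proof -
  assume "x \<in> F m"
  interpret ring "free_ring m" by (fact ring_free_ring)
  show ?thesis
    by (rule minus_equality) (use \<open>x \<in> F m\<close> in \<open>auto intro: F_simps\<close>)
qed

definition RK_gens :: "nat \<Rightarrow> nat set set \<Rightarrow> free_alg set" where
  "RK_gens m K = R_relations m \<union> {u_prod \<sigma> | \<sigma>. \<sigma> \<subseteq> {1..m} \<and> \<sigma> \<notin> K}"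

lemma u_prod_in_F: "\<sigma> \<subseteq> {1..m} \<Longrightarrow> u_prod \<sigma> \<in> F m"
  and t_prod_in_F: "\<sigma> \<subseteq> {1..m} \<Longrightarrow> t_prod \<sigma> \<in> F m"
proof -
  assume \<sigma>: "\<sigma> \<subseteq> {1..m}"
  then have "finite \<sigma>" by (rule finite_subset) simp
  moreover have "u_gen ` \<sigma> \<subseteq> F m" "t_gen ` \<sigma> \<subseteq> F m"
    using \<sigma> gens_in_F by blast+
  ultimately show "u_prod \<sigma> \<in> F m" "t_prod \<sigma> \<in> F m"
    unfolding u_prod_def t_prod_def by (auto intro!: F_prod_list)
qed

lemma RK_gens_in_F: "RK_gens m K \<subseteq> F m"
  unfolding RK_gens_def R_relations_def
  by (auto intro!: F_simps gens_in_F u_prod_in_F)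

lemma ideal_RK_ideal: "ideal (RK_ideal m K) (free_ring m)"
  using ring.genideal_ideal[OF ring_free_ring RK_gens_in_F]
  by (simp add: RK_ideal_def RK_gens_def)

lemma RK_gens_in_ideal: "x \<in> RK_gens m K \<Longrightarrow> x \<in> RK_ideal m K"
  using ring.genideal_self[OF ring_free_ring RK_gens_in_F, of m K]
  unfolding RK_ideal_def RK_gens_def by blast

lemma RK_ideal_in_F: "x \<in> RK_ideal m K \<Longrightarrow> x \<in> F m"
  using additive_subgroup.a_subset[OF ideal.axioms(1)[OF ideal_RK_ideal]] by blast

lemma RK_ideal_simps:
  "0 \<in> RK_ideal m K"
  "x \<in> RK_ideal m K \<Longrightarrow> y \<in> RK_ideal m K \<Longrightarrow> x + y \<in> RK_ideal m K"
  "x \<in> RK_ideal m K \<Longrightarrow> a \<in> F m \<Longrightarrow> a * x \<in> RK_ideal m K"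
  "x \<in> RK_ideal m K \<Longrightarrow> a \<in> F m \<Longrightarrow> x * a \<in> RK_ideal m K"
  "x \<in> RK_ideal m K \<Longrightarrow> - x \<in> RK_ideal m K"
  "x \<in> RK_ideal m K \<Longrightarrow> y \<in> RK_ideal m K \<Longrightarrow> x - y \<in> RK_ideal m K"
  "x \<in> RK_ideal m K \<Longrightarrow> scal c x \<in> RK_ideal m K"
proof -
  note I = ideal_RK_ideal[of m K]
  note A = additive_subgroup.a_closed[OF ideal.axioms(1)[OF I]]
    additive_subgroup.zero_closed[OF ideal.axioms(1)[OF I]]
  show "0 \<in> RK_ideal m K"
    using A by simp
  show add: "x \<in> RK_ideal m K \<Longrightarrow> y \<in> RK_ideal m K \<Longrightarrow> x + y \<in> RK_ideal m K" for x y
    using A by simp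
  show l: "x \<in> RK_ideal m K \<Longrightarrow> a \<in> F m \<Longrightarrow> a * x \<in> RK_ideal m K" for x a
    using ideal.I_l_closed[OF I] by simp
  show "x \<in> RK_ideal m K \<Longrightarrow> a \<in> F m \<Longrightarrow> x * a \<in> RK_ideal m K" for x a
    using ideal.I_r_closed[OF I] by simp
  show neg: "x \<in> RK_ideal m K \<Longrightarrow> - x \<in> RK_ideal m K" for x
    using l[of x "- 1"] F_simps(3,6) by auto
  show "x \<in> RK_ideal m K \<Longrightarrow> y \<in> RK_ideal m K \<Longrightarrow> x - y \<in> RK_ideal m K" for x y
    using add[of x "- y"] neg by simp
  show "x \<in> RK_ideal m K \<Longrightarrow> scal c x \<in> RK_ideal m K" for x c
    by (subst scal_conv_mult) (intro l F_simps)
qed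

lemma RK_ideal_sum: "(\<And>i. i \<in> A \<Longrightarrow> f i \<in> RK_ideal m K) \<Longrightarrow> sum f A \<in> RK_ideal m K"
  by (induction A rule: infinite_finite_induct) (auto simp: RK_ideal_simps)

text \<open>
  The elements of the ideal with a given property, if closed under sums and under multiplication
  by elements of the ring, form an ideal again; negation is multiplication by \<open>-1\<close>.
\<close>

lemma RK_ideal_induct [consumes 1, case_names gen zero add left right]:
  assumes "x \<in> RK_ideal m K"
    and g: "\<And>x. x \<in> RK_gens m K \<Longrightarrow> P x"
    and z: "P 0"
    and a: "\<And>x y. x \<in> RK_ideal m K \<Longrightarrow> y \<in> RK_ideal m K \<Longrightarrow> P x \<Longrightarrow> P y \<Longrightarrow> P (x + y)"
    and l: "\<And>x a. x \<in> RK_ideal m K \<Longrightarrow> a \<in> F m \<Longrightarrow> P x \<Longrightarrow> P (a * x)"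
    and r: "\<And>x a. x \<in> RK_ideal m K \<Longrightarrow> a \<in> F m \<Longrightarrow> P x \<Longrightarrow> P (x * a)"
  shows "P x"
proof -
  let ?J = "{x \<in> RK_ideal m K. P x}"
  interpret ring "free_ring m" by (fact ring_free_ring)
  have "ideal ?J (free_ring m)"
  proof (rule idealI)
    show "ring (free_ring m)" by (fact ring_free_ring)
    show "subgroup ?J (add_monoid (free_ring m))"
    proof (rule add.subgroupI)
      fix x assume x: "x \<in> ?J"
      have "- 1 \<in> F m" by (intro F_simps)
      with x have "- 1 * x \<in> ?J"
        using l[of x "- 1"] RK_ideal_simps(3)[of x m K "- 1"] by auto
      with x show "\<ominus>\<^bsub>free_ring m\<^esub> x \<in> ?J"
        using free_ring_a_inv[OF RK_ideal_in_F, of x m K] by simp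
    next
      show "?J \<noteq> {}"
        using z RK_ideal_simps(1) by blast
    qed (use a RK_ideal_in_F RK_ideal_simps(2) in auto)
  qed (use l r RK_ideal_simps(3,4) in auto)
  then have "Idl\<^bsub>free_ring m\<^esub> (RK_gens m K) \<subseteq> ?J"
    by (rule genideal_minimal) (use g RK_gens_in_ideal in blast)
  with assms(1) show ?thesis
    unfolding RK_ideal_def RK_gens_def by blast
qed

text \<open>
  Equality in \<open>R\<^sup>K\<close>, expressed on representatives.
\<close>

definition cong :: "nat \<Rightarrow> nat set set \<Rightarrow> free_alg \<Rightarrow> free_alg \<Rightarrow> bool" where
  "cong m K x y \<longleftrightarrow> x - y \<in> RK_ideal m K"

lemma cong_refl [simp]: "cong m K x x"
  by (simp add: cong_def RK_ideal_simps)

lemma cong_sym: "cong m K x y \<Longrightarrow> cong m K y x"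
  using RK_ideal_simps(5) by (fastforce simp: cong_def)

lemma cong_trans [trans]: "cong m K x y \<Longrightarrow> cong m K y z \<Longrightarrow> cong m K x z"
  using RK_ideal_simps(2)[of "x - y" m K "y - z"] by (simp add: cong_def)

lemma cong_0: "cong m K x 0 \<longleftrightarrow> x \<in> RK_ideal m K"
  by (simp add: cong_def)

lemma cong_mem: "cong m K x y \<Longrightarrow> x \<in> RK_ideal m K \<longleftrightarrow> y \<in> RK_ideal m K"
  unfolding cong_0[symmetric] by (blast intro: cong_trans cong_sym)

lemma cong_add: "cong m K x y \<Longrightarrow> cong m K a b \<Longrightarrow> cong m K (x + a) (y + b)"
  using RK_ideal_simps(2)[of "x - y" m K "a - b"] by (simp add: cong_def algebra_simps)

lemma cong_neg: "cong m K x y \<Longrightarrow> cong m K (- x) (- y)"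
  using RK_ideal_simps(5)[of "x - y" m K] by (simp add: cong_def)

lemma cong_diff: "cong m K x y \<Longrightarrow> cong m K a b \<Longrightarrow> cong m K (x - a) (y - b)"
  using cong_add[of m K x y "- a" "- b"] cong_neg by simp

lemma cong_scal: "cong m K x y \<Longrightarrow> cong m K (scal c x) (scal c y)"
  using RK_ideal_simps(7)[of "x - y" m K c] by (simp add: cong_def free_alg.scale_right_diff_distrib)

lemma cong_sum: "(\<And>i. i \<in> A \<Longrightarrow> cong m K (f i) (g i)) \<Longrightarrow> cong m K (sum f A) (sum g A)"
  by (induction A rule: infinite_finite_induct) (auto intro: cong_add)

lemma cong_left: "cong m K x y \<Longrightarrow> a \<in> F m \<Longrightarrow> cong m K (a * x) (a * y)"
  using RK_ideal_simps(3)[of "x - y" m K a] by (simp add: cong_def right_diff_distrib)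

lemma cong_right: "cong m K x y \<Longrightarrow> a \<in> F m \<Longrightarrow> cong m K (x * a) (y * a)"
  using RK_ideal_simps(4)[of "x - y" m K a] by (simp add: cong_def left_diff_distrib)

lemma cong_mult:
  "cong m K x y \<Longrightarrow> cong m K a b \<Longrightarrow> a \<in> F m \<Longrightarrow> y \<in> F m \<Longrightarrow> cong m K (x * a) (y * b)"
  by (blast intro: cong_trans cong_left cong_right)

lemma R_relations_in_ideal: "x \<in> R_relations m \<Longrightarrow> x \<in> RK_ideal m K"
  by (rule RK_gens_in_ideal) (simp add: RK_gens_def)

lemma relations:
  assumes "i \<in> {1..m}"
  shows "cong m K (u_gen i * u_gen i) 0" "cong m K (u_gen i * t_gen i) (u_gen i)"
    "cong m K (t_gen i * u_gen i) (- u_gen i)" "cong m K (t_gen i * t_gen i) 1"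
    and "j \<in> {1..m} \<Longrightarrow> i \<noteq> j \<Longrightarrow> cong m K (u_gen i * u_gen j) (- (u_gen j * u_gen i))"
    and "j \<in> {1..m} \<Longrightarrow> i \<noteq> j \<Longrightarrow> cong m K (u_gen i * t_gen j) (t_gen j * u_gen i)"
    and "j \<in> {1..m} \<Longrightarrow> i \<noteq> j \<Longrightarrow> cong m K (t_gen i * t_gen j) (t_gen j * t_gen i)"
  unfolding cong_def diff_minus_eq_add diff_0_right
  by (rule R_relations_in_ideal, unfold R_relations_def, use assms in blast)+

lemma cong_u_prod: "\<sigma> \<subseteq> {1..m} \<Longrightarrow> \<sigma> \<notin> K \<Longrightarrow> u_prod \<sigma> \<in> RK_ideal m K"
  by (auto intro!: RK_gens_in_ideal simp: RK_gens_def)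

lemma RK_gens_cases [consumes 1]:
  assumes "x \<in> RK_gens m K"
  obtains (uu) i where "x = u_gen i * u_gen i" "i \<in> {1..m}"
  | (ut) i where "x = u_gen i * t_gen i - u_gen i" "i \<in> {1..m}"
  | (tu) i where "x = t_gen i * u_gen i + u_gen i" "i \<in> {1..m}"
  | (tt) i where "x = t_gen i * t_gen i - 1" "i \<in> {1..m}"
  | (uu') i j where "x = u_gen i * u_gen j + u_gen j * u_gen i" "i \<in> {1..m}" "j \<in> {1..m}" "i \<noteq> j"
  | (ut') i j where "x = u_gen i * t_gen j - t_gen j * u_gen i" "i \<in> {1..m}" "j \<in> {1..m}" "i \<noteq> j"
  | (tt') i j where "x = t_gen i * t_gen j - t_gen j * t_gen i" "i \<in> {1..m}" "j \<in> {1..m}" "i \<noteq> j"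
  | (face) \<sigma> where "x = u_prod \<sigma>" "\<sigma> \<subseteq> {1..m}" "\<sigma> \<notin> K"
proof -
  consider (one) i where "i \<in> {1..m}" "x \<in> {u_gen i * u_gen i, u_gen i * t_gen i - u_gen i,
        t_gen i * u_gen i + u_gen i, t_gen i * t_gen i - 1}"
    | (two) i j where "i \<in> {1..m}" "j \<in> {1..m}" "i \<noteq> j" "x \<in> {u_gen i * u_gen j + u_gen j * u_gen i,
        u_gen i * t_gen j - t_gen j * u_gen i, t_gen i * t_gen j - t_gen j * t_gen i}"
    | (face) \<sigma> where "\<sigma> \<subseteq> {1..m}" "\<sigma> \<notin> K" "x = u_prod \<sigma>"
    using assms unfolding RK_gens_def R_relations_def Un_iff UN_iff mem_Collect_eq Bex_def Diff_iff
    by (elim disjE exE conjE) (assumption | metis singletonI)+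
  then show thesis
  proof cases
    case one
    note * = uu[OF _ one(1)] ut[OF _ one(1)] tu[OF _ one(1)] tt[OF _ one(1)]
    from one(2) show thesis
      by (elim insertE emptyE) (erule *)+
  next
    case two
    note * = uu'[OF _ two(1,2,3)] ut'[OF _ two(1,2,3)] tt'[OF _ two(1,2,3)]
    from two(4) show thesis
      by (elim insertE emptyE) (erule *)+
  next
    case f: face
    show thesis by (rule face[OF f(3,1,2)])
  qed
qed

lemma twist_u_prod: "twist (u_prod \<sigma>) = scal ((-1) ^ card \<sigma>) (u_prod \<sigma>)"
proof -
  have "twist (prod_list (map u_gen xs)) = scal ((-1) ^ length xs) (prod_list (map u_gen xs))" for xs
    by (induction xs) (simp_all add: twist_mult twist_u_gen scal_mult)
  then show ?thesis
    by (simp add: u_prod_def)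
qed

lemma free_diff_u_prod: "free_diff (u_prod \<sigma>) = 0"
proof -
  have "free_diff (prod_list (map u_gen xs)) = 0" for xs
    by (induction xs) (simp_all add: free_diff_mult free_diff_gen)
  then show ?thesis
    by (simp add: u_prod_def)
qed

text \<open>
  Every generator of the ideal is homogeneous in the number of \<open>u\<close>'s, hence an eigenvector of \<open>twist\<close>.
\<close>

lemma twist_RK_ideal:
  assumes "x \<in> RK_ideal m K"
  shows "twist x \<in> RK_ideal m K"
  using assms
proof (induction rule: RK_ideal_induct)
  case (gen x)
  then have x: "x \<in> RK_ideal m K" by (rule RK_gens_in_ideal)
  from gen have "twist x = x \<or> twist x = - x \<or> (\<exists>c. twist x = scal c x)"
    by (cases rule: RK_gens_cases)
      (auto simp: twist_simps twist_mult twist_u_gen twist_t_gen twist_u_prod)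
  with x show ?case by (auto simp: RK_ideal_simps)
qed (auto simp: twist_mult twist_simps intro: RK_ideal_simps(1-4) twist_in_F)

text \<open>
  The differential descends to \<open>R\<^sup>K\<close>: it sends each relation to a combination of
  relations, and it kills \<open>u\<^sub>\<sigma>\<close>.
\<close>

lemma free_diff_RK_ideal:
  assumes "x \<in> RK_ideal m K"
  shows "free_diff x \<in> RK_ideal m K"
  using assms
proof (induction rule: RK_ideal_induct)
  case (gen x)
  then show ?case
  proof (cases rule: RK_gens_cases)
    case (ut i)
    then have "free_diff x = - (u_gen i * u_gen i)"
      by (simp add: free_diff_simps free_diff_mult twist_u_gen free_diff_gen)
    then show ?thesis
      using relations(1)[OF ut(2)] by (simp add: cong_0 RK_ideal_simps)
  next
    case (tu i)
    then have "free_diff x = u_gen i * u_gen i"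
      by (simp add: free_diff_simps free_diff_mult twist_u_gen free_diff_gen)
    then show ?thesis
      using relations(1)[OF tu(2)] by (simp add: cong_0)
  next
    case (tt i)
    then have "free_diff x = u_gen i * t_gen i + t_gen i * u_gen i"
      by (simp add: free_diff_simps free_diff_mult twist_t_gen free_diff_gen)
    then show ?thesis
      using cong_add[OF relations(2,3)[OF tt(2)]] by (simp add: cong_0)
  next
    case (ut' i j)
    then have "free_diff x = - (u_gen i * u_gen j + u_gen j * u_gen i)"
      by (simp add: free_diff_simps free_diff_mult twist_u_gen twist_t_gen free_diff_gen)
    then show ?thesis
      using relations(5)[OF ut'(2,3,4)] by (simp add: cong_def RK_ideal_simps(5) del: minus_add_distrib)
  next
    case (tt' i j)
    then have "free_diff x = (u_gen i * t_gen j - t_gen j * u_gen i) - (u_gen j * t_gen i - t_gen i * u_gen j)"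
      by (simp add: free_diff_simps free_diff_mult twist_t_gen free_diff_gen)
    then show ?thesis
      using relations(6)[OF tt'(2,3,4)] relations(6)[OF tt'(3,2)] tt'(4)
      by (simp add: cong_def RK_ideal_simps(6))
  qed (simp_all add: free_diff_simps free_diff_mult twist_u_gen free_diff_gen free_diff_u_prod RK_ideal_simps)
next
  case (left x a)
  then show ?case
    unfolding free_diff_mult by (intro RK_ideal_simps(2) RK_ideal_simps(3)[of "free_diff x"]
      RK_ideal_simps(3)[of x] free_diff_in_F twist_in_F)
next
  case (right x a)
  then show ?case
    unfolding free_diff_mult by (intro RK_ideal_simps(2) RK_ideal_simps(4)[of "free_diff x"]
      RK_ideal_simps(4)[of "twist x"] free_diff_in_F twist_RK_ideal)
qed (auto simp: free_diff_simps intro: RK_ideal_simps(1,2))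

lemma cong_free_diff: "cong m K x y \<Longrightarrow> cong m K (free_diff x) (free_diff y)"
  using free_diff_RK_ideal[of "x - y" m K] by (simp add: cong_def free_diff_simps)

section \<open>Coefficients of monomials\<close>

text \<open>
  A pair \<open>(\<sigma>, \<omega>)\<close> with \<open>\<sigma> \<subseteq> \<omega>\<close> labels the monomial \<open>u\<^sub>\<sigma> t\<^bsub>\<omega> - \<sigma>\<^esub>\<close>. That
  these monomials are linearly independent in \<open>R\<^sup>K\<close> for \<open>\<sigma> \<in> K\<close> is shown by a representation: the
  free algebra acts on coefficient functions, the generators acting as left multiplication would act
  on coefficients of monomials if the relations held, and one checks that the relations do hold for
  these operators.
\<close>

type_synonym coeffs = "nat set \<times> nat set \<Rightarrow> rat"

text \<open>
  Left multiplication by \<open>u\<^sub>i\<close> produces \<open>u\<^sub>\<sigma>\<close> with \<open>i \<in> \<sigma>\<close> from two monomials: from the one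
  without any letter of index \<open>i\<close>, and from the one with \<open>t\<^sub>i\<close>, since \<open>u\<^sub>i t\<^sub>i = u\<^sub>i\<close>. The sign moves
  \<open>u\<^sub>i\<close> to its place in the increasing product.
\<close>

definition U_op :: "nat \<Rightarrow> coeffs \<Rightarrow> coeffs" where
  "U_op i f = (\<lambda>(\<sigma>, \<omega>). if i \<in> \<sigma> \<and> i \<in> \<omega>
     then (-1) ^ card {j \<in> \<sigma>. j < i} * (f (\<sigma> - {i}, \<omega>) + f (\<sigma> - {i}, \<omega> - {i})) else 0)"

definition toggle :: "nat \<Rightarrow> nat set \<Rightarrow> nat set" where
  "toggle i \<omega> = (if i \<in> \<omega> then \<omega> - {i} else insert i \<omega>)"

text \<open>
  In degree zero at the index \<open>i\<close>, multiplication by \<open>t\<^sub>i\<close> exchanges \<open>1\<close> and \<open>t\<^sub>i\<close>, because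
  \<open>t\<^sub>i t\<^sub>i = 1\<close>; on \<open>u\<^sub>i\<close> it is \<open>-1\<close>.
\<close>

definition T_op :: "nat \<Rightarrow> coeffs \<Rightarrow> coeffs" where
  "T_op i f = (\<lambda>(\<sigma>, \<omega>). if i \<in> \<sigma> then - f (\<sigma>, \<omega>) else f (\<sigma>, toggle i \<omega>))"

fun word_op :: "generator list \<Rightarrow> coeffs \<Rightarrow> coeffs" where
  "word_op [] f = f"
| "word_op (UGen i # w) f = U_op i (word_op w f)"
| "word_op (TGen i # w) f = T_op i (word_op w f)"

lemma word_op_append: "word_op (v @ w) f = word_op v (word_op w f)"
  by (induction v rule: word_induct) simp_all

lemma word_op_linear:
  "word_op w (\<lambda>s. f s + g s) = (\<lambda>s. word_op w f s + word_op w g s)"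
  "word_op w (\<lambda>s. c * f s) = (\<lambda>s. c * word_op w f s)"
  by (induction w rule: word_induct)
    (simp_all add: U_op_def T_op_def fun_eq_iff algebra_simps)

definition act :: "free_alg \<Rightarrow> coeffs \<Rightarrow> coeffs" where
  "act x f s = (\<Sum>w\<in>Poly_Mapping.keys x. Poly_Mapping.lookup x w * word_op (letters w) f s)"

lemma act_superset:
  fixes x :: free_alg
  assumes "finite A" "Poly_Mapping.keys x \<subseteq> A"
  shows "act x f s = (\<Sum>w\<in>A. Poly_Mapping.lookup x w * word_op (letters w) f s)"
  unfolding act_def
  by (rule sum.mono_neutral_left) (use assms in \<open>auto simp: in_keys_iff\<close>)

lemma act_word_elt: "act (word_elt w) f = word_op w f"
  by (simp add: act_def word_elt_def fun_eq_iff)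

lemma act_add: "act (x + y) f s = act x f s + act y f s"
proof -
  let ?A = "Poly_Mapping.keys x \<union> Poly_Mapping.keys y"
  show ?thesis
    using keys_add[of x y] by (simp add: act_superset[of ?A] lookup_add sum.distrib distrib_right)
qed

lemma act_scal: "act (scal c x) f s = c * act x f s"
  by (subst act_superset[of "Poly_Mapping.keys x"])
    (auto simp: act_def sum_distrib_left lookup_scal in_keys_iff mult.assoc)

lemma act_zero [simp]: "act 0 f s = 0"
  by (simp add: act_def)

lemma act_neg: "act (- x) f s = - act x f s"
  using act_scal[of "-1" x f s] by simp

lemma act_diff: "act (x - y) f s = act x f s - act y f s"
  using act_add[of x "- y" f s] by (simp add: act_neg)

lemma act_sum: "act (sum x A) f s = (\<Sum>i\<in>A. act (x i) f s)"
  by (induction A rule: infinite_finite_induct) (simp_all add: act_add)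

lemma act_mult: "act (x * y) f = act x (act y f)"
proof -
  have "act (word_elt v * y) f = act (word_elt v) (act y f)" for v
  proof (induction y rule: free_alg_induct)
    case (word w)
    then show ?case by (simp add: act_word_elt word_op_append flip: word_elt_append)
  next
    case (add x y)
    then show ?case
      by (simp add: fun_eq_iff distrib_left act_add[abs_def] act_word_elt word_op_linear)
  next
    case (scal c x)
    then show ?case
      by (simp add: fun_eq_iff scal_mult act_scal[abs_def] act_word_elt word_op_linear)
  qed
  then show ?thesis
    by (induction x rule: free_alg_induct)
      (simp_all add: fun_eq_iff distrib_right act_add act_scal scal_mult)
qed

lemma act_gens: "act (u_gen i) f = U_op i f" "act (t_gen i) f = T_op i f" "act 1 f = f"
  by (simp_all add: u_gen_def t_gen_def act_word_elt flip: word_elt_Nil)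

text \<open>
  The coefficients of the monomial \<open>1\<close>.
\<close>

definition vac :: coeffs where "vac s = (if s = ({}, {}) then 1 else 0)"

definition coeff :: "free_alg \<Rightarrow> coeffs" where "coeff x = act x vac"

lemma coeff_simps:
  "coeff (x + y) s = coeff x s + coeff y s" "coeff (x - y) s = coeff x s - coeff y s"
  "coeff (- x) s = - coeff x s" "coeff (scal c x) s = c * coeff x s" "coeff 0 s = 0"
  "coeff (sum h A) s = (\<Sum>i\<in>A. coeff (h i) s)"
  by (simp_all add: coeff_def act_add act_diff act_neg act_scal act_sum)

lemma coeff_mult: "coeff (x * y) = act x (coeff y)"
  by (simp add: coeff_def act_mult)

lemma U_op_U_op_same: "U_op i (U_op i f) = (\<lambda>_. 0)"
  by (auto simp: U_op_def fun_eq_iff)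

text \<open>
  For \<open>i < j\<close>, removing \<open>i\<close> from \<open>\<sigma>\<close> lowers the number of elements below \<open>j\<close> by one, while
  removing \<open>j\<close> leaves the number of elements below \<open>i\<close> unchanged.
\<close>

lemma U_op_anticommute:
  assumes "i \<noteq> j"
  shows "U_op i (U_op j f) s = - U_op j (U_op i f) s"
proof -
  have *: "U_op i (U_op j f) (\<sigma>, \<omega>) = - U_op j (U_op i f) (\<sigma>, \<omega>)" if "i < j" for i j \<sigma> \<omega>
  proof (cases "i \<in> \<sigma> \<and> j \<in> \<sigma>")
    case True
    have 1: "{k \<in> \<sigma> - {j}. k < i} = {k \<in> \<sigma>. k < i}"
      using that by auto
    have 2: "{k \<in> \<sigma>. k < j} = insert i {k \<in> \<sigma> - {i}. k < j}" "i \<notin> {k \<in> \<sigma> - {i}. k < j}"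
      using that True by auto
    have 3: "card {k \<in> \<sigma>. k < j} = Suc (card {k \<in> \<sigma> - {i}. k < j})"
      using 2(2) by (subst 2(1), subst card_insert_disjoint) auto
    have 4: "\<sigma> - {i} - {j} = \<sigma> - {j} - {i}" "\<omega> - {i} - {j} = \<omega> - {j} - {i}"
      by auto
    show ?thesis
      using True that unfolding U_op_def split_conv 1 3 by (simp add: 4 algebra_simps)
  qed (use that in \<open>auto simp: U_op_def\<close>)
  obtain \<sigma> \<omega> where "s = (\<sigma>, \<omega>)" by fastforce
  then show ?thesis
    using assms *[of i j] *[of j i] by (cases "i < j") auto
qed

lemma U_op_T_op_same: "U_op i (T_op i f) = U_op i f"
  by (auto simp: U_op_def T_op_def toggle_def insert_absorb fun_eq_iff)

lemma T_op_U_op_same: "T_op i (U_op i f) s = - U_op i f s"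
  by (auto simp: U_op_def T_op_def split: prod.splits)

lemma T_op_T_op_same: "T_op i (T_op i f) = f"
proof -
  have "toggle i (toggle i \<omega>) = \<omega>" for \<omega>
    by (auto simp: toggle_def)
  then show ?thesis
    by (simp add: T_op_def fun_eq_iff)
qed

lemma U_op_T_op_commute:
  assumes "i \<noteq> j" shows "U_op i (T_op j f) = T_op j (U_op i f)"
proof -
  have "toggle j (\<omega> - {i}) = toggle j \<omega> - {i}" "i \<in> toggle j \<omega> \<longleftrightarrow> i \<in> \<omega>" for \<omega>
    using assms by (auto simp: toggle_def)
  then show ?thesis
    using assms by (simp add: U_op_def T_op_def fun_eq_iff algebra_simps)
qed

lemma T_op_commute: "T_op i (T_op j f) = T_op j (T_op i f)"
proof -
  have "toggle i (toggle j \<omega>) = toggle j (toggle i \<omega>)" for \<omega>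
    by (auto simp: toggle_def)
  then show ?thesis
    by (simp add: T_op_def fun_eq_iff)
qed

lemma act_u_prod_support:
  assumes "finite \<tau>" "act (u_prod \<tau>) f (\<sigma>, \<omega>) \<noteq> 0"
  shows "\<tau> \<subseteq> \<sigma>"
proof -
  have "act (prod_list (map u_gen xs)) f (\<sigma>, \<omega>) \<noteq> 0 \<Longrightarrow> set xs \<subseteq> \<sigma>" for xs
  proof (induction xs arbitrary: \<sigma> \<omega>)
    case (Cons i xs)
    then have "i \<in> \<sigma>"
      "act (prod_list (map u_gen xs)) f (\<sigma> - {i}, \<omega>) \<noteq> 0 \<or> act (prod_list (map u_gen xs)) f (\<sigma> - {i}, \<omega> - {i}) \<noteq> 0"
      by (auto simp: act_mult act_gens U_op_def split: if_splits)
    with Cons.IH show ?case by fastforce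
  qed simp
  from this[of "sorted_list_of_set \<tau>"] assms show ?thesis
    by (simp add: u_prod_def)
qed

definition down_closed :: "nat set set \<Rightarrow> bool" where
  "down_closed K \<longleftrightarrow> (\<forall>\<sigma>\<in>K. \<forall>\<tau>. \<tau> \<subseteq> \<sigma> \<longrightarrow> \<tau> \<in> K)"

lemma act_vanishes_on_faces:
  assumes "down_closed K" "\<And>\<sigma> \<omega>. \<sigma> \<in> K \<Longrightarrow> f (\<sigma>, \<omega>) = 0" "\<sigma> \<in> K"
  shows "act x f (\<sigma>, \<omega>) = 0"
proof -
  have "\<sigma> \<in> K \<Longrightarrow> word_op w f (\<sigma>, \<omega>) = 0" for w \<sigma> \<omega>
  proof (induction w arbitrary: \<sigma> \<omega> rule: word_induct)
    case (U i w)
    then have "\<sigma> - {i} \<in> K" using assms(1) unfolding down_closed_def by blast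
    with U show ?case by (simp add: U_op_def)
  qed (use assms(2) in \<open>auto simp: T_op_def\<close>)
  with assms(3) show ?thesis by (simp add: act_def)
qed

text \<open>
  The relations act by zero. For \<open>u\<^sub>\<tau>\<close> with \<open>\<tau> \<notin> K\<close>, the image is supported on \<open>\<sigma> \<supseteq> \<tau>\<close>, and no such
  \<open>\<sigma>\<close> lies in \<open>K\<close>. Vanishing on \<open>K\<close> is preserved by all operators, as these never remove elements
  from \<open>\<sigma>\<close>.
\<close>

lemma act_RK_ideal:
  assumes K: "down_closed K" and "x \<in> RK_ideal m K" "\<sigma> \<in> K"
  shows "act x f (\<sigma>, \<omega>) = 0"
  using assms(2,3)
proof (induction arbitrary: f \<sigma> \<omega> rule: RK_ideal_induct)
  case (gen x)
  from gen(1) show ?case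
  proof (cases rule: RK_gens_cases)
    case (face \<tau>)
    show ?thesis
    proof (rule ccontr)
      assume "act x f (\<sigma>, \<omega>) \<noteq> 0"
      then have "\<tau> \<subseteq> \<sigma>"
        using face act_u_prod_support[of \<tau> f \<sigma> \<omega>] finite_subset by blast
      then show False
        using K gen(2) face(3) unfolding down_closed_def by blast
    qed
  next
    case (uu' i j)
    then show ?thesis
      using U_op_anticommute[of i j f] by (simp add: act_add act_mult act_gens)
  next
    case (tt' i j)
    then show ?thesis
      by (simp add: act_diff act_mult act_gens T_op_commute[of i j f])
  qed (simp_all add: act_add act_diff act_mult act_gens U_op_U_op_same U_op_T_op_same
      T_op_U_op_same T_op_T_op_same U_op_T_op_commute)
qed (auto simp: act_add act_mult intro: act_vanishes_on_faces[OF K])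

lemma coeff_RK_ideal:
  "down_closed K \<Longrightarrow> x \<in> RK_ideal m K \<Longrightarrow> \<sigma> \<in> K \<Longrightarrow> coeff x (\<sigma>, \<omega>) = 0"
  by (simp add: coeff_def act_RK_ideal)

lemma coeff_cong:
  "down_closed K \<Longrightarrow> cong m K x y \<Longrightarrow> \<sigma> \<in> K \<Longrightarrow> coeff x (\<sigma>, \<omega>) = coeff y (\<sigma>, \<omega>)"
  using coeff_RK_ideal[of K "x - y" m \<sigma> \<omega>] by (simp add: cong_def coeff_simps)

section \<open>Reduction to monomials\<close>

lemma gen_commute:
  assumes "gen_index g \<in> {1..m}" "gen_index h \<in> {1..m}" "gen_index g \<noteq> gen_index h"
  shows "cong m K (word_elt [g] * word_elt [h])
           (scal ((-1) ^ (u_count [g] * u_count [h])) (word_elt [h] * word_elt [g]))"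
proof (cases g; cases h)
  fix i j assume "g = UGen i" "h = UGen j"
  then show ?thesis using assms relations(5)[of i m j K] by (simp add: word_elt_gen)
next
  fix i j assume "g = UGen i" "h = TGen j"
  then show ?thesis using assms relations(6)[of i m j K] by (simp add: word_elt_gen)
next
  fix i j assume "g = TGen i" "h = UGen j"
  then show ?thesis using assms relations(6)[of j m i K] cong_sym by (simp add: word_elt_gen)
next
  fix i j assume "g = TGen i" "h = TGen j"
  then show ?thesis using assms relations(7)[of i m j K] by (simp add: word_elt_gen)
qed

lemma gen_word_commute:
  assumes "gen_index g \<in> {1..m}" "w \<in> words m" "gen_index g \<notin> gen_index ` set w"
  shows "cong m K (word_elt [g] * word_elt w)
           (scal ((-1) ^ (u_count [g] * u_count w)) (word_elt w * word_elt [g]))"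
  using assms(2,3)
proof (induction w)
  case (Cons h w)
  have h: "word_elt [h] \<in> F m" and w: "word_elt w \<in> F m" and g: "word_elt [g] \<in> F m"
    using Cons.prems assms(1) by (auto simp: word_elt_in_F)
  have "word_elt [g] * word_elt (h # w) = word_elt [g] * word_elt [h] * word_elt w"
    by (simp add: mult.assoc flip: word_elt_append)
  also have "cong m K \<dots> (scal ((-1) ^ (u_count [g] * u_count [h])) (word_elt [h] * word_elt [g]) * word_elt w)"
    using Cons.prems assms(1) w by (intro cong_right gen_commute) auto
  also have "\<dots> = scal ((-1) ^ (u_count [g] * u_count [h])) (word_elt [h] * (word_elt [g] * word_elt w))"
    by (simp add: scal_mult mult.assoc)
  also have "cong m K \<dots> (scal ((-1) ^ (u_count [g] * u_count [h])) (word_elt [h] *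
      (scal ((-1) ^ (u_count [g] * u_count w)) (word_elt w * word_elt [g]))))"
    using Cons.prems h by (intro cong_scal cong_left Cons.IH) auto
  also have "\<dots> = scal ((-1) ^ (u_count [g] * u_count (h # w))) (word_elt (h # w) * word_elt [g])"
  proof -
    have "u_count (h # w) = u_count [h] + u_count w"
      using u_count_simps(4)[of "[h]" w] by simp
    moreover have "word_elt (h # w) = word_elt [h] * word_elt w"
      by (rule word_elt_Cons)
    ultimately show ?thesis
      by (simp add: scal_mult mult.assoc power_add distrib_left)
  qed
  finally show ?case .
qed (simp add: word_elt_Nil)

text \<open>
  Letters with different indices commute up to the sign \<open>-1\<close> for each pair of \<open>u\<close>'s that changes
  places.
\<close>

lemma word_word_commute:
  assumes "v \<in> words m" "w \<in> words m" "gen_index ` set v \<inter> gen_index ` set w = {}"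
  shows "cong m K (word_elt v * word_elt w)
           (scal ((-1) ^ (u_count v * u_count w)) (word_elt w * word_elt v))"
  using assms(1,3)
proof (induction v)
  case (Cons g v)
  have v: "word_elt v \<in> F m" and w: "word_elt w \<in> F m" and g: "word_elt [g] \<in> F m"
    using Cons.prems assms(2) by (auto simp: word_elt_in_F)
  have "word_elt (g # v) * word_elt w = word_elt [g] * (word_elt v * word_elt w)"
    by (simp add: mult.assoc flip: word_elt_append)
  also have "cong m K \<dots> (word_elt [g] * scal ((-1) ^ (u_count v * u_count w)) (word_elt w * word_elt v))"
    using Cons.prems g by (intro cong_left Cons.IH) auto
  also have "\<dots> = scal ((-1) ^ (u_count v * u_count w)) (word_elt [g] * word_elt w * word_elt v)"
    by (simp add: scal_mult mult.assoc)
  also have "cong m K \<dots> (scal ((-1) ^ (u_count v * u_count w))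
      (scal ((-1) ^ (u_count [g] * u_count w)) (word_elt w * word_elt [g]) * word_elt v))"
    using Cons.prems assms(2) v by (intro cong_scal cong_right gen_word_commute) auto
  also have "\<dots> = scal ((-1) ^ (u_count (g # v) * u_count w)) (word_elt w * word_elt (g # v))"
  proof -
    have "u_count (g # v) = u_count [g] + u_count v"
      using u_count_simps(4)[of "[g]" v] by simp
    moreover have "word_elt (g # v) = word_elt [g] * word_elt v"
      by (rule word_elt_Cons)
    ultimately show ?thesis
      by (simp add: scal_mult mult.assoc power_add add_mult_distrib2 mult.commute)
  qed
  finally show ?case .
qed (simp add: word_elt_Nil)

abbreviation u_word :: "nat list \<Rightarrow> free_alg" where "u_word xs \<equiv> word_elt (map UGen xs)"
abbreviation t_word :: "nat list \<Rightarrow> free_alg" where "t_word xs \<equiv> word_elt (map TGen xs)"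

lemma u_prod_word: "u_prod \<sigma> = u_word (sorted_list_of_set \<sigma>)"
  and t_prod_word: "t_prod \<sigma> = t_word (sorted_list_of_set \<sigma>)"
proof -
  have "prod_list (map u_gen xs) = u_word xs" "prod_list (map t_gen xs) = t_word xs" for xs
    by (induction xs) (simp_all add: word_elt_Nil word_elt_gen word_elt_Cons[of _ "map _ _"])
  then show "u_prod \<sigma> = u_word (sorted_list_of_set \<sigma>)" "t_prod \<sigma> = t_word (sorted_list_of_set \<sigma>)"
    by (simp_all add: u_prod_def t_prod_def)
qed

lemma u_count_map [simp]: "u_count (map UGen xs) = length xs" "u_count (map TGen xs) = 0"
  by (induction xs) simp_all

lemma u_word_in_F: "set xs \<subseteq> {1..m} \<Longrightarrow> u_word xs \<in> F m"
  and t_word_in_F: "set xs \<subseteq> {1..m} \<Longrightarrow> t_word xs \<in> F m"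
  unfolding word_elt_in_F by auto

lemma u_word_Cons: "u_word (x # xs) = u_gen x * u_word xs"
  and t_word_Cons: "t_word (x # xs) = t_gen x * t_word xs"
  using word_elt_Cons[of _ "map _ xs"] by (simp_all add: word_elt_gen)

lemma u_gen_u_word:
  assumes "i \<in> {1..m}" "set xs \<subseteq> {1..m}" "sorted xs" "distinct xs"
  shows "cong m K (u_gen i * u_word xs)
    (if i \<in> set xs then 0 else scal ((-1) ^ card {j \<in> set xs. j < i}) (u_word (insort i xs)))"
  using assms(2-)
proof (induction xs)
  case Nil
  then show ?case by (simp add: word_elt_gen word_elt_Nil)
next
  case (Cons x xs)
  have x: "x \<in> {1..m}" "set xs \<subseteq> {1..m}" "u_gen x \<in> F m" "u_word xs \<in> F m" "u_gen i \<in> F m"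
    using Cons.prems assms(1) u_word_in_F gens_in_F by auto
  consider "i < x" | "i = x" | "x < i" by linarith
  then show ?case
  proof cases
    case 1
    then have "i \<notin> set (x # xs)" "{j \<in> set (x # xs). j < i} = {}"
      using Cons.prems by auto
    moreover have "insort i (x # xs) = i # x # xs" using 1 by simp
    ultimately show ?thesis
      using u_word_Cons[of i "x # xs"] by (simp only: if_False card.empty power_0 free_alg.scale_one cong_refl)
  next
    case 2
    have "cong m K (u_gen i * u_gen i * u_word xs) (0 * u_word xs)"
      using assms(1) x by (intro cong_right relations(1))
    with 2 show ?thesis by (simp add: u_word_Cons mult.assoc del: list.map)
  next
    case 3
    have "cong m K (u_gen i * u_gen x * u_word xs) (- (u_gen x * u_gen i) * u_word xs)"
      using assms(1) x 3 by (intro cong_right relations(5)) auto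
    also have "\<dots> = - (u_gen x * (u_gen i * u_word xs))"
      by (simp add: mult.assoc)
    also have "cong m K \<dots> (- (u_gen x * (if i \<in> set xs then 0 else scal ((-1) ^ card {j \<in> set xs. j < i}) (u_word (insort i xs)))))"
      using Cons.prems x by (intro cong_neg cong_left Cons.IH) auto
    also have "\<dots> = (if i \<in> set (x # xs) then 0 else scal ((-1) ^ card {j \<in> set (x # xs). j < i}) (u_word (insort i (x # xs))))"
    proof -
      have "{j \<in> set (x # xs). j < i} = insert x {j \<in> set xs. j < i}" "x \<notin> set xs"
        using 3 Cons.prems by auto
      then have "card {j \<in> set (x # xs). j < i} = Suc (card {j \<in> set xs. j < i})"
        by simp
      moreover have "insort i (x # xs) = x # insort i xs" using 3 by simp
      ultimately show ?thesis
        using 3 by (simp add: scal_mult u_word_Cons del: list.map insort_key.simps)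
    qed
    finally show ?thesis by (simp add: u_word_Cons mult.assoc del: list.map insort_key.simps)
  qed
qed

lemma t_gen_t_word:
  assumes "i \<in> {1..m}" "set xs \<subseteq> {1..m}" "i \<notin> set xs"
  shows "cong m K (t_gen i * t_word xs) (t_word (insort i xs))"
  using assms(2-)
proof (induction xs)
  case Nil
  then show ?case by (simp add: word_elt_gen word_elt_Nil)
next
  case (Cons x xs)
  have x: "x \<in> {1..m}" "set xs \<subseteq> {1..m}" "t_gen x \<in> F m" "t_word xs \<in> F m"
    using Cons.prems t_word_in_F gens_in_F by auto
  show ?case
  proof (cases "i \<le> x")
    case True
    then have "insort i (x # xs) = i # x # xs" by simp
    then show ?thesis
      using t_word_Cons[of i "x # xs"] by (simp only: cong_refl)
  next
    case False
    have "cong m K (t_gen i * t_gen x * t_word xs) (t_gen x * t_gen i * t_word xs)"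
      using assms(1) x False by (intro cong_right relations(7)) auto
    also have "\<dots> = t_gen x * (t_gen i * t_word xs)"
      by (simp add: mult.assoc)
    also have "cong m K \<dots> (t_gen x * t_word (insort i xs))"
      using Cons.prems x by (intro cong_left Cons.IH) auto
    finally show ?thesis
      using False by (simp add: t_word_Cons mult.assoc del: list.map)
  qed
qed

lemma t_gen_u_word:
  assumes "i \<in> {1..m}" "set xs \<subseteq> {1..m}"
  shows "cong m K (t_gen i * u_word xs) (if i \<in> set xs then - u_word xs else u_word xs * t_gen i)"
proof (cases "i \<in> set xs")
  case False
  then show ?thesis
    using gen_word_commute[of "TGen i" m "map UGen xs" K] assms
    by (auto simp: word_elt_gen image_image)
next
  case True
  have "i \<in> set xs \<Longrightarrow> cong m K (t_gen i * u_word xs) (- u_word xs)"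
    using assms(2)
  proof (induction xs)
    case (Cons x xs)
    have x: "x \<in> {1..m}" "set xs \<subseteq> {1..m}" "u_gen x \<in> F m" "u_word xs \<in> F m"
      using Cons.prems u_word_in_F gens_in_F by auto
    show ?case
    proof (cases "i = x")
      case True
      have "cong m K (t_gen i * u_gen i * u_word xs) (- u_gen i * u_word xs)"
        using assms(1) x by (intro cong_right relations)
      with True show ?thesis
        by (simp add: u_word_Cons mult.assoc del: list.map)
    next
      case False
      have "cong m K (t_gen i * u_gen x * u_word xs) (u_gen x * t_gen i * u_word xs)"
        using assms(1) x False by (intro cong_right cong_sym[OF relations(6)]) auto
      also have "\<dots> = u_gen x * (t_gen i * u_word xs)"
        by (simp add: mult.assoc)
      also have "cong m K \<dots> (u_gen x * - u_word xs)"
        using Cons.prems x False by (intro cong_left Cons.IH) auto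
      finally show ?thesis
        by (simp add: u_word_Cons mult.assoc del: list.map)
    qed
  qed simp
  with True show ?thesis by simp
qed

text \<open>
  The letter \<open>t\<^sub>i\<close> travels to the left until it meets \<open>u\<^sub>i\<close>, which absorbs it.
\<close>

lemma u_word_t_gen:
  assumes "i \<in> set xs" "set xs \<subseteq> {1..m}" "distinct xs"
  shows "cong m K (u_word xs * t_gen i) (u_word xs)"
  using assms
proof (induction xs)
  case (Cons x xs)
  have x: "x \<in> {1..m}" "set xs \<subseteq> {1..m}" "u_gen x \<in> F m" "u_word xs \<in> F m"
    using Cons.prems u_word_in_F gens_in_F by auto
  show ?case
  proof (cases "i = x")
    case True
    have "cong m K (u_word (x # xs) * t_gen i) (u_gen x * (t_gen i * u_word xs))"
      using t_gen_u_word[of i m xs K] True Cons.prems x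
      by (auto simp: u_word_Cons mult.assoc simp del: list.map intro: cong_left cong_sym)
    also have "\<dots> = u_gen x * t_gen i * u_word xs"
      by (simp add: mult.assoc)
    also have "cong m K \<dots> (u_gen x * u_word xs)"
      unfolding True using x by (intro cong_right relations)
    finally show ?thesis
      by (simp add: u_word_Cons del: list.map)
  next
    case False
    then show ?thesis
      using Cons x by (auto simp: u_word_Cons mult.assoc simp del: list.map intro!: cong_left)
  qed
qed simp

definition monomial :: "nat set \<times> nat set \<Rightarrow> free_alg" where
  "monomial = (\<lambda>(\<sigma>, \<omega>). u_prod \<sigma> * t_prod (\<omega> - \<sigma>))"

definition states :: "nat \<Rightarrow> (nat set \<times> nat set) set" where
  "states m = {(\<sigma>, \<omega>). \<sigma> \<subseteq> \<omega> \<and> \<omega> \<subseteq> {1..m}}"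

lemma statesD: "(\<sigma>, \<omega>) \<in> states m \<Longrightarrow> \<sigma> \<subseteq> \<omega> \<and> \<omega> \<subseteq> {1..m} \<and> \<sigma> \<subseteq> {1..m} \<and> finite \<sigma> \<and> finite \<omega>"
  unfolding states_def using finite_subset[of _ "{1..m}"] by auto

lemma finite_states [simp]: "finite (states m)"
  by (rule finite_subset[of _ "Pow {1..m} \<times> Pow {1..m}"]) (auto simp: states_def)

lemma monomial_in_F: "s \<in> states m \<Longrightarrow> monomial s \<in> F m"
  by (cases s) (auto simp: monomial_def dest!: statesD intro!: F_simps u_prod_in_F t_prod_in_F)

lemma u_gen_u_prod:
  assumes "i \<in> {1..m}" "\<sigma> \<subseteq> {1..m}"
  shows "cong m K (u_gen i * u_prod \<sigma>)
    (if i \<in> \<sigma> then 0 else scal ((-1) ^ card {j \<in> \<sigma>. j < i}) (u_prod (insert i \<sigma>)))"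
proof -
  have "finite \<sigma>" using assms(2) finite_subset by blast
  then show ?thesis
    using u_gen_u_word[of i m "sorted_list_of_set \<sigma>" K] assms
    by (auto simp: u_prod_word)
qed

lemma t_gen_t_prod:
  assumes "i \<in> {1..m}" "\<rho> \<subseteq> {1..m}"
  shows "cong m K (t_gen i * t_prod \<rho>) (t_prod (toggle i \<rho>))"
proof -
  have *: "cong m K (t_gen i * t_prod \<rho>) (t_prod (insert i \<rho>))" if "i \<notin> \<rho>" "\<rho> \<subseteq> {1..m}" for \<rho>
  proof -
    have "finite \<rho>" using that finite_subset by blast
    then show ?thesis
      using t_gen_t_word[of i m "sorted_list_of_set \<rho>" K] assms that
      by (auto simp: t_prod_word)
  qed
  show ?thesis
  proof (cases "i \<in> \<rho>")
    case True
    have sub: "\<rho> - {i} \<subseteq> {1..m}" using assms by auto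
    have "cong m K (t_gen i * (t_gen i * t_prod (\<rho> - {i}))) (t_gen i * t_prod (insert i (\<rho> - {i})))"
      using assms sub by (intro cong_left * gens_in_F) auto
    moreover have "cong m K (t_gen i * t_gen i * t_prod (\<rho> - {i})) (1 * t_prod (\<rho> - {i}))"
      using assms sub by (intro cong_right relations t_prod_in_F)
    ultimately show ?thesis
      using True by (auto simp: toggle_def mult.assoc insert_absorb intro: cong_trans cong_sym)
  qed (use * assms in \<open>simp add: toggle_def\<close>)
qed

lemma t_gen_u_prod:
  assumes "i \<in> {1..m}" "\<sigma> \<subseteq> {1..m}"
  shows "cong m K (t_gen i * u_prod \<sigma>) (if i \<in> \<sigma> then - u_prod \<sigma> else u_prod \<sigma> * t_gen i)"
proof -
  have "finite \<sigma>" using assms(2) finite_subset by blast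
  then show ?thesis
    using t_gen_u_word[of i m "sorted_list_of_set \<sigma>" K] assms
    by (auto simp: u_prod_word)
qed

lemma u_prod_t_gen:
  assumes "i \<in> \<sigma>" "\<sigma> \<subseteq> {1..m}"
  shows "cong m K (u_prod \<sigma> * t_gen i) (u_prod \<sigma>)"
proof -
  have "finite \<sigma>" using assms(2) finite_subset by blast
  then show ?thesis
    using u_word_t_gen[of i "sorted_list_of_set \<sigma>" m K] assms
    by (auto simp: u_prod_word)
qed

text \<open>
  If \<open>i \<in> \<omega> - \<sigma>\<close>, then \<open>t\<^sub>i\<close> is split off from \<open>t\<^bsub>\<omega> - \<sigma>\<^esub>\<close> and absorbed by the new \<open>u\<^sub>i\<close>, so
  that the index set \<open>\<omega>\<close> stays the same.
\<close>

lemma u_gen_monomial: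
  assumes i: "i \<in> {1..m}" and s: "(\<sigma>, \<omega>) \<in> states m"
  shows "cong m K (u_gen i * monomial (\<sigma>, \<omega>))
    (if i \<in> \<sigma> then 0 else scal ((-1) ^ card {j \<in> \<sigma>. j < i}) (monomial (insert i \<sigma>, insert i \<omega>)))"
proof -
  note s' = statesD[OF s]
  let ?c = "(-1) ^ card {j \<in> \<sigma>. j < i}"
  have t: "t_prod (\<omega> - \<sigma>) \<in> F m" using s' by (intro t_prod_in_F) auto
  have "u_gen i * monomial (\<sigma>, \<omega>) = u_gen i * u_prod \<sigma> * t_prod (\<omega> - \<sigma>)"
    by (simp add: monomial_def mult.assoc)
  also have "cong m K \<dots> ((if i \<in> \<sigma> then 0 else scal ?c (u_prod (insert i \<sigma>))) * t_prod (\<omega> - \<sigma>))"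
    using i s' t by (intro cong_right u_gen_u_prod) auto
  finally have 1: "cong m K (u_gen i * monomial (\<sigma>, \<omega>)) ((if i \<in> \<sigma> then 0 else scal ?c (u_prod (insert i \<sigma>))) * t_prod (\<omega> - \<sigma>))" .
  consider "i \<in> \<sigma>" | "i \<notin> \<sigma>" "i \<notin> \<omega>" | "i \<notin> \<sigma>" "i \<in> \<omega>" by blast
  then show ?thesis
  proof cases
    case i_in: 1
    with 1 show ?thesis by simp
  next
    case 2
    then have "insert i \<omega> - insert i \<sigma> = \<omega> - \<sigma>" by auto
    with 1 2 show ?thesis by (simp add: monomial_def scal_mult)
  next
    case False: 3
    let ?\<sigma> = "insert i \<sigma>"
    have sub: "?\<sigma> \<subseteq> {1..m}" "\<omega> - ?\<sigma> \<subseteq> {1..m}" using s' i by auto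
    have "toggle i (\<omega> - ?\<sigma>) = \<omega> - \<sigma>" using False by (auto simp: toggle_def)
    then have "cong m K (u_prod ?\<sigma> * t_prod (\<omega> - \<sigma>)) (u_prod ?\<sigma> * (t_gen i * t_prod (\<omega> - ?\<sigma>)))"
      using t_gen_t_prod[OF i sub(2), of K] u_prod_in_F[OF sub(1)] by (metis cong_left cong_sym)
    also have "u_prod ?\<sigma> * (t_gen i * t_prod (\<omega> - ?\<sigma>)) = u_prod ?\<sigma> * t_gen i * t_prod (\<omega> - ?\<sigma>)"
      by (simp add: mult.assoc)
    also have "cong m K \<dots> (u_prod ?\<sigma> * t_prod (\<omega> - ?\<sigma>))"
      using sub by (intro cong_right u_prod_t_gen t_prod_in_F) auto
    finally have "cong m K (u_prod ?\<sigma> * t_prod (\<omega> - \<sigma>)) (monomial (?\<sigma>, insert i \<omega>))"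
      using False by (simp add: monomial_def insert_absorb)
    from cong_scal[OF this, of ?c] show ?thesis
      using cong_trans[OF 1] False by (simp add: scal_mult)
  qed
qed

lemma t_gen_monomial:
  assumes i: "i \<in> {1..m}" and s: "(\<sigma>, \<omega>) \<in> states m"
  shows "cong m K (t_gen i * monomial (\<sigma>, \<omega>)) (if i \<in> \<sigma> then - monomial (\<sigma>, \<omega>) else monomial (\<sigma>, toggle i \<omega>))"
proof -
  note s' = statesD[OF s]
  have t: "t_prod (\<omega> - \<sigma>) \<in> F m" and u: "u_prod \<sigma> \<in> F m"
    using s' by (auto intro!: t_prod_in_F u_prod_in_F)
  have "t_gen i * monomial (\<sigma>, \<omega>) = t_gen i * u_prod \<sigma> * t_prod (\<omega> - \<sigma>)"
    by (simp add: monomial_def mult.assoc)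
  also have "cong m K \<dots> ((if i \<in> \<sigma> then - u_prod \<sigma> else u_prod \<sigma> * t_gen i) * t_prod (\<omega> - \<sigma>))"
    using i s' t by (intro cong_right t_gen_u_prod) auto
  also have "cong m K \<dots> (if i \<in> \<sigma> then - monomial (\<sigma>, \<omega>) else monomial (\<sigma>, toggle i \<omega>))"
  proof (cases "i \<in> \<sigma>")
    case False
    then have "toggle i \<omega> - \<sigma> = toggle i (\<omega> - \<sigma>)" by (auto simp: toggle_def)
    moreover have "cong m K (u_prod \<sigma> * (t_gen i * t_prod (\<omega> - \<sigma>))) (u_prod \<sigma> * t_prod (toggle i (\<omega> - \<sigma>)))"
      using i s' u by (intro cong_left t_gen_t_prod) auto
    ultimately show ?thesis
      using False by (simp add: monomial_def mult.assoc)
  qed (simp add: monomial_def)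
  finally show ?thesis .
qed

definition delta :: "rat \<Rightarrow> nat set \<times> nat set \<Rightarrow> coeffs" where
  "delta c s = (\<lambda>s'. if s' = s then c else 0)"

lemma vac_delta: "vac = delta 1 ({}, {})"
  by (simp add: vac_def delta_def fun_eq_iff)

lemma U_op_delta:
  assumes "\<sigma> \<subseteq> \<omega>"
  shows "U_op i (delta c (\<sigma>, \<omega>)) =
    delta (if i \<in> \<sigma> then 0 else (-1) ^ card {j \<in> \<sigma>. j < i} * c) (insert i \<sigma>, insert i \<omega>)"
proof (rule ext)
  fix s :: "nat set \<times> nat set"
  obtain \<sigma>' \<omega>' where s: "s = (\<sigma>', \<omega>')" by fastforce
  show "U_op i (delta c (\<sigma>, \<omega>)) s =
    delta (if i \<in> \<sigma> then 0 else (-1) ^ card {j \<in> \<sigma>. j < i} * c) (insert i \<sigma>, insert i \<omega>) s"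
  proof (cases "i \<in> \<sigma>' \<and> i \<in> \<omega>' \<and> i \<notin> \<sigma> \<and> \<sigma>' = insert i \<sigma>")
    case True
    then have 1: "\<sigma>' - {i} = \<sigma>" and 2: "{j \<in> \<sigma>'. j < i} = {j \<in> \<sigma>. j < i}" by auto
    have 3: "(\<omega>' = \<omega> \<and> i \<in> \<omega>) \<noteq> (\<omega>' - {i} = \<omega> \<and> i \<notin> \<omega>)" if "\<omega>' = insert i \<omega>"
      using that by auto
    have 4: "\<omega>' \<noteq> \<omega> \<and> \<omega>' - {i} \<noteq> \<omega>" if "\<omega>' \<noteq> insert i \<omega>"
      using that True by auto
    have 5: "\<omega>' - {i} \<noteq> \<omega>" if "i \<in> \<omega>" using that by auto
    have 6: "\<omega>' \<noteq> \<omega>" if "i \<notin> \<omega>" using that True by auto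
    show ?thesis
      unfolding s U_op_def split_conv using True 1 2 3 4 5 6
      by (cases "\<omega>' = insert i \<omega>"; cases "i \<in> \<omega>") (auto simp: delta_def)
  next
    case False
    then have "\<not> (i \<in> \<sigma>' \<and> i \<in> \<omega>') \<or> \<sigma>' - {i} \<noteq> \<sigma>" by auto
    with False show ?thesis
      unfolding s U_op_def by (auto simp: delta_def)
  qed
qed

lemma T_op_delta:
  "T_op i (delta c (\<sigma>, \<omega>)) = (if i \<in> \<sigma> then delta (- c) (\<sigma>, \<omega>) else delta c (\<sigma>, toggle i \<omega>))"
proof -
  have "toggle i \<omega>' = \<omega> \<longleftrightarrow> \<omega>' = toggle i \<omega>" for \<omega>'
    by (auto simp: toggle_def)
  then show ?thesis
    by (auto simp: T_op_def delta_def fun_eq_iff)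
qed

lemma states_insert: "(\<sigma>, \<omega>) \<in> states m \<Longrightarrow> i \<in> {1..m} \<Longrightarrow> (insert i \<sigma>, insert i \<omega>) \<in> states m"
  and states_toggle: "(\<sigma>, \<omega>) \<in> states m \<Longrightarrow> i \<in> {1..m} \<Longrightarrow> i \<notin> \<sigma> \<Longrightarrow> (\<sigma>, toggle i \<omega>) \<in> states m"
  by (auto simp: states_def toggle_def)

text \<open>
  Rewriting with the relations and acting on coefficients run in parallel: each letter turns a
  multiple of one monomial into a multiple of another, on both sides by the same rule.
\<close>

lemma word_normal_form:
  assumes "w \<in> words m"
  shows "\<exists>c. \<exists>s\<in>states m. cong m K (word_elt w) (scal c (monomial s)) \<and> coeff (word_elt w) = delta c s"
  using assms
proof (induction w rule: word_induct)
  case Nil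
  have "u_prod {} = 1" "t_prod {} = 1" by (simp_all add: u_prod_def t_prod_def)
  then show ?case
    by (intro exI[of _ 1] bexI[of _ "({}, {})"])
      (auto simp: word_elt_Nil monomial_def coeff_def act_gens vac_delta states_def)
next
  case (U i w)
  then obtain c \<sigma> \<omega> where s: "(\<sigma>, \<omega>) \<in> states m"
    and c: "cong m K (word_elt w) (scal c (monomial (\<sigma>, \<omega>)))" "coeff (word_elt w) = delta c (\<sigma>, \<omega>)"
    by auto
  have i: "i \<in> {1..m}" using U.prems by auto
  let ?c = "if i \<in> \<sigma> then 0 else (-1) ^ card {j \<in> \<sigma>. j < i} * c"
  have e: "word_elt (UGen i # w) = u_gen i * word_elt w"
    using word_elt_Cons[of "UGen i" w] by (simp add: word_elt_gen)
  have "cong m K (word_elt (UGen i # w)) (u_gen i * scal c (monomial (\<sigma>, \<omega>)))"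
    unfolding e using c(1) i gens_in_F by (intro cong_left)
  also have "\<dots> = scal c (u_gen i * monomial (\<sigma>, \<omega>))"
    by (simp add: scal_mult)
  also have "cong m K \<dots> (scal c (if i \<in> \<sigma> then 0 else scal ((-1) ^ card {j \<in> \<sigma>. j < i}) (monomial (insert i \<sigma>, insert i \<omega>))))"
    using s i by (intro cong_scal u_gen_monomial)
  also have "\<dots> = scal ?c (monomial (insert i \<sigma>, insert i \<omega>))"
    by (simp add: mult.commute)
  finally have "cong m K (word_elt (UGen i # w)) (scal ?c (monomial (insert i \<sigma>, insert i \<omega>)))" .
  moreover have "coeff (word_elt (UGen i # w)) = delta ?c (insert i \<sigma>, insert i \<omega>)"
    using statesD[OF s] by (simp add: e coeff_mult act_gens c U_op_delta)
  ultimately show ?case using states_insert[OF s i] by blast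
next
  case (T i w)
  then obtain c \<sigma> \<omega> where s: "(\<sigma>, \<omega>) \<in> states m"
    and c: "cong m K (word_elt w) (scal c (monomial (\<sigma>, \<omega>)))" "coeff (word_elt w) = delta c (\<sigma>, \<omega>)"
    by auto
  have i: "i \<in> {1..m}" using T.prems by auto
  have e: "word_elt (TGen i # w) = t_gen i * word_elt w"
    using word_elt_Cons[of "TGen i" w] by (simp add: word_elt_gen)
  have "cong m K (word_elt (TGen i # w)) (t_gen i * scal c (monomial (\<sigma>, \<omega>)))"
    unfolding e using c(1) i gens_in_F by (intro cong_left)
  also have "\<dots> = scal c (t_gen i * monomial (\<sigma>, \<omega>))"
    by (simp add: scal_mult)
  also have "cong m K \<dots> (scal c (if i \<in> \<sigma> then - monomial (\<sigma>, \<omega>) else monomial (\<sigma>, toggle i \<omega>)))"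
    using s i by (intro cong_scal t_gen_monomial)
  finally have 1: "cong m K (word_elt (TGen i # w)) (scal c (if i \<in> \<sigma> then - monomial (\<sigma>, \<omega>) else monomial (\<sigma>, toggle i \<omega>)))" .
  have 2: "coeff (word_elt (TGen i # w)) = (if i \<in> \<sigma> then delta (- c) (\<sigma>, \<omega>) else delta c (\<sigma>, toggle i \<omega>))"
    by (simp add: e coeff_mult act_gens c T_op_delta)
  show ?case
  proof (cases "i \<in> \<sigma>")
    case True
    then show ?thesis
      using 1 2 s by (intro exI[of _ "- c"] bexI[of _ "(\<sigma>, \<omega>)"]) auto
  next
    case False
    then show ?thesis
      using 1 2 states_toggle[OF s i] by (intro exI[of _ c] bexI[of _ "(\<sigma>, toggle i \<omega>)"]) auto
  qed
qed

text \<open>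
  This identifies \<open>coeff\<close> with the coordinates in \<open>R\<^sup>K\<close> and makes the monomials span it.
\<close>

lemma expansion:
  assumes "x \<in> F m"
  shows "cong m K x (\<Sum>s\<in>states m. scal (coeff x s) (monomial s))"
  using assms
proof (induction rule: F_induct)
  case (word w)
  from word_normal_form[OF word, of K] obtain c s
    where s: "s \<in> states m" "cong m K (word_elt w) (scal c (monomial s))" "coeff (word_elt w) = delta c s"
    by blast
  have "(\<Sum>s'\<in>states m. scal (coeff (word_elt w) s') (monomial s')) = (\<Sum>s'\<in>states m. if s' = s then scal c (monomial s) else 0)"
    unfolding s(3) delta_def by (intro sum.cong) auto
  with s show ?case by simp
next
  case (add x y)
  from cong_add[OF add.IH] show ?case
    by (simp add: coeff_simps free_alg.scale_left_distrib sum.distrib)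
next
  case (scal c x)
  from cong_scal[OF scal.IH, of c] show ?case
    by (simp add: coeff_simps free_alg.scale_sum_right)
qed

lemma monomial_RK_ideal:
  assumes "(\<sigma>, \<omega>) \<in> states m" "\<sigma> \<notin> K"
  shows "monomial (\<sigma>, \<omega>) \<in> RK_ideal m K"
proof -
  have "\<sigma> \<subseteq> {1..m}" "\<omega> - \<sigma> \<subseteq> {1..m}" using statesD[OF assms(1)] by auto
  then show ?thesis
    unfolding monomial_def split_conv using assms(2) by (intro RK_ideal_simps(4) cong_u_prod t_prod_in_F)
qed

text \<open>
  The ideal is described by coordinates: the monomials \<open>u\<^sub>\<sigma> t\<^bsub>\<omega> - \<sigma>\<^esub>\<close> with \<open>\<sigma> \<in> K\<close> form a basis of
  \<open>R\<^sup>K\<close>, as the others lie in the ideal.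
\<close>

lemma RK_ideal_iff:
  assumes "down_closed K" "x \<in> F m"
  shows "x \<in> RK_ideal m K \<longleftrightarrow> (\<forall>(\<sigma>, \<omega>)\<in>states m. \<sigma> \<in> K \<longrightarrow> coeff x (\<sigma>, \<omega>) = 0)"
proof
  assume "x \<in> RK_ideal m K"
  with coeff_RK_ideal[OF assms(1)] show "\<forall>(\<sigma>, \<omega>)\<in>states m. \<sigma> \<in> K \<longrightarrow> coeff x (\<sigma>, \<omega>) = 0"
    by blast
next
  assume 0: "\<forall>(\<sigma>, \<omega>)\<in>states m. \<sigma> \<in> K \<longrightarrow> coeff x (\<sigma>, \<omega>) = 0"
  have "(\<Sum>s\<in>states m. scal (coeff x s) (monomial s)) \<in> RK_ideal m K"
  proof (rule RK_ideal_sum)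
    fix s assume s: "s \<in> states m"
    obtain \<sigma> \<omega> where [simp]: "s = (\<sigma>, \<omega>)" by fastforce
    show "scal (coeff x s) (monomial s) \<in> RK_ideal m K"
      using 0 s monomial_RK_ideal[of \<sigma> \<omega> m K] by (cases "\<sigma> \<in> K") (auto simp: RK_ideal_simps)
  qed
  then show "x \<in> RK_ideal m K"
    using cong_mem[OF expansion[OF assms(2)]] by blast
qed

section \<open>Words without repeated indices\<close>

text \<open>
  The differential of a monomial consists of words that are not in normal order. What survives of
  the bigrading is recorded here: each index of \<open>\<omega>\<close> occurs once, and \<open>p\<close> of the letters are \<open>u\<close>'s.
\<close>

definition plain_words :: "nat \<Rightarrow> nat set \<Rightarrow> generator list set" where
  "plain_words p \<omega> = {w. distinct (map gen_index w) \<and> gen_index ` set w = \<omega> \<and> u_count w = p}"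

definition plain :: "nat \<Rightarrow> nat set \<Rightarrow> free_alg set" where
  "plain p \<omega> = free_alg.span (word_elt ` plain_words p \<omega>)"

lemma plain_simps:
  "0 \<in> plain p \<omega>" "x \<in> plain p \<omega> \<Longrightarrow> y \<in> plain p \<omega> \<Longrightarrow> x + y \<in> plain p \<omega>"
  "x \<in> plain p \<omega> \<Longrightarrow> - x \<in> plain p \<omega>" "x \<in> plain p \<omega> \<Longrightarrow> scal c x \<in> plain p \<omega>"
  "w \<in> plain_words p \<omega> \<Longrightarrow> word_elt w \<in> plain p \<omega>"
  unfolding plain_def
  by (auto intro: free_alg.span_zero free_alg.span_add free_alg.span_neg free_alg.span_scale free_alg.span_base)

lemma plain_induct [consumes 1, case_names zero add word]:
  assumes "x \<in> plain p \<omega>" "P 0" "\<And>x y c. P x \<Longrightarrow> P y \<Longrightarrow> P (scal c x + y)"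
    "\<And>w. w \<in> plain_words p \<omega> \<Longrightarrow> P (word_elt w)"
  shows "P x"
  using assms(1) unfolding plain_def
  by (induction rule: free_alg.span_induct_alt) (use assms in auto)

lemma plain_u_gen: "x \<in> plain p \<omega> \<Longrightarrow> i \<notin> \<omega> \<Longrightarrow> u_gen i * x \<in> plain (Suc p) (insert i \<omega>)"
  and plain_t_gen: "x \<in> plain p \<omega> \<Longrightarrow> i \<notin> \<omega> \<Longrightarrow> t_gen i * x \<in> plain p (insert i \<omega>)"
proof -
  have *: "UGen i # w \<in> plain_words (Suc p) (insert i \<omega>) \<and> TGen i # w \<in> plain_words p (insert i \<omega>)"
    if "w \<in> plain_words p \<omega>" "i \<notin> \<omega>" for w
    using that by (auto simp: plain_words_def)
  have e: "u_gen i * word_elt w = word_elt (UGen i # w)" "t_gen i * word_elt w = word_elt (TGen i # w)" for w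
    using word_elt_Cons[of _ w] by (simp_all add: word_elt_gen)
  show "x \<in> plain p \<omega> \<Longrightarrow> i \<notin> \<omega> \<Longrightarrow> u_gen i * x \<in> plain (Suc p) (insert i \<omega>)"
    by (induction rule: plain_induct) (auto simp: * e distrib_left scal_mult intro!: plain_simps)
  show "x \<in> plain p \<omega> \<Longrightarrow> i \<notin> \<omega> \<Longrightarrow> t_gen i * x \<in> plain p (insert i \<omega>)"
    by (induction rule: plain_induct) (auto simp: * e distrib_left scal_mult intro!: plain_simps)
qed

lemma free_diff_plain: "x \<in> plain p \<omega> \<Longrightarrow> free_diff x \<in> plain (Suc p) \<omega>"
proof (induction rule: plain_induct)
  case (word w)
  have "w \<in> plain_words p \<omega> \<Longrightarrow> diff_word w \<in> plain (Suc p) \<omega>" for w p \<omega>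
  proof (induction w arbitrary: p \<omega> rule: word_induct)
    case (U i w)
    then have w: "w \<in> plain_words (u_count w) (gen_index ` set w)" "i \<notin> gen_index ` set w"
      and o: "\<omega> = insert i (gen_index ` set w)" "p = Suc (u_count w)"
      by (auto simp: plain_words_def)
    show ?case unfolding o using plain_u_gen[OF U.IH[OF w(1)] w(2)] by (simp add: plain_simps)
  next
    case (T i w)
    then have w: "w \<in> plain_words (u_count w) (gen_index ` set w)" "i \<notin> gen_index ` set w"
      and o: "\<omega> = insert i (gen_index ` set w)" "p = u_count w"
      by (auto simp: plain_words_def)
    show ?case unfolding o
      using plain_t_gen[OF T.IH[OF w(1)] w(2)] plain_u_gen[OF plain_simps(5)[OF w(1)] w(2)]
      by (simp add: plain_simps)
  qed (simp add: plain_simps)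
  with word show ?case by (simp add: free_diff_word_elt)
qed (auto simp: free_diff_simps plain_simps)

lemma twist_plain: "x \<in> plain p \<omega> \<Longrightarrow> twist x = scal ((-1) ^ p) x"
  by (induction rule: plain_induct)
    (auto simp: twist_simps twist_word_elt plain_words_def free_alg.scale_right_distrib mult.commute)

text \<open>
  Sorting a word without repeated indices changes neither its set of indices nor its number of \<open>u\<close>'s.
\<close>

lemma coeff_plain:
  assumes "x \<in> plain p \<omega>" "coeff x (\<sigma>, \<omega>') \<noteq> 0"
  shows "\<omega>' = \<omega> \<and> \<sigma> \<subseteq> \<omega> \<and> card \<sigma> = p"
proof -
  have w: "word_op w vac (\<sigma>, \<omega>') \<noteq> 0 \<Longrightarrow> distinct (map gen_index w) \<Longrightarrow>
      \<omega>' = gen_index ` set w \<and> \<sigma> \<subseteq> \<omega>' \<and> card \<sigma> = u_count w" for w \<sigma> \<omega>'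
  proof (induction w arbitrary: \<sigma> \<omega>' rule: word_induct)
    case Nil
    then show ?case by (auto simp: vac_def split: if_splits)
  next
    case (U i w)
    from U.prems have i: "i \<in> \<sigma>" "i \<in> \<omega>'" "i \<notin> gen_index ` set w" and d: "distinct (map gen_index w)"
      and "word_op w vac (\<sigma> - {i}, \<omega>') \<noteq> 0 \<or> word_op w vac (\<sigma> - {i}, \<omega>' - {i}) \<noteq> 0"
      by (auto simp: U_op_def split: if_splits)
    with U.IH[OF _ d] have *: "\<omega>' - {i} = gen_index ` set w" "\<sigma> - {i} \<subseteq> \<omega>' - {i}" "card (\<sigma> - {i}) = u_count w"
      by blast+
    have "\<sigma> \<subseteq> insert i (gen_index ` set w)" using *(1,2) by blast
    then have "finite \<sigma>" by (rule finite_subset) simp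
    from card.remove[OF this i(1)] have "card \<sigma> = u_count (UGen i # w)" using *(3) by simp
    moreover have "\<omega>' = gen_index ` set (UGen i # w)" using *(1) i(2) by auto
    moreover have "\<sigma> \<subseteq> \<omega>'" using *(2) i(2) by blast
    ultimately show ?case by blast
  next
    case (T i w)
    have i: "i \<notin> gen_index ` set w" and d: "distinct (map gen_index w)" using T.prems by auto
    show ?case
    proof (cases "i \<in> \<sigma>")
      case True
      then have "word_op w vac (\<sigma>, \<omega>') \<noteq> 0" using T.prems by (simp add: T_op_def)
      from T.IH[OF this d] True i show ?thesis by blast
    next
      case False
      then have "word_op w vac (\<sigma>, toggle i \<omega>') \<noteq> 0" using T.prems by (simp add: T_op_def)
      from T.IH[OF this d] have *: "toggle i \<omega>' = gen_index ` set w" "\<sigma> \<subseteq> toggle i \<omega>'" "card \<sigma> = u_count w"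
        by auto
      have "i \<in> \<omega>'"
      proof (rule ccontr)
        assume "i \<notin> \<omega>'"
        then have "i \<in> toggle i \<omega>'" by (simp add: toggle_def)
        with *(1) i show False by simp
      qed
      then have t: "toggle i \<omega>' = \<omega>' - {i}" by (simp add: toggle_def)
      have "\<omega>' = gen_index ` set (TGen i # w)" using *(1) \<open>i \<in> \<omega>'\<close> unfolding t by auto
      moreover have "\<sigma> \<subseteq> \<omega>'" using *(2) unfolding t by blast
      ultimately show ?thesis using *(3) by simp
    qed
  qed
  from assms show ?thesis
  proof (induction rule: plain_induct)
    case (add x y c)
    then have "coeff x (\<sigma>, \<omega>') \<noteq> 0 \<or> coeff y (\<sigma>, \<omega>') \<noteq> 0"
      by (auto simp: coeff_simps)
    with add.IH show ?case by blast
  next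
    case (word v)
    then show ?case
      using w[of v \<sigma> \<omega>'] by (auto simp: coeff_def act_word_elt plain_words_def)
  qed (simp add: coeff_simps)
qed

lemma monomial_plain:
  assumes "finite \<omega>" "\<sigma> \<subseteq> \<omega>"
  shows "monomial (\<sigma>, \<omega>) \<in> plain (card \<sigma>) \<omega>"
proof -
  have "finite \<sigma>" using assms finite_subset by blast
  let ?w = "map UGen (sorted_list_of_set \<sigma>) @ map TGen (sorted_list_of_set (\<omega> - \<sigma>))"
  have "monomial (\<sigma>, \<omega>) = word_elt ?w"
    by (simp add: monomial_def u_prod_word t_prod_word word_elt_append)
  moreover have "?w \<in> plain_words (card \<sigma>) \<omega>"
    using assms \<open>finite \<sigma>\<close> by (auto simp: plain_words_def comp_def image_Un image_image)
  ultimately show ?thesis by (simp add: plain_simps)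
qed

text \<open>
  In increasing order each \<open>u\<^sub>i\<close> is inserted in front of larger indices only, so no sign arises.
\<close>

lemma coeff_monomial:
  assumes "(\<sigma>, \<omega>) \<in> states m"
  shows "coeff (monomial (\<sigma>, \<omega>)) = delta 1 (\<sigma>, \<omega>)"
proof -
  have t: "word_op (map TGen xs) vac = delta 1 ({}, set xs)" if "distinct xs" for xs
    using that by (induction xs) (auto simp: vac_delta T_op_delta toggle_def)
  have u: "word_op (map UGen xs) (delta 1 ({}, \<rho>)) = delta 1 (set xs, set xs \<union> \<rho>)"
    if "sorted xs" "distinct xs" for xs \<rho>
    using that
  proof (induction xs)
    case (Cons x xs)
    then have *: "{j \<in> set xs. j < x} = {}" by auto
    from Cons show ?case
      by (simp add: U_op_delta *)
  qed simp
  note fin = statesD[OF assms]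
  have "coeff (monomial (\<sigma>, \<omega>)) = word_op (map UGen (sorted_list_of_set \<sigma>)) (word_op (map TGen (sorted_list_of_set (\<omega> - \<sigma>))) vac)"
    by (simp add: monomial_def u_prod_word t_prod_word coeff_def act_word_elt word_op_append flip: word_elt_append)
  also have "word_op (map TGen (sorted_list_of_set (\<omega> - \<sigma>))) vac = delta 1 ({}, \<omega> - \<sigma>)"
    using fin t[of "sorted_list_of_set (\<omega> - \<sigma>)"] by simp
  also have "word_op (map UGen (sorted_list_of_set \<sigma>)) \<dots> = delta 1 (\<sigma>, \<sigma> \<union> (\<omega> - \<sigma>))"
    using fin u[of "sorted_list_of_set \<sigma>" "\<omega> - \<sigma>"] by simp
  moreover have "\<sigma> \<union> (\<omega> - \<sigma>) = \<omega>" using fin by blast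
  ultimately show ?thesis by simp
qed

section \<open>Two blocks of indices\<close>

lemma sorted_list_of_set_blocks:
  fixes \<sigma> \<tau> :: "nat set"
  assumes "\<sigma> \<subseteq> {1..m}" "finite \<tau>" "0 \<notin> \<tau>"
  shows "sorted_list_of_set (\<sigma> \<union> (+) m ` \<tau>) = sorted_list_of_set \<sigma> @ map ((+) m) (sorted_list_of_set \<tau>)"
proof -
  let ?xs = "sorted_list_of_set \<sigma>" and ?ys = "map ((+) m) (sorted_list_of_set \<tau>)"
  have \<sigma>: "finite \<sigma>" by (rule finite_subset[OF assms(1)]) simp
  have set: "set ?xs = \<sigma>" "set ?ys = (+) m ` \<tau>" using \<sigma> assms(2) by simp_all
  have le: "x < m + y" if "x \<in> \<sigma>" "y \<in> \<tau>" for x y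
  proof -
    have "x \<le> m" using assms(1) that(1) by auto
    moreover have "y \<noteq> 0" using assms(3) that(2) by metis
    ultimately show ?thesis by simp
  qed
  have "sorted ?ys" by (simp add: sorted_map)
  moreover have "x \<le> y" if "x \<in> set ?xs" "y \<in> set ?ys" for x y
    using that le unfolding set by (auto intro: less_imp_le)
  ultimately have s: "sorted (?xs @ ?ys)"
    by (simp only: sorted_append sorted_sorted_list_of_set) blast
  have "set ?xs \<inter> set ?ys = {}"
    using le unfolding set by fastforce
  then have d: "distinct (?xs @ ?ys)"
    by (simp only: distinct_append distinct_sorted_list_of_set distinct_map) simp
  have "set (sorted_list_of_set (\<sigma> \<union> (+) m ` \<tau>)) = set (?xs @ ?ys)"
    using \<sigma> assms(2) unfolding set_append set by simp
  with s d show ?thesis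
    by (intro sorted_distinct_set_unique sorted_sorted_list_of_set distinct_sorted_list_of_set)
qed

lemma shift_words: "shift m (u_word xs) = u_word (map ((+) m) xs)" "shift m (t_word xs) = t_word (map ((+) m) xs)"
  by (simp_all add: shift_word_elt comp_def)

lemma shift_u_prod: "finite \<tau> \<Longrightarrow> 0 \<notin> \<tau> \<Longrightarrow> shift m (u_prod \<tau>) = u_prod ((+) m ` \<tau>)"
  using sorted_list_of_set_blocks[of "{}" m \<tau>] by (simp add: u_prod_word shift_words)

lemma u_prod_blocks:
  "\<sigma> \<subseteq> {1..m} \<Longrightarrow> finite \<tau> \<Longrightarrow> 0 \<notin> \<tau> \<Longrightarrow> u_prod (\<sigma> \<union> (+) m ` \<tau>) = u_prod \<sigma> * shift m (u_prod \<tau>)"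
  and t_prod_blocks:
  "\<sigma> \<subseteq> {1..m} \<Longrightarrow> finite \<tau> \<Longrightarrow> 0 \<notin> \<tau> \<Longrightarrow> t_prod (\<sigma> \<union> (+) m ` \<tau>) = t_prod \<sigma> * shift m (t_prod \<tau>)"
  by (simp_all add: u_prod_word t_prod_word sorted_list_of_set_blocks word_elt_append shift_words)

lemma index_shift: "gen_index (shift_gen m g) = m + gen_index g"
  by (cases g) auto

lemma u_count_shift [simp]: "u_count (map (shift_gen m) w) = u_count w"
  by (induction w rule: word_induct) simp_all

lemma shift_commute_words:
  assumes "v \<in> words m" "w \<in> words n"
  shows "cong (m + n) K (shift m (word_elt w) * word_elt v)
    (scal ((-1) ^ (u_count w * u_count v)) (word_elt v * shift m (word_elt w)))"
proof -
  have "map (shift_gen m) w \<in> words (m + n)" "v \<in> words (m + n)"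
    using assms by (force simp: index_shift)+
  moreover have "gen_index ` set (map (shift_gen m) w) \<inter> gen_index ` set v = {}"
    using assms by (force simp: index_shift)
  ultimately show ?thesis
    using word_word_commute[of "map (shift_gen m) w" "m + n" v K] by (simp add: shift_word_elt)
qed

text \<open>
  The Koszul sign rule \<open>y x = (-1)\<^bsup>|x||y|\<^esup> x y\<close> for arbitrary elements: splitting \<open>y\<close> into its even
  part \<open>(y + twist y) / 2\<close> and its odd part \<open>(y - twist y) / 2\<close> makes both sides bilinear, and words are
  homogeneous.
\<close>

lemma shift_commute:
  assumes "x \<in> F m" "y \<in> F n"
  shows "cong (m + n) K (shift m y * x)
    (scal (1/2) (x * shift m (y + twist y) + twist x * shift m (y - twist y)))"
  using assms(2,1)
proof (induction y rule: F_induct)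
  case (word w)
  show ?case using word(2)
  proof (induction x rule: F_induct)
    case v: (word v)
    have 2: "scal (1/2) (x + x) = x" for x
      using free_alg.scale_left_distrib[of "1/2" "1/2" x] by (simp add: free_alg.scale_right_distrib)
    have two_neg: "scal (1/2) (- x - x) = - x" for x
      using 2[of "- x"] by simp
    have "scal (1/2) (word_elt v * shift m (word_elt w + twist (word_elt w)) + twist (word_elt v) * shift m (word_elt w - twist (word_elt w)))
      = scal ((-1) ^ (u_count w * u_count v)) (word_elt v * shift m (word_elt w))"
      by (cases "even (u_count w)"; cases "even (u_count v)")
        (simp_all add: twist_word_elt shift_simps scal_mult distrib_left right_diff_distrib 2 two_neg)
    then show ?case using shift_commute_words[OF v word(1)] by simp
  next
    case (add x x')
    from cong_add[OF add.IH] show ?case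
      by (simp add: distrib_left distrib_right twist_simps free_alg.scale_right_distrib add_ac)
  next
    case (scal c x)
    from cong_scal[OF scal.IH, of c] show ?case
      by (simp add: scal_mult twist_simps free_alg.scale_right_distrib mult_ac)
  qed
next
  case (add y y')
  from cong_add[OF add.IH] add.prems show ?case
    by (simp add: distrib_left distrib_right twist_simps shift_simps right_diff_distrib
        free_alg.scale_right_distrib free_alg.scale_right_diff_distrib algebra_simps)
next
  case (scal c y)
  from cong_scal[OF scal.IH, of c] scal.prems show ?case
    by (simp add: scal_mult twist_simps shift_simps distrib_left right_diff_distrib
        free_alg.scale_right_distrib free_alg.scale_right_diff_distrib mult_ac)
qed

text \<open>
  Used twice: for the map from \<open>R\<^sup>K\<close> to the algebra of the join, and with all sets admitted as faces
  on both sides.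
\<close>

lemma RK_ideal_mono:
  assumes "x \<in> RK_ideal m K" "m \<le> m'" "\<And>\<sigma>. \<sigma> \<subseteq> {1..m} \<Longrightarrow> \<sigma> \<notin> K \<Longrightarrow> \<sigma> \<notin> K'"
  shows "x \<in> RK_ideal m' K'"
  using assms(1)
proof (induction rule: RK_ideal_induct)
  case (gen x)
  have "{1..m} \<subseteq> {1..m'}" using assms(2) by auto
  then have "R_relations m \<subseteq> R_relations m'"
    unfolding R_relations_def by blast
  moreover have "u_prod \<sigma> \<in> RK_ideal m' K'" if "\<sigma> \<subseteq> {1..m}" "\<sigma> \<notin> K" for \<sigma>
    using that assms(3)[OF that] \<open>{1..m} \<subseteq> {1..m'}\<close> by (intro cong_u_prod) auto
  ultimately show ?case
    using gen R_relations_in_ideal unfolding RK_gens_def by blast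
qed (use F_mono[OF assms(2)] in \<open>auto intro: RK_ideal_simps(1-4)\<close>)

lemma cong_mono:
  assumes "cong m K x y" "m \<le> m'" "\<And>\<sigma>. \<sigma> \<subseteq> {1..m} \<Longrightarrow> \<sigma> \<notin> K \<Longrightarrow> \<sigma> \<notin> K'"
  shows "cong m' K' x y"
  using RK_ideal_mono[OF _ assms(2,3)] assms(1) unfolding cong_def by blast

lemma shift_RK_ideal:
  assumes "x \<in> RK_ideal n L" "\<And>\<tau>. \<tau> \<subseteq> {1..n} \<Longrightarrow> \<tau> \<notin> L \<Longrightarrow> (+) m ` \<tau> \<notin> K'"
  shows "shift m x \<in> RK_ideal (m + n) K'"
  using assms(1)
proof (induction rule: RK_ideal_induct)
  case (gen x)
  have i: "m + i \<in> {1..m + n}" if "i \<in> {1..n}" for i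
    using that by simp
  from gen show ?case
  proof (cases rule: RK_gens_cases)
    case (uu i)
    then show ?thesis
      using relations(1)[OF i, of i K'] by (simp add: cong_def shift_simps shift_mult shift_gens)
  next
    case (ut i)
    then show ?thesis
      using relations(2)[OF i, of i K'] by (simp add: cong_def shift_simps shift_mult shift_gens)
  next
    case (tu i)
    then show ?thesis
      using relations(3)[OF i, of i K'] by (simp add: cong_def shift_simps shift_mult shift_gens)
  next
    case (tt i)
    then show ?thesis
      using relations(4)[OF i, of i K'] by (simp add: cong_def shift_simps shift_mult shift_gens)
  next
    case (uu' i j)
    then show ?thesis
      using relations(5)[OF i i, of i j K'] by (simp add: cong_def shift_simps shift_mult shift_gens)
  next
    case (ut' i j)
    then show ?thesis
      using relations(6)[OF i i, of i j K'] by (simp add: cong_def shift_simps shift_mult shift_gens)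
  next
    case (tt' i j)
    then show ?thesis
      using relations(7)[OF i i, of i j K'] by (simp add: cong_def shift_simps shift_mult shift_gens)
  next
    case (face \<tau>)
    have "finite \<tau>" by (rule finite_subset[OF face(2)]) simp
    moreover have "0 \<notin> \<tau>" using face(2) by auto
    moreover have "(+) m ` \<tau> \<subseteq> {1..m + n}" using face(2) i by blast
    ultimately show ?thesis
      using assms(2)[OF face(2,3)] face(1) by (simp add: shift_u_prod cong_u_prod)
  qed
qed (auto simp: shift_simps shift_mult intro: RK_ideal_simps(1-4) shift_in_F)

lemma cong_shift:
  assumes "cong n L x y" "\<And>\<tau>. \<tau> \<subseteq> {1..n} \<Longrightarrow> \<tau> \<notin> L \<Longrightarrow> (+) m ` \<tau> \<notin> K'"
  shows "cong (m + n) K' (shift m x) (shift m y)"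
  using shift_RK_ideal[OF _ assms(2)] assms(1) by (simp add: cong_def flip: shift_simps)

definition join_state :: "nat \<Rightarrow> nat set \<times> nat set \<Rightarrow> nat set \<times> nat set \<Rightarrow> nat set \<times> nat set" where
  "join_state m s t = (fst s \<union> (+) m ` fst t, snd s \<union> (+) m ` snd t)"

lemma block_inj:
  fixes m n :: nat
  assumes "\<sigma> \<subseteq> {1..m}" "\<sigma>' \<subseteq> {1..m}" "\<tau> \<subseteq> {1..n}" "\<tau>' \<subseteq> {1..n}"
    and eq: "\<sigma> \<union> (+) m ` \<tau> = \<sigma>' \<union> (+) m ` \<tau>'"
  shows "\<sigma> = \<sigma>' \<and> \<tau> = \<tau>'"
proof -
  have s: "\<sigma> = (\<sigma> \<union> (+) m ` \<tau>) \<inter> {1..m}" if "\<sigma> \<subseteq> {1..m}" "\<tau> \<subseteq> {1..n}" for \<sigma> \<tau>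
  proof -
    have "m + j \<notin> {1..m}" if "j \<in> \<tau>" for j
      using \<open>\<tau> \<subseteq> {1..n}\<close> that by fastforce
    then show ?thesis using \<open>\<sigma> \<subseteq> {1..m}\<close> by blast
  qed
  have t: "\<tau> = {j \<in> {1..n}. m + j \<in> \<sigma> \<union> (+) m ` \<tau>}" if "\<sigma> \<subseteq> {1..m}" "\<tau> \<subseteq> {1..n}" for \<sigma> \<tau>
  proof -
    have "m + j \<notin> \<sigma>" if "j \<in> {1..n}" for j
      using \<open>\<sigma> \<subseteq> {1..m}\<close> that by fastforce
    then show ?thesis using \<open>\<tau> \<subseteq> {1..n}\<close> by auto
  qed
  have "\<sigma> = (\<sigma>' \<union> (+) m ` \<tau>') \<inter> {1..m}" "\<tau> = {j \<in> {1..n}. m + j \<in> \<sigma>' \<union> (+) m ` \<tau>'}"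
    using s[OF assms(1,3)] t[OF assms(1,3)] unfolding eq by (simp_all only:)
  with s[OF assms(2,4)] t[OF assms(2,4)] show ?thesis
    by (simp only:)
qed

definition left_block :: "nat \<Rightarrow> nat set \<Rightarrow> nat set" where
  "left_block m \<omega> = \<omega> \<inter> {1..m}"

definition right_block :: "nat \<Rightarrow> nat \<Rightarrow> nat set \<Rightarrow> nat set" where
  "right_block m n \<omega> = {j \<in> {1..n}. m + j \<in> \<omega>}"

lemma block_decomposition:
  assumes "\<omega> \<subseteq> {1..m + n}"
  shows "\<omega> = left_block m \<omega> \<union> (+) m ` right_block m n \<omega>"
proof -
  have "x \<in> (+) m ` right_block m n \<omega>" if "x \<in> \<omega>" "x \<notin> {1..m}" for x
    using assms that by (intro image_eqI[of _ _ "x - m"]) (auto simp: right_block_def)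
  moreover have "(+) m ` right_block m n \<omega> \<subseteq> \<omega>"
    by (auto simp: right_block_def)
  ultimately show ?thesis
    unfolding left_block_def by blast
qed

lemma block_subsets: "left_block m \<omega> \<subseteq> {1..m}" "right_block m n \<omega> \<subseteq> {1..n}"
  by (auto simp: left_block_def right_block_def)

lemma block_split:
  fixes m n :: nat
  assumes "\<omega> \<subseteq> {1..m + n}"
  obtains \<sigma> \<tau> where "\<sigma> \<subseteq> {1..m}" "\<tau> \<subseteq> {1..n}" "\<omega> = \<sigma> \<union> (+) m ` \<tau>"
  using that[OF block_subsets block_decomposition[OF assms]] .

lemma block_subset:
  fixes m n :: nat
  assumes "\<sigma> \<subseteq> {1..m}" "\<sigma>' \<subseteq> {1..m}" "\<tau> \<subseteq> {1..n}" "\<tau>' \<subseteq> {1..n}"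
  shows "\<sigma> \<union> (+) m ` \<tau> \<subseteq> \<sigma>' \<union> (+) m ` \<tau>' \<longleftrightarrow> \<sigma> \<subseteq> \<sigma>' \<and> \<tau> \<subseteq> \<tau>'"
proof
  assume "\<sigma> \<union> (+) m ` \<tau> \<subseteq> \<sigma>' \<union> (+) m ` \<tau>'"
  then have "(\<sigma> \<union> \<sigma>') \<union> (+) m ` (\<tau> \<union> \<tau>') = \<sigma>' \<union> (+) m ` \<tau>'" by blast
  from block_inj[OF _ _ _ _ this, of n] assms show "\<sigma> \<subseteq> \<sigma>' \<and> \<tau> \<subseteq> \<tau>'" by blast
qed blast

lemma bij_join_state:
  "bij_betw (\<lambda>(s, t). join_state m s t) (states m \<times> states n) (states (m + n))"
  unfolding bij_betw_def
proof
  show "inj_on (\<lambda>(s, t). join_state m s t) (states m \<times> states n)"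
  proof (rule inj_onI)
    fix p q assume p: "p \<in> states m \<times> states n" and q: "q \<in> states m \<times> states n"
      and pq: "(case p of (s, t) \<Rightarrow> join_state m s t) = (case q of (s, t) \<Rightarrow> join_state m s t)"
    obtain \<sigma> \<omega> \<tau> \<upsilon> where p': "p = ((\<sigma>, \<omega>), (\<tau>, \<upsilon>))" by (metis surj_pair)
    obtain \<sigma>' \<omega>' \<tau>' \<upsilon>' where q': "q = ((\<sigma>', \<omega>'), (\<tau>', \<upsilon>'))" by (metis surj_pair)
    have s: "(\<sigma>, \<omega>) \<in> states m" "(\<tau>, \<upsilon>) \<in> states n" "(\<sigma>', \<omega>') \<in> states m" "(\<tau>', \<upsilon>') \<in> states n"
      and e: "join_state m (\<sigma>, \<omega>) (\<tau>, \<upsilon>) = join_state m (\<sigma>', \<omega>') (\<tau>', \<upsilon>')"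
      using p q pq unfolding p' q' by auto
    note s' = s[THEN statesD]
    have "\<sigma> \<union> (+) m ` \<tau> = \<sigma>' \<union> (+) m ` \<tau>'" "\<omega> \<union> (+) m ` \<upsilon> = \<omega>' \<union> (+) m ` \<upsilon>'"
      using e by (auto simp: join_state_def)
    from block_inj[OF _ _ _ _ this(1), of n] block_inj[OF _ _ _ _ this(2), of n] s'
    have "\<sigma> = \<sigma>' \<and> \<tau> = \<tau>'" "\<omega> = \<omega>' \<and> \<upsilon> = \<upsilon>'" by blast+
    then show "p = q" unfolding p' q' by simp
  qed
  show "(\<lambda>(s, t). join_state m s t) ` (states m \<times> states n) = states (m + n)"
  proof (intro equalityI subsetI)
    fix r assume "r \<in> (\<lambda>(s, t). join_state m s t) ` (states m \<times> states n)"
    then obtain \<sigma> \<omega> \<tau> \<upsilon> where s: "(\<sigma>, \<omega>) \<in> states m" "(\<tau>, \<upsilon>) \<in> states n"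
      and r: "r = (\<sigma> \<union> (+) m ` \<tau>, \<omega> \<union> (+) m ` \<upsilon>)"
      by (auto simp: join_state_def)
    note s' = s[THEN statesD]
    have "(+) m ` \<upsilon> \<subseteq> {1..m + n}" "\<omega> \<subseteq> {1..m + n}"
      using s' by auto
    moreover have "\<sigma> \<union> (+) m ` \<tau> \<subseteq> \<omega> \<union> (+) m ` \<upsilon>" using s' by blast
    ultimately show "r \<in> states (m + n)"
      unfolding r states_def by blast
  next
    fix r assume r: "r \<in> states (m + n)"
    obtain \<alpha> \<beta> where ab: "r = (\<alpha>, \<beta>)" by fastforce
    with r have sub: "\<alpha> \<subseteq> {1..m+n}" "\<beta> \<subseteq> {1..m+n}" "\<alpha> \<subseteq> \<beta>" by (auto simp: states_def)
    obtain \<sigma> \<tau> where 1: "\<sigma> \<subseteq> {1..m}" "\<tau> \<subseteq> {1..n}" "\<alpha> = \<sigma> \<union> (+) m ` \<tau>" using block_split[OF sub(1)] .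
    obtain \<omega> \<upsilon> where 2: "\<omega> \<subseteq> {1..m}" "\<upsilon> \<subseteq> {1..n}" "\<beta> = \<omega> \<union> (+) m ` \<upsilon>" using block_split[OF sub(2)] .
    have "\<sigma> \<subseteq> \<omega> \<and> \<tau> \<subseteq> \<upsilon>"
      using block_subset[OF 1(1) 2(1) 1(2) 2(2)] sub(3) 1(3) 2(3) by simp
    with 1 2 have "((\<sigma>, \<omega>), (\<tau>, \<upsilon>)) \<in> states m \<times> states n" by (auto simp: states_def)
    moreover have "r = (\<lambda>(s, t). join_state m s t) ((\<sigma>, \<omega>), (\<tau>, \<upsilon>))"
      using 1 2 ab by (simp add: join_state_def)
    ultimately show "r \<in> (\<lambda>(s, t). join_state m s t) ` (states m \<times> states n)" by (rule rev_image_eqI)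
  qed
qed

lemma join_state_in: "s \<in> states m \<Longrightarrow> t \<in> states n \<Longrightarrow> join_state m s t \<in> states (m + n)"
  using bij_betwE[OF bij_join_state[of m n]] by fastforce

lemma join_state_inj:
  "s \<in> states m \<Longrightarrow> t \<in> states n \<Longrightarrow> s' \<in> states m \<Longrightarrow> t' \<in> states n \<Longrightarrow>
    join_state m s t = join_state m s' t' \<longleftrightarrow> s = s' \<and> t = t'"
  using bij_betw_imp_inj_on[OF bij_join_state[of m n], THEN inj_onD, of "(s, t)" "(s', t')"] by auto

lemma sum_join_states:
  "(\<Sum>r\<in>states (m + n). f r) = (\<Sum>s\<in>states m. \<Sum>t\<in>states n. f (join_state m s t))"
  using sum.reindex_bij_betw[OF bij_join_state[of m n], of f]
  by (simp add: sum.cartesian_product split_def)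

text \<open>
  In \<open>u\<^sub>\<sigma> u\<^bsub>m+\<tau>\<^esub> t\<^sub>\<rho> t\<^bsub>m+\<rho>'\<^esub>\<close> the two middle factors commute without sign, since \<open>t\<close>'s have degree
  zero.
\<close>

lemma monomial_join_state:
  assumes "s \<in> states m" "t \<in> states n"
  shows "cong (m + n) K (monomial (join_state m s t)) (monomial s * shift m (monomial t))"
proof -
  obtain \<sigma> \<omega> \<tau> \<upsilon> where st: "s = (\<sigma>, \<omega>)" "t = (\<tau>, \<upsilon>)" by fastforce
  note s = statesD[OF assms(1)[unfolded st]] and t = statesD[OF assms(2)[unfolded st]]
  have 0: "0 \<notin> \<tau>" "0 \<notin> \<upsilon>" using t by auto
  have sub: "\<omega> - \<sigma> \<subseteq> {1..m}" "\<upsilon> - \<tau> \<subseteq> {1..n}" using s t by auto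
  have "(\<omega> \<union> (+) m ` \<upsilon>) - (\<sigma> \<union> (+) m ` \<tau>) = (\<omega> - \<sigma>) \<union> (+) m ` (\<upsilon> - \<tau>)"
  proof -
    have "x \<noteq> m + y" if "x \<in> \<omega> \<or> x \<in> \<sigma>" "y \<in> \<upsilon> \<or> y \<in> \<tau>" for x y
    proof -
      have "x \<le> m" using s that(1) by auto
      moreover have "1 \<le> y" using t that(2) by auto
      ultimately show ?thesis by simp
    qed
    then have "\<omega> \<inter> (+) m ` \<tau> = {}" "\<sigma> \<inter> (+) m ` \<upsilon> = {}" by blast+
    moreover have "(+) m ` \<upsilon> - (+) m ` \<tau> = (+) m ` (\<upsilon> - \<tau>)"
      by (simp add: image_set_diff)
    ultimately show ?thesis by blast
  qed
  then have "monomial (join_state m s t) = u_prod (\<sigma> \<union> (+) m ` \<tau>) * t_prod ((\<omega> - \<sigma>) \<union> (+) m ` (\<upsilon> - \<tau>))"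
    by (simp add: monomial_def join_state_def st)
  also have "\<dots> = u_prod \<sigma> * (shift m (u_prod \<tau>) * t_prod (\<omega> - \<sigma>)) * shift m (t_prod (\<upsilon> - \<tau>))"
    using s t 0 sub by (simp add: u_prod_blocks t_prod_blocks mult.assoc)
  also have "cong (m + n) K \<dots> (u_prod \<sigma> * (t_prod (\<omega> - \<sigma>) * shift m (u_prod \<tau>)) * shift m (t_prod (\<upsilon> - \<tau>)))"
  proof (intro cong_right cong_left)
    have w: "map UGen (sorted_list_of_set \<tau>) \<in> words n" "map TGen (sorted_list_of_set (\<omega> - \<sigma>)) \<in> words m"
      using s t by auto
    show "cong (m + n) K (shift m (u_prod \<tau>) * t_prod (\<omega> - \<sigma>)) (t_prod (\<omega> - \<sigma>) * shift m (u_prod \<tau>))"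
      using shift_commute_words[OF w(2,1), of K] by (simp add: u_prod_word t_prod_word)
    show "u_prod \<sigma> \<in> F (m + n)" using s by (intro u_prod_in_F) auto
    show "shift m (t_prod (\<upsilon> - \<tau>)) \<in> F (m + n)" using sub by (intro shift_in_F t_prod_in_F)
  qed
  also have "\<dots> = monomial s * shift m (monomial t)"
    by (simp add: monomial_def st shift_mult mult.assoc)
  finally show ?thesis .
qed

lemma block_in_F: "a \<in> F m \<Longrightarrow> b \<in> F n \<Longrightarrow> a * shift m b \<in> F (m + n)"
  using F_mono[of m "m + n"] by (intro F_simps shift_in_F) auto

text \<open>
  Both sides are computed modulo the relations alone, that is with all sets admitted as faces, where
  every monomial is a basis element.
\<close>

lemma coeff_blocks:
  assumes "a \<in> F m" "b \<in> F n" "s \<in> states m" "t \<in> states n"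
  shows "coeff (a * shift m b) (join_state m s t) = coeff a s * coeff b t"
proof -
  let ?a = "\<Sum>s\<in>states m. scal (coeff a s) (monomial s)" and ?b = "\<Sum>t\<in>states n. scal (coeff b t) (monomial t)"
  have "?a \<in> F m" by (intro F_sum F_simps monomial_in_F)
  then have "?a \<in> F (m + n)" using F_mono[of m "m + n"] by auto
  then have "cong (m + n) UNIV (a * shift m b) (?a * shift m ?b)"
    using assms(1,2)
    by (intro cong_mult cong_shift[OF expansion[of _ _ UNIV]] cong_mono[OF expansion[of _ _ UNIV]] shift_in_F) auto
  also have "?a * shift m ?b = (\<Sum>s'\<in>states m. \<Sum>t'\<in>states n. scal (coeff a s' * coeff b t') (monomial s' * shift m (monomial t')))"
    by (simp add: shift_simps sum_product scal_mult mult.commute)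
  also have "cong (m + n) UNIV \<dots> (\<Sum>s'\<in>states m. \<Sum>t'\<in>states n. scal (coeff a s' * coeff b t') (monomial (join_state m s' t')))"
    by (intro cong_sum cong_scal cong_sym[OF monomial_join_state])
  finally have "coeff (a * shift m b) (join_state m s t) =
      coeff (\<Sum>s'\<in>states m. \<Sum>t'\<in>states n. scal (coeff a s' * coeff b t') (monomial (join_state m s' t'))) (join_state m s t)"
    using coeff_cong[of UNIV] by (cases "join_state m s t") (simp add: down_closed_def)
  also have "\<dots> = (\<Sum>s'\<in>states m. \<Sum>t'\<in>states n. coeff a s' * coeff b t' * (if s' = s \<and> t' = t then 1 else 0))"
    unfolding coeff_simps
  proof (intro sum.cong refl arg_cong2[of _ _ _ _ "(*)"])
    fix s' t' assume "s' \<in> states m" "t' \<in> states n"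
    then show "coeff (monomial (join_state m s' t')) (join_state m s t) = (if s' = s \<and> t' = t then 1 else 0)"
      using assms(3,4) coeff_monomial[of "fst (join_state m s' t')" "snd (join_state m s' t')" "m + n"]
        join_state_in[of s' m t' n] join_state_inj[of s m t n s' t']
      by (auto simp: delta_def)
  qed
  also have "\<dots> = (\<Sum>s'\<in>states m. if s' = s then coeff a s else 0) * (\<Sum>t'\<in>states n. if t' = t then coeff b t else 0)"
    unfolding sum_product by (intro sum.cong refl) simp
  also have "\<dots> = coeff a s * coeff b t"
    using assms(3,4) by simp
  finally show ?thesis .
qed

section \<open>Operators on the tensor product\<close>

text \<open>
  The linear maps that descend to \<open>R\<^sup>K\<close>.
\<close>

definition endo :: "nat \<Rightarrow> nat set set \<Rightarrow> (free_alg \<Rightarrow> free_alg) \<Rightarrow> bool" where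
  "endo m K f \<longleftrightarrow> lin f \<and> (\<forall>x\<in>F m. f x \<in> F m) \<and> (\<forall>x\<in>RK_ideal m K. f x \<in> RK_ideal m K)"

lemma endoD:
  assumes "endo m K f"
  shows "lin f" "x \<in> F m \<Longrightarrow> f x \<in> F m" "x \<in> RK_ideal m K \<Longrightarrow> f x \<in> RK_ideal m K"
  using assms by (auto simp: endo_def)

lemma endo_cong: "endo m K f \<Longrightarrow> cong m K x y \<Longrightarrow> cong m K (f x) (f y)"
  unfolding cong_def endo_def by (metis lin_simps(3))

lemma endo_id: "endo m K (\<lambda>x. x)"
  by (simp add: endo_def lin_ident)

lemma endo_free_diff: "endo m K free_diff"
  by (simp add: endo_def lin_free_diff free_diff_in_F free_diff_RK_ideal)

lemma endo_twist: "endo m K twist"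
  by (simp add: endo_def lin_twist twist_in_F twist_RK_ideal)

lemma endo_compose: "endo m K f \<Longrightarrow> endo m K g \<Longrightarrow> endo m K (\<lambda>x. f (g x))"
  by (simp add: endo_def lin_compose)

lemma endo_add: "endo m K f \<Longrightarrow> endo m K g \<Longrightarrow> endo m K (\<lambda>x. f x + g x)"
  by (simp add: endo_def lin_plus F_simps RK_ideal_simps)

text \<open>
  The operator \<open>f \<otimes> g\<close> on \<open>R\<^sup>K \<otimes> R\<^sup>L\<close>, defined through the basis of monomials. No sign is
  inserted; where the Koszul rule requires one, it is put into \<open>f\<close> as a factor \<open>twist\<close>.
\<close>

definition tensor :: "nat \<Rightarrow> nat \<Rightarrow> (free_alg \<Rightarrow> free_alg) \<Rightarrow> (free_alg \<Rightarrow> free_alg) \<Rightarrow> free_alg \<Rightarrow> free_alg" where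
  "tensor m n f g x = (\<Sum>s\<in>states m. \<Sum>t\<in>states n.
     scal (coeff x (join_state m s t)) (f (monomial s) * shift m (g (monomial t))))"

locale two_complexes =
  fixes m n :: nat and K L :: "nat set set"
  assumes down_K: "down_closed K" and empty_K: "{} \<in> K" and K_subset: "K \<subseteq> Pow {1..m}"
    and down_L: "down_closed L" and empty_L: "{} \<in> L" and L_subset: "L \<subseteq> Pow {1..n}"
begin

abbreviation "J \<equiv> simplicial_join m K L"

lemma block_in_join:
  assumes "\<sigma> \<subseteq> {1..m}" "\<tau> \<subseteq> {1..n}"
  shows "\<sigma> \<union> (+) m ` \<tau> \<in> J \<longleftrightarrow> \<sigma> \<in> K \<and> \<tau> \<in> L"
proof
  assume "\<sigma> \<union> (+) m ` \<tau> \<in> J"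
  then obtain \<sigma>' \<tau>' where *: "\<sigma>' \<in> K" "\<tau>' \<in> L" "\<sigma> \<union> (+) m ` \<tau> = \<sigma>' \<union> (+) m ` \<tau>'"
    unfolding simplicial_join_def by blast
  moreover have "\<sigma>' \<subseteq> {1..m}" "\<tau>' \<subseteq> {1..n}" using * K_subset L_subset by auto
  ultimately show "\<sigma> \<in> K \<and> \<tau> \<in> L"
    using block_inj[OF assms(1) _ assms(2) _ *(3)] by blast
qed (auto simp: simplicial_join_def)

lemma J_subset: "J \<subseteq> Pow {1..m + n}"
proof -
  have "\<sigma> \<union> (+) m ` \<tau> \<subseteq> {1..m + n}" if "\<sigma> \<in> K" "\<tau> \<in> L" for \<sigma> \<tau>
    using K_subset L_subset that by fastforce
  then show ?thesis unfolding simplicial_join_def by blast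
qed

lemma down_J: "down_closed J"
  unfolding down_closed_def
proof (intro ballI allI impI)
  fix \<rho> \<rho>' assume r: "\<rho> \<in> J" "\<rho>' \<subseteq> \<rho>"
  have "\<rho> \<subseteq> {1..m + n}" using r(1) J_subset by blast
  then have "\<rho>' \<subseteq> {1..m + n}" using r(2) by blast
  from block_split[OF this] obtain \<sigma> \<tau>
    where 1: "\<sigma> \<subseteq> {1..m}" "\<tau> \<subseteq> {1..n}" "\<rho>' = \<sigma> \<union> (+) m ` \<tau>" .
  obtain \<sigma>' \<tau>' where 2: "\<sigma>' \<subseteq> {1..m}" "\<tau>' \<subseteq> {1..n}" "\<rho> = \<sigma>' \<union> (+) m ` \<tau>'"
    using block_split[OF \<open>\<rho> \<subseteq> {1..m + n}\<close>] .
  have "\<sigma> \<subseteq> \<sigma>'" "\<tau> \<subseteq> \<tau>'" using block_subset[OF 1(1) 2(1) 1(2) 2(2)] r(2) 1(3) 2(3) by simp_all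
  moreover have "\<sigma>' \<in> K" "\<tau>' \<in> L" using block_in_join[OF 2(1,2)] r(1) 2(3) by simp_all
  ultimately have "\<sigma> \<in> K" "\<tau> \<in> L"
    using down_K down_L unfolding down_closed_def by blast+
  then show "\<rho>' \<in> J"
    using block_in_join[OF 1(1,2)] 1(3) by simp
qed

lemma K_ideal_J: "x \<in> RK_ideal m K \<Longrightarrow> x \<in> RK_ideal (m + n) J"
  by (erule RK_ideal_mono) (use block_in_join[of _ "{}"] in auto)

lemma shift_ideal_J: "y \<in> RK_ideal n L \<Longrightarrow> shift m y \<in> RK_ideal (m + n) J"
  by (erule shift_RK_ideal) (use block_in_join[of "{}"] in auto)

lemma cong_J_left: "cong m K x y \<Longrightarrow> cong (m + n) J x y"
  using K_ideal_J by (simp add: cong_def)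

lemma cong_J_right: "cong n L x y \<Longrightarrow> cong (m + n) J (shift m x) (shift m y)"
  using shift_ideal_J[of "x - y"] by (simp add: cong_def shift_simps)

lemma cong_J_mult:
  assumes "cong m K a a'" "cong n L b b'" "a' \<in> F m" "b \<in> F n"
  shows "cong (m + n) J (a * shift m b) (a' * shift m b')"
  using assms F_mono[of m "m + n"]
  by (intro cong_mult cong_J_left cong_J_right shift_in_F) auto

lemma ideal_J_mult:
  assumes "a \<in> F m" "b \<in> F n" "a \<in> RK_ideal m K \<or> b \<in> RK_ideal n L"
  shows "a * shift m b \<in> RK_ideal (m + n) J"
  using assms(3)
proof
  assume "a \<in> RK_ideal m K"
  then show ?thesis using assms by (intro RK_ideal_simps(4) K_ideal_J shift_in_F)
next
  assume "b \<in> RK_ideal n L"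
  moreover have "a \<in> F (m + n)" using assms F_mono[of m "m + n"] by auto
  ultimately show ?thesis by (intro RK_ideal_simps(3) shift_ideal_J)
qed

lemma lin_tensor: "lin (tensor m n f g)"
  by (rule linI) (simp_all add: tensor_def coeff_simps free_alg.scale_left_distrib sum.distrib
      free_alg.scale_sum_right)

lemma endo_tensor:
  assumes f: "endo m K f" and g: "endo n L g"
  shows "endo (m + n) J (tensor m n f g)"
  unfolding endo_def
proof (intro conjI ballI lin_tensor)
  have fg: "f (monomial s) \<in> F m" "g (monomial t) \<in> F n" if "s \<in> states m" "t \<in> states n" for s t
    using endoD(2)[OF f] endoD(2)[OF g] monomial_in_F that by auto
  show "tensor m n f g x \<in> F (m + n)" for x
    unfolding tensor_def by (intro F_sum F_simps(7) block_in_F fg)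
  fix x assume x: "x \<in> RK_ideal (m + n) J"
  show "tensor m n f g x \<in> RK_ideal (m + n) J"
    unfolding tensor_def
  proof (intro RK_ideal_sum)
    fix s t assume st: "s \<in> states m" "t \<in> states n"
    obtain \<sigma> \<omega> \<tau> \<upsilon> where e: "s = (\<sigma>, \<omega>)" "t = (\<tau>, \<upsilon>)" by fastforce
    show "scal (coeff x (join_state m s t)) (f (monomial s) * shift m (g (monomial t))) \<in> RK_ideal (m + n) J"
    proof (cases "\<sigma> \<in> K \<and> \<tau> \<in> L")
      case True
      then have "\<sigma> \<union> (+) m ` \<tau> \<in> J" using K_subset L_subset by (subst block_in_join) auto
      then have "coeff x (join_state m s t) = 0"
        unfolding e join_state_def using coeff_RK_ideal[OF down_J x] by simp
      then show ?thesis by (simp add: RK_ideal_simps)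
    next
      case False
      then have "monomial s \<in> RK_ideal m K \<or> monomial t \<in> RK_ideal n L"
        using monomial_RK_ideal st unfolding e by blast
      then show ?thesis
        using endoD(3)[OF f] endoD(3)[OF g] st by (intro RK_ideal_simps(7) ideal_J_mult fg) auto
    qed
  qed
qed

lemma tensor_mult:
  assumes f: "endo m K f" and g: "endo n L g" and "a \<in> F m" "b \<in> F n"
  shows "cong (m + n) J (tensor m n f g (a * shift m b)) (f a * shift m (g b))"
proof -
  let ?a = "\<Sum>s\<in>states m. scal (coeff a s) (monomial s)" and ?b = "\<Sum>t\<in>states n. scal (coeff b t) (monomial t)"
  have "tensor m n f g (a * shift m b) = (\<Sum>s\<in>states m. \<Sum>t\<in>states n. scal (coeff a s * coeff b t) (f (monomial s) * shift m (g (monomial t))))"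
    unfolding tensor_def using assms(3,4) by (intro sum.cong refl) (simp add: coeff_blocks)
  also have "\<dots> = f ?a * shift m (g ?b)"
    by (simp add: lin_simps[OF endoD(1)[OF f]] lin_simps[OF endoD(1)[OF g]] shift_simps sum_product scal_mult mult.commute)
  also have "cong (m + n) J \<dots> (f a * shift m (g b))"
    using assms
    by (intro cong_J_mult endo_cong[OF f] endo_cong[OF g] cong_sym[OF expansion] endoD(2)[OF f] endoD(2)[OF g])
      (auto intro!: F_sum F_simps monomial_in_F)
  finally show ?thesis .
qed

text \<open>
  Modulo the ideal of the join, every element is a combination of products of a monomial of \<open>R\<^sup>K\<close>
  and one of \<open>R\<^sup>L\<close>.
\<close>

lemma agree_on_blocks:
  assumes f: "endo (m + n) J f" and g: "endo (m + n) J g" and "x \<in> F (m + n)"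
    and e: "\<And>s t. s \<in> states m \<Longrightarrow> t \<in> states n \<Longrightarrow>
      cong (m + n) J (f (monomial s * shift m (monomial t))) (g (monomial s * shift m (monomial t)))"
  shows "cong (m + n) J (f x) (g x)"
proof -
  let ?x = "\<Sum>r\<in>states (m + n). scal (coeff x r) (monomial r)"
  have r: "cong (m + n) J (f (monomial (join_state m s t))) (g (monomial (join_state m s t)))"
    if "s \<in> states m" "t \<in> states n" for s t
    using endo_cong[OF f monomial_join_state[OF that]] e[OF that] cong_sym[OF endo_cong[OF g monomial_join_state[OF that]]]
    by (blast intro: cong_trans)
  have "cong (m + n) J (f x) (f ?x)"
    by (rule endo_cong[OF f expansion[OF assms(3)]])
  also have "f ?x = (\<Sum>s\<in>states m. \<Sum>t\<in>states n. scal (coeff x (join_state m s t)) (f (monomial (join_state m s t))))"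
    by (simp add: lin_simps[OF endoD(1)[OF f]] sum_join_states)
  also have "cong (m + n) J \<dots> (\<Sum>s\<in>states m. \<Sum>t\<in>states n. scal (coeff x (join_state m s t)) (g (monomial (join_state m s t))))"
    by (intro cong_sum cong_scal r)
  also have "\<dots> = g ?x"
    by (simp add: lin_simps[OF endoD(1)[OF g]] sum_join_states)
  also have "cong (m + n) J \<dots> (g x)"
    by (rule cong_sym[OF endo_cong[OF g expansion[OF assms(3)]]])
  finally show ?thesis .
qed

text \<open>
  If \<open>h\<close> has odd degree, then \<open>h \<otimes> 1\<close> commutes in the graded sense with the summand \<open>1 \<otimes> d\<close> of the
  differential, and only \<open>(d h + h d) \<otimes> 1\<close> remains.
\<close>

lemma homotopy_left:
  assumes h: "endo m K h" and "x \<in> F (m + n)"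
    and odd: "\<And>s. s \<in> states m \<Longrightarrow> cong m K (h (twist (monomial s))) (- twist (h (monomial s)))"
  shows "cong (m + n) J (free_diff (tensor m n h (\<lambda>b. b) x) + tensor m n h (\<lambda>b. b) (free_diff x))
    (tensor m n (\<lambda>a. free_diff (h a) + h (free_diff a)) (\<lambda>b. b) x)"
proof (rule agree_on_blocks[of "\<lambda>x. free_diff (tensor m n h (\<lambda>b. b) x) + tensor m n h (\<lambda>b. b) (free_diff x)"
      "tensor m n (\<lambda>a. free_diff (h a) + h (free_diff a)) (\<lambda>b. b)"])
  note t = endo_tensor[OF h endo_id]
  note h' = endo_add[OF endo_compose[OF endo_free_diff h] endo_compose[OF h endo_free_diff]]
  show "endo (m + n) J (\<lambda>x. free_diff (tensor m n h (\<lambda>b. b) x) + tensor m n h (\<lambda>b. b) (free_diff x))"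
    by (intro endo_add endo_compose[OF endo_free_diff t] endo_compose[OF t endo_free_diff])
  show "endo (m + n) J (tensor m n (\<lambda>a. free_diff (h a) + h (free_diff a)) (\<lambda>b. b))"
    by (intro endo_tensor endo_id h')
  fix s t assume st: "s \<in> states m" "t \<in> states n"
  define a b where "a = monomial s" and "b = monomial t"
  have ab: "a \<in> F m" "b \<in> F n" using st by (auto simp: a_def b_def monomial_in_F)
  note in_F = ab endoD(2)[OF h] free_diff_in_F twist_in_F
  have "cong (m + n) J (free_diff (tensor m n h (\<lambda>b. b) (a * shift m b))) (free_diff (h a * shift m b))"
    using ab by (intro cong_free_diff tensor_mult h endo_id)
  also have "free_diff (h a * shift m b) = free_diff (h a) * shift m b + twist (h a) * shift m (free_diff b)"
    by (simp add: free_diff_mult free_diff_shift)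
  finally have 1: "cong (m + n) J (free_diff (tensor m n h (\<lambda>b. b) (a * shift m b)))
    (free_diff (h a) * shift m b + twist (h a) * shift m (free_diff b))" .
  have "tensor m n h (\<lambda>b. b) (free_diff (a * shift m b)) =
    tensor m n h (\<lambda>b. b) (free_diff a * shift m b) + tensor m n h (\<lambda>b. b) (twist a * shift m (free_diff b))"
    by (simp add: free_diff_mult free_diff_shift lin_simps[OF endoD(1)[OF t]])
  also have "cong (m + n) J \<dots> (h (free_diff a) * shift m b + h (twist a) * shift m (free_diff b))"
    using in_F by (intro cong_add tensor_mult h endo_id)
  also have "cong (m + n) J \<dots> (h (free_diff a) * shift m b + (- twist (h a)) * shift m (free_diff b))"
    using in_F odd[OF st(1)] by (intro cong_add cong_refl cong_J_mult) (auto simp: a_def intro!: F_simps)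
  finally have 2: "cong (m + n) J (tensor m n h (\<lambda>b. b) (free_diff (a * shift m b)))
    (h (free_diff a) * shift m b + (- twist (h a)) * shift m (free_diff b))" .
  have "cong (m + n) J (free_diff (tensor m n h (\<lambda>b. b) (a * shift m b)) + tensor m n h (\<lambda>b. b) (free_diff (a * shift m b)))
    ((free_diff (h a) + h (free_diff a)) * shift m b)"
    using cong_add[OF 1 2] by (simp add: algebra_simps)
  also have "cong (m + n) J \<dots> (tensor m n (\<lambda>a. free_diff (h a) + h (free_diff a)) (\<lambda>b. b) (a * shift m b))"
    using ab by (intro cong_sym[OF tensor_mult[OF h' endo_id]])
  finally show "cong (m + n) J
      (free_diff (tensor m n h (\<lambda>b. b) (monomial s * shift m (monomial t))) + tensor m n h (\<lambda>b. b) (free_diff (monomial s * shift m (monomial t))))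
      (tensor m n (\<lambda>a. free_diff (h a) + h (free_diff a)) (\<lambda>b. b) (monomial s * shift m (monomial t)))"
    unfolding a_def b_def .
qed fact

text \<open>
  The factor \<open>twist\<close> is the Koszul sign of an odd operator on the second factor. It anticommutes
  with \<open>d\<close>, so the terms \<open>d \<otimes> h\<close> cancel and its square leaves \<open>1 \<otimes> (d h + h d)\<close>.
\<close>

lemma homotopy_right:
  assumes h: "endo n L h" and "x \<in> F (m + n)"
  shows "cong (m + n) J (free_diff (tensor m n twist h x) + tensor m n twist h (free_diff x))
    (tensor m n (\<lambda>a. a) (\<lambda>b. free_diff (h b) + h (free_diff b)) x)"
proof (rule agree_on_blocks[of "\<lambda>x. free_diff (tensor m n twist h x) + tensor m n twist h (free_diff x)"
      "tensor m n (\<lambda>a. a) (\<lambda>b. free_diff (h b) + h (free_diff b))"])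
  note t = endo_tensor[OF endo_twist h]
  note h' = endo_add[OF endo_compose[OF endo_free_diff h] endo_compose[OF h endo_free_diff]]
  show "endo (m + n) J (\<lambda>x. free_diff (tensor m n twist h x) + tensor m n twist h (free_diff x))"
    by (intro endo_add endo_compose[OF endo_free_diff t] endo_compose[OF t endo_free_diff])
  show "endo (m + n) J (tensor m n (\<lambda>a. a) (\<lambda>b. free_diff (h b) + h (free_diff b)))"
    by (intro endo_tensor endo_id h')
  fix s t assume st: "s \<in> states m" "t \<in> states n"
  define a b where "a = monomial s" and "b = monomial t"
  have ab: "a \<in> F m" "b \<in> F n" using st by (auto simp: a_def b_def monomial_in_F)
  note in_F = ab endoD(2)[OF h] free_diff_in_F twist_in_F
  have "cong (m + n) J (free_diff (tensor m n twist h (a * shift m b))) (free_diff (twist a * shift m (h b)))"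
    using ab by (intro cong_free_diff tensor_mult h endo_twist)
  also have "free_diff (twist a * shift m (h b)) = - (twist (free_diff a) * shift m (h b)) + a * shift m (free_diff (h b))"
    by (simp add: free_diff_mult free_diff_shift free_diff_twist)
  finally have 1: "cong (m + n) J (free_diff (tensor m n twist h (a * shift m b)))
    (- (twist (free_diff a) * shift m (h b)) + a * shift m (free_diff (h b)))" .
  have "tensor m n twist h (free_diff (a * shift m b)) =
    tensor m n twist h (free_diff a * shift m b) + tensor m n twist h (twist a * shift m (free_diff b))"
    by (simp add: free_diff_mult free_diff_shift lin_simps[OF endoD(1)[OF t]])
  also have "cong (m + n) J \<dots> (twist (free_diff a) * shift m (h b) + twist (twist a) * shift m (h (free_diff b)))"
    using in_F by (intro cong_add tensor_mult h endo_twist)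
  finally have 2: "cong (m + n) J (tensor m n twist h (free_diff (a * shift m b)))
    (twist (free_diff a) * shift m (h b) + a * shift m (h (free_diff b)))" by simp
  have "cong (m + n) J (free_diff (tensor m n twist h (a * shift m b)) + tensor m n twist h (free_diff (a * shift m b)))
    (a * shift m (free_diff (h b) + h (free_diff b)))"
    using cong_add[OF 1 2] by (simp add: algebra_simps shift_simps)
  also have "cong (m + n) J \<dots> (tensor m n (\<lambda>a. a) (\<lambda>b. free_diff (h b) + h (free_diff b)) (a * shift m b))"
    using ab by (intro cong_sym[OF tensor_mult[OF endo_id h']])
  finally show "cong (m + n) J
      (free_diff (tensor m n twist h (monomial s * shift m (monomial t))) + tensor m n twist h (free_diff (monomial s * shift m (monomial t))))
      (tensor m n (\<lambda>a. a) (\<lambda>b. free_diff (h b) + h (free_diff b)) (monomial s * shift m (monomial t)))"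
    unfolding a_def b_def .
qed fact

end

section \<open>A contraction onto cocycles\<close>

text \<open>
  Representatives of the degree \<open>p\<close> part of \<open>R\<^sup>K\<^sub>\<omega>\<close> in the free algebra.
\<close>

definition part :: "nat set set \<Rightarrow> nat \<Rightarrow> nat set \<Rightarrow> free_alg set" where
  "part K p \<omega> = free_alg.span {u_prod \<sigma> * t_prod (\<omega> - \<sigma>) | \<sigma>. \<sigma> \<subseteq> \<omega> \<and> \<sigma> \<in> K \<and> card \<sigma> = p}"

lemma part_simps:
  "0 \<in> part K p \<omega>" "x \<in> part K p \<omega> \<Longrightarrow> y \<in> part K p \<omega> \<Longrightarrow> x + y \<in> part K p \<omega>"
  "x \<in> part K p \<omega> \<Longrightarrow> y \<in> part K p \<omega> \<Longrightarrow> x - y \<in> part K p \<omega>"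
  "x \<in> part K p \<omega> \<Longrightarrow> scal c x \<in> part K p \<omega>"
  "\<sigma> \<subseteq> \<omega> \<Longrightarrow> \<sigma> \<in> K \<Longrightarrow> monomial (\<sigma>, \<omega>) \<in> part K (card \<sigma>) \<omega>"
  unfolding part_def monomial_def
  by (auto intro: free_alg.span_zero free_alg.span_add free_alg.span_diff free_alg.span_scale free_alg.span_base)

lemma part_sum: "(\<And>i. i \<in> A \<Longrightarrow> f i \<in> part K p \<omega>) \<Longrightarrow> sum f A \<in> part K p \<omega>"
  by (induction A rule: infinite_finite_induct) (auto simp: part_simps)

lemma part_induct [consumes 1, case_names zero add monomial]:
  assumes "x \<in> part K p \<omega>" "P 0" "\<And>x y c. P x \<Longrightarrow> P y \<Longrightarrow> P (scal c x + y)"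
    "\<And>\<sigma>. \<sigma> \<subseteq> \<omega> \<Longrightarrow> \<sigma> \<in> K \<Longrightarrow> card \<sigma> = p \<Longrightarrow> P (monomial (\<sigma>, \<omega>))"
  shows "P x"
  using assms(1) unfolding part_def
  by (induction rule: free_alg.span_induct_alt) (use assms in \<open>auto simp: monomial_def\<close>)

lemma part_in_F: "x \<in> part K p \<omega> \<Longrightarrow> \<omega> \<subseteq> {1..m} \<Longrightarrow> x \<in> F m"
  by (induction rule: part_induct) (auto intro!: F_simps monomial_in_F simp: states_def)

lemma part_plain: "x \<in> part K p \<omega> \<Longrightarrow> finite \<omega> \<Longrightarrow> x \<in> plain p \<omega>"
  by (induction rule: part_induct) (use plain_simps monomial_plain in auto)

lemma twist_part: "x \<in> part K p \<omega> \<Longrightarrow> finite \<omega> \<Longrightarrow> twist x = scal ((-1) ^ p) x"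
  using part_plain twist_plain by blast

lemma coeff_part:
  assumes "x \<in> part K p \<omega>" "\<omega> \<subseteq> {1..m}" "coeff x (\<sigma>, \<omega>') \<noteq> 0"
  shows "\<omega>' = \<omega> \<and> \<sigma> \<subseteq> \<omega> \<and> \<sigma> \<in> K \<and> card \<sigma> = p"
  using assms(1,3)
proof (induction rule: part_induct)
  case (add x y c)
  then have "coeff x (\<sigma>, \<omega>') \<noteq> 0 \<or> coeff y (\<sigma>, \<omega>') \<noteq> 0"
    by (auto simp: coeff_simps)
  with add.IH show ?case by blast
next
  case (monomial \<tau>)
  then have "(\<tau>, \<omega>) \<in> states m" using assms(2) by (simp add: states_def)
  with monomial show ?case by (auto simp: coeff_monomial delta_def split: if_splits)
qed (simp add: coeff_simps)

definition proj :: "nat \<Rightarrow> nat set set \<Rightarrow> free_alg \<Rightarrow> free_alg" where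
  "proj m K x = (\<Sum>s\<in>states m. if fst s \<in> K then scal (coeff x s) (monomial s) else 0)"

lemma lin_proj: "lin (proj m K)"
  unfolding proj_def
  by (rule linI)
    (auto simp: coeff_simps free_alg.scale_left_distrib free_alg.scale_sum_right simp flip: sum.distrib intro!: sum.cong)

lemma proj_cong:
  assumes "x \<in> F m" shows "cong m K x (proj m K x)"
proof -
  have "cong m K x (\<Sum>s\<in>states m. scal (coeff x s) (monomial s))"
    by (rule expansion[OF assms])
  also have "cong m K \<dots> (proj m K x)"
    unfolding proj_def
  proof (rule cong_sum)
    fix s assume "s \<in> states m"
    then show "cong m K (scal (coeff x s) (monomial s)) (if fst s \<in> K then scal (coeff x s) (monomial s) else 0)"
      using monomial_RK_ideal[of "fst s" "snd s" m K] by (auto simp: cong_0 RK_ideal_simps)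
  qed
  finally show ?thesis .
qed

lemma proj_plain_part:
  assumes "x \<in> plain p \<omega>"
  shows "proj m K x \<in> part K p \<omega>"
  unfolding proj_def
proof (rule part_sum)
  fix s :: "nat set \<times> nat set"
  obtain \<sigma> \<omega>' where s: "s = (\<sigma>, \<omega>')" by fastforce
  show "(if fst s \<in> K then scal (coeff x s) (monomial s) else 0) \<in> part K p \<omega>"
    using coeff_plain[OF assms, of \<sigma> \<omega>'] part_simps(5)[of \<sigma> \<omega> K]
    by (cases "coeff x (\<sigma>, \<omega>') = 0") (auto simp: s part_simps)
qed

text \<open>
  Over a field a differential has a generalised inverse, that is \<open>h\<close> with \<open>d h d = d\<close>. Then
  \<open>x - (d h x + h d x)\<close> is a cocycle: its differential is \<open>d x - d h d x = 0\<close>. Choosing the inverse on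
  each bihomogeneous part \<open>R\<^sup>K\<^sub>\<omega>\<close> separately makes \<open>h\<close> lower the degree by one and preserve
  \<open>\<omega>\<close>, so these cocycles are bihomogeneous.
\<close>

lemma contraction:
  assumes K: "down_closed K"
  obtains h where "endo m K h"
    and "\<And>s. s \<in> states m \<Longrightarrow> cong m K (h (twist (monomial s))) (- twist (h (monomial s)))"
    and "\<And>\<sigma> \<omega>. (\<sigma>, \<omega>) \<in> states m \<Longrightarrow> \<sigma> \<in> K \<Longrightarrow>
      \<exists>x \<in> part K (card \<sigma>) \<omega>. free_diff x \<in> RK_ideal m K \<and>
        cong m K (monomial (\<sigma>, \<omega>) - (free_diff (h (monomial (\<sigma>, \<omega>))) + h (free_diff (monomial (\<sigma>, \<omega>))))) x"
proof -
  define d where "d x = proj m K (free_diff x)" for x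
  have lin_d: "lin d"
    using lin_compose[OF lin_proj lin_free_diff] by (simp add: d_def[abs_def])
  have "\<exists>g. range g \<subseteq> part K p \<omega> \<and> lin g \<and> (\<forall>v\<in>d ` part K p \<omega>. d (g v) = v)" for p \<omega>
    by (rule pair.linear_exists_right_inverse_on[OF lin_d]) (simp add: part_def)
  then obtain g where g: "\<And>p \<omega>. range (g p \<omega>) \<subseteq> part K p \<omega>" "\<And>p \<omega>. lin (g p \<omega>)"
    "\<And>p \<omega> v. v \<in> d ` part K p \<omega> \<Longrightarrow> d (g p \<omega> v) = v"
    by metis
  have g_part: "g p \<omega> v \<in> part K p \<omega>" for p \<omega> v
    using g(1) by blast
  \<comment> \<open>The value of the homotopy on a monomial; it is \<open>0\<close> in degree \<open>0\<close>, where \<open>card - 1\<close> would be truncated.\<close>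
  define G where "G s = (if fst s \<in> K \<and> card (fst s) \<noteq> 0 then g (card (fst s) - 1) (snd s) (monomial s) else 0)" for s
  define h where "h x = (\<Sum>s\<in>states m. scal (coeff x s) (G s))" for x
  have lin_h: "lin h"
    unfolding h_def by (rule linI)
      (auto simp: coeff_simps free_alg.scale_left_distrib free_alg.scale_sum_right simp flip: sum.distrib)
  have G_F: "G s \<in> F m" if "s \<in> states m" for s
    using part_in_F[OF g_part, of "snd s" m] that by (auto simp: G_def states_def F_simps)
  have h_ideal: "h x = 0" if "x \<in> RK_ideal m K" for x
    unfolding h_def using coeff_RK_ideal[OF K that] by (intro sum.neutral) (auto simp: G_def)
  have endo_h: "endo m K h"
    unfolding endo_def
    by (auto simp: lin_h h_ideal RK_ideal_simps) (auto simp: h_def intro!: F_sum F_simps G_F)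
  have h_monomial: "h (monomial s) = G s" if "s \<in> states m" for s
  proof -
    have "h (monomial s) = (\<Sum>s'\<in>states m. if s' = s then G s else 0)"
      unfolding h_def using that coeff_monomial[of "fst s" "snd s" m]
      by (intro sum.cong refl) (auto simp: delta_def)
    with that show ?thesis by simp
  qed
  have h_Suc: "h x = g p \<omega> x" if "x \<in> part K (Suc p) \<omega>" "\<omega> \<subseteq> {1..m}" for x p \<omega>
    using that(1)
  proof (induction rule: part_induct)
    case (monomial \<sigma>)
    then have "(\<sigma>, \<omega>) \<in> states m" using that(2) by (simp add: states_def)
    with monomial show ?case by (simp add: h_monomial G_def)
  qed (simp_all add: lin_simps[OF lin_h] lin_simps[OF g(2)])
  have d_cong: "cong m K (free_diff x) (d x)" if "x \<in> F m" for x
    unfolding d_def by (intro proj_cong free_diff_in_F that)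
  have d_part: "d x \<in> part K (Suc p) \<omega>" if "x \<in> part K p \<omega>" "finite \<omega>" for x p \<omega>
    unfolding d_def by (intro proj_plain_part free_diff_plain part_plain[of _ K] that)
  show thesis
  proof
    show "endo m K h" by (rule endo_h)
    fix s assume s: "s \<in> states m"
    obtain \<sigma> \<omega> where so: "s = (\<sigma>, \<omega>)" by fastforce
    note st = statesD[OF s[unfolded so]]
    have tw: "twist (monomial s) = scal ((-1) ^ card \<sigma>) (monomial s)"
      unfolding so using twist_plain[OF monomial_plain] st by blast
    have "twist (G s) = scal ((-1) ^ (card \<sigma> - 1)) (G s)"
      using twist_part[OF g_part, of \<omega> "card \<sigma> - 1"] st by (simp add: G_def so twist_simps)
    moreover have "scal ((-1) ^ card \<sigma>) (G s) = - scal ((-1) ^ (card \<sigma> - 1)) (G s)"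
      by (cases "card \<sigma>") (simp_all add: G_def so)
    ultimately show "cong m K (h (twist (monomial s))) (- twist (h (monomial s)))"
      by (simp add: tw lin_simps[OF lin_h] h_monomial[OF s])
  next
    fix \<sigma> \<omega> assume s: "(\<sigma>, \<omega>) \<in> states m" and "\<sigma> \<in> K"
    note st = statesD[OF s]
    let ?p = "card \<sigma>" and ?e = "monomial (\<sigma>, \<omega>)"
    have e: "?e \<in> part K ?p \<omega>" "?e \<in> F m"
      using st \<open>\<sigma> \<in> K\<close> by (auto intro: part_simps(5) monomial_in_F[OF s])
    have he_F: "h ?e \<in> F m" by (rule endoD(2)[OF endo_h e(2)])
    have he: "d (h ?e) \<in> part K ?p \<omega>"
    proof (cases ?p)
      case 0
      then show ?thesis by (simp add: h_monomial[OF s] G_def lin_simps[OF lin_d] part_simps)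
    next
      case (Suc q)
      then have "h ?e = g q \<omega> ?e" using h_Suc e(1) st by auto
      then show ?thesis unfolding Suc using d_part[OF g_part] st by simp
    qed
    have hd: "h (free_diff ?e) = g ?p \<omega> (d ?e)"
    proof -
      have "h (free_diff ?e - d ?e) = 0"
        using d_cong[OF e(2)] by (intro h_ideal) (simp add: cong_def)
      then have "h (free_diff ?e) = h (d ?e)" by (simp add: lin_simps[OF lin_h])
      also have "\<dots> = g ?p \<omega> (d ?e)" using st by (intro h_Suc d_part e) auto
      finally show ?thesis .
    qed
    let ?x = "?e - (d (h ?e) + g ?p \<omega> (d ?e))"
    have x: "?x \<in> part K ?p \<omega>"
      by (intro part_simps(2,3) e he g_part)
    have "cong m K (free_diff (d (h ?e))) (free_diff (free_diff (h ?e)))"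
      by (intro cong_free_diff cong_sym[OF d_cong] he_F)
    moreover have "cong m K (free_diff (g ?p \<omega> (d ?e))) (free_diff ?e)"
    proof -
      have "g ?p \<omega> (d ?e) \<in> F m" using part_in_F[OF g_part] st by blast
      then have "cong m K (free_diff (g ?p \<omega> (d ?e))) (d (g ?p \<omega> (d ?e)))" by (rule d_cong)
      also have "d (g ?p \<omega> (d ?e)) = d ?e" using e(1) by (intro g(3)) blast
      also have "cong m K \<dots> (free_diff ?e)" by (rule cong_sym[OF d_cong[OF e(2)]])
      finally show ?thesis .
    qed
    ultimately have "cong m K (free_diff ?x) (free_diff ?e - (0 + free_diff ?e))"
      unfolding free_diff_simps by (intro cong_diff cong_add cong_refl) simp_all
    then have "free_diff ?x \<in> RK_ideal m K" by (simp add: cong_0)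
    moreover have "cong m K (?e - (free_diff (h ?e) + h (free_diff ?e))) ?x"
      unfolding hd by (intro cong_diff cong_add cong_refl d_cong he_F)
    ultimately show "\<exists>x \<in> part K ?p \<omega>. free_diff x \<in> RK_ideal m K \<and>
        cong m K (?e - (free_diff (h ?e) + h (free_diff ?e))) x"
      using x by blast
  qed
qed

section \<open>The cohomology ring\<close>

text \<open>
  The two predicates say that the class of an element in \<open>R\<^sup>K\<close> is a cocycle, respectively a
  coboundary.
\<close>

definition cocycle :: "nat \<Rightarrow> nat set set \<Rightarrow> free_alg \<Rightarrow> bool" where
  "cocycle m K x \<longleftrightarrow> x \<in> F m \<and> free_diff x \<in> RK_ideal m K"

definition exact :: "nat \<Rightarrow> nat set set \<Rightarrow> free_alg \<Rightarrow> bool" where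
  "exact m K x \<longleftrightarrow> (\<exists>y\<in>F m. cong m K x (free_diff y))"

lemma cong_in_F: "cong m K x y \<Longrightarrow> y \<in> F m \<Longrightarrow> x \<in> F m"
  using RK_ideal_in_F[of "x - y" m K] F_simps(1)[of "x - y" m y] by (simp add: cong_def)

lemma exact_in_F: "exact m K x \<Longrightarrow> x \<in> F m"
  unfolding exact_def using cong_in_F free_diff_in_F by blast

lemma exact_cong: "cong m K x x' \<Longrightarrow> exact m K x \<longleftrightarrow> exact m K x'"
  unfolding exact_def by (blast intro: cong_trans cong_sym)

lemma exact_ideal: "x \<in> RK_ideal m K \<Longrightarrow> exact m K x"
  unfolding exact_def using F_simps(5)[of m] by (intro bexI[of _ 0]) (simp_all add: cong_0 free_diff_simps)

lemma exact_add: "exact m K x \<Longrightarrow> exact m K y \<Longrightarrow> exact m K (x + y)"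
  unfolding exact_def
proof (elim bexE)
  fix a b assume "a \<in> F m" "b \<in> F m" "cong m K x (free_diff a)" "cong m K y (free_diff b)"
  then show "\<exists>z\<in>F m. cong m K (x + y) (free_diff z)"
    by (intro bexI[of _ "a + b"]) (auto simp: free_diff_simps intro!: cong_add F_simps)
qed

lemma exact_scal: "exact m K x \<Longrightarrow> exact m K (scal c x)"
  unfolding exact_def
proof (elim bexE)
  fix a assume "a \<in> F m" "cong m K x (free_diff a)"
  then show "\<exists>z\<in>F m. cong m K (scal c x) (free_diff z)"
    by (intro bexI[of _ "scal c a"]) (auto simp: free_diff_simps intro!: cong_scal F_simps)
qed

lemma exact_free_diff: "y \<in> F m \<Longrightarrow> exact m K (free_diff y)"
  unfolding exact_def by (intro bexI[of _ y]) simp_all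

lemma exact_sum: "(\<And>i. i \<in> A \<Longrightarrow> exact m K (f i)) \<Longrightarrow> exact m K (sum f A)"
  by (induction A rule: infinite_finite_induct) (auto intro: exact_add exact_ideal RK_ideal_simps)

lemma cocycle_1: "cocycle m K 1"
  by (simp add: cocycle_def F_simps RK_ideal_simps)

lemma cocycle_mult: "cocycle m K x \<Longrightarrow> cocycle m K y \<Longrightarrow> cocycle m K (x * y)"
  unfolding cocycle_def free_diff_mult
  by (intro conjI F_simps(2) RK_ideal_simps(2) RK_ideal_simps(3)[of "free_diff y"] RK_ideal_simps(4)[of "free_diff x"] twist_in_F)
    auto

lemma cocycle_prod_list: "(\<And>x. x \<in> set xs \<Longrightarrow> cocycle m K x) \<Longrightarrow> cocycle m K (prod_list xs)"
  by (induction xs) (auto intro: cocycle_1 cocycle_mult)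

text \<open>
  If \<open>x = d y\<close>, then \<open>x c = d (y c)\<close> and \<open>c x = d (twist c y)\<close> in \<open>R\<^sup>K\<close>, for a cocycle \<open>c\<close>.
\<close>

lemma exact_mult:
  assumes "exact m K x" "cocycle m K c"
  shows "exact m K (x * c)" "exact m K (c * x)"
proof -
  from assms(1) obtain y where y: "y \<in> F m" "cong m K x (free_diff y)" by (auto simp: exact_def)
  have c: "c \<in> F m" "free_diff c \<in> RK_ideal m K" using assms(2) by (auto simp: cocycle_def)
  have "cong m K (x * c) (free_diff y * c)"
    using y c by (intro cong_right)
  also have "free_diff y * c = free_diff (y * c) - twist y * free_diff c"
    by (simp add: free_diff_mult)
  also have "cong m K \<dots> (free_diff (y * c) - 0)"
    by (intro cong_diff cong_refl) (simp add: cong_0 RK_ideal_simps(3) c twist_in_F y)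
  finally show "exact m K (x * c)"
    unfolding exact_def using F_simps(2)[OF y(1) c(1)] by auto
  have "cong m K (c * x) (c * free_diff y)"
    using y c by (intro cong_left)
  also have "c * free_diff y = free_diff (twist c * y) + twist (free_diff c) * y"
    by (simp add: free_diff_mult free_diff_twist)
  also have "cong m K \<dots> (free_diff (twist c * y) + 0)"
    by (intro cong_add cong_refl) (simp add: cong_0 RK_ideal_simps(4) twist_RK_ideal c y)
  finally show "exact m K (c * x)"
    unfolding exact_def using F_simps(2)[OF twist_in_F[OF c(1)] y(1)] by auto
qed

lemma RK_class_eq: "x \<in> F m \<Longrightarrow> y \<in> F m \<Longrightarrow> RK_class m K x = RK_class m K y \<longleftrightarrow> cong m K x y"
proof -
  assume xy: "x \<in> F m" "y \<in> F m"
  interpret ideal "RK_ideal m K" "free_ring m" by (rule ideal_RK_ideal)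
  have "x \<ominus>\<^bsub>free_ring m\<^esub> y = x - y"
    using xy by (simp add: a_minus_def free_ring_a_inv)
  then show ?thesis
    using quotient_eq_iff_same_a_r_cos[OF ideal_RK_ideal xy] by (simp add: RK_class_def cong_def)
qed

lemma RK_class_self: "x \<in> F m \<Longrightarrow> x \<in> RK_class m K x"
  using RK_ideal_simps(1)[of m K] by (auto simp: RK_class_def a_r_coset_def r_coset_def)

lemma RK_class_mem: "x \<in> F m \<Longrightarrow> y \<in> RK_class m K x \<Longrightarrow> cong m K y x"
  by (auto simp: RK_class_def a_r_coset_def r_coset_def cong_def)

lemma ring_RK: "ring (RK m K)"
  unfolding RK_def by (rule ideal.quotient_is_ring[OF ideal_RK_ideal])

lemma RK_class_hom: "RK_class m K \<in> ring_hom (free_ring m) (RK m K)"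
  using ideal.rcos_ring_hom[OF ideal_RK_ideal] by (simp add: RK_def RK_class_def[abs_def])

lemma carrier_RK: "carrier (RK m K) = RK_class m K ` F m"
  by (auto simp: RK_def FactRing_def A_RCOSETS_def' RK_class_def)

lemma zero_RK: "\<zero>\<^bsub>RK m K\<^esub> = RK_class m K 0"
proof -
  have "RK_class m K 0 = RK_ideal m K"
    by (auto simp: RK_class_def a_r_coset_def r_coset_def)
  then show ?thesis by (simp add: RK_def FactRing_def)
qed

lemma RK_ops:
  "x \<in> F m \<Longrightarrow> y \<in> F m \<Longrightarrow> RK_class m K x \<oplus>\<^bsub>RK m K\<^esub> RK_class m K y = RK_class m K (x + y)"
  "x \<in> F m \<Longrightarrow> y \<in> F m \<Longrightarrow> RK_class m K x \<otimes>\<^bsub>RK m K\<^esub> RK_class m K y = RK_class m K (x * y)"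
  "\<one>\<^bsub>RK m K\<^esub> = RK_class m K 1"
  using ring_hom_add[OF RK_class_hom] ring_hom_mult[OF RK_class_hom] ring_hom_one[OF RK_class_hom]
  by simp_all

lemma RK_diff_class:
  assumes "x \<in> F m"
  shows "RK_diff m K (RK_class m K x) = RK_class m K (free_diff x)"
proof -
  have "RK_class m K (free_diff y) = RK_class m K (free_diff x)" if "y \<in> RK_class m K x" for y
  proof -
    have "cong m K y x" using RK_class_mem[OF assms that] .
    moreover from this have "y \<in> F m" using assms by (rule cong_in_F)
    ultimately show ?thesis
      using assms by (simp add: RK_class_eq free_diff_in_F cong_free_diff)
  qed
  then have "(\<lambda>y. RK_class m K (free_diff y)) ` RK_class m K x = {RK_class m K (free_diff x)}"
    using RK_class_self[OF assms, of K] by blast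
  then show ?thesis
    by (simp add: RK_diff_def)
qed

lemma RK_class_zero_iff: "x \<in> F m \<Longrightarrow> RK_class m K x = \<zero>\<^bsub>RK m K\<^esub> \<longleftrightarrow> x \<in> RK_ideal m K"
  by (simp add: zero_RK RK_class_eq F_simps cong_0)

lemma RK_class_cocycles: "x \<in> F m \<Longrightarrow> RK_class m K x \<in> cocycles m K \<longleftrightarrow> cocycle m K x"
  by (simp add: cocycles_def carrier_RK RK_diff_class RK_class_zero_iff free_diff_in_F cocycle_def)

lemma cocycles_eq: "cocycles m K = RK_class m K ` Collect (cocycle m K)"
proof (intro equalityI subsetI)
  fix X assume X: "X \<in> cocycles m K"
  then obtain x where "x \<in> F m" "X = RK_class m K x"
    unfolding cocycles_def carrier_RK by blast
  with X show "X \<in> RK_class m K ` Collect (cocycle m K)"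
    by (simp add: RK_class_cocycles)
qed (auto simp: RK_class_cocycles cocycle_def)

lemma coboundaries_eq: "coboundaries m K = RK_class m K ` free_diff ` F m"
  unfolding coboundaries_def carrier_RK by (auto simp: RK_diff_class image_image)

lemma RK_class_coboundaries: "x \<in> F m \<Longrightarrow> RK_class m K x \<in> coboundaries m K \<longleftrightarrow> exact m K x"
proof -
  assume "x \<in> F m"
  then have "RK_class m K x = RK_class m K (free_diff y) \<longleftrightarrow> cong m K x (free_diff y)" if "y \<in> F m" for y
    using that by (simp add: RK_class_eq free_diff_in_F)
  then show ?thesis
    unfolding coboundaries_eq exact_def image_image by (auto simp: image_iff)
qed

abbreviation Z_ring :: "nat \<Rightarrow> nat set set \<Rightarrow> free_alg set ring" where
  "Z_ring m K \<equiv> (RK m K)\<lparr>carrier := cocycles m K\<rparr>"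

lemma RK_a_inv: "x \<in> F m \<Longrightarrow> \<ominus>\<^bsub>RK m K\<^esub> RK_class m K x = RK_class m K (- x)"
proof -
  assume x: "x \<in> F m"
  interpret ring "RK m K" by (rule ring_RK)
  show ?thesis
    using x by (intro minus_equality) (auto simp: RK_ops F_simps zero_RK carrier_RK)
qed

lemma cocycle_neg: "cocycle m K x \<Longrightarrow> cocycle m K (- x)"
  and cocycle_add: "cocycle m K x \<Longrightarrow> cocycle m K y \<Longrightarrow> cocycle m K (x + y)"
  by (auto simp: cocycle_def free_diff_simps F_simps RK_ideal_simps)

lemma cocycle_F: "cocycle m K x \<Longrightarrow> x \<in> F m"
  by (simp add: cocycle_def)

lemma ring_Z: "ring (Z_ring m K)"
proof -
  interpret ring "RK m K" by (rule ring_RK)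
  have "subring (cocycles m K) (RK m K)"
    by (rule subringI)
      (auto simp: cocycles_eq carrier_RK RK_ops RK_a_inv cocycle_F
        intro!: imageI cocycle_1 cocycle_neg cocycle_mult cocycle_add)
  then show ?thesis by (rule subring_is_ring)
qed

lemma exact_cocycle: "exact m K x \<Longrightarrow> cocycle m K x"
proof -
  assume x: "exact m K x"
  then obtain y where "y \<in> F m" "cong m K x (free_diff y)" by (auto simp: exact_def)
  from cong_free_diff[OF this(2)] exact_in_F[OF x] show ?thesis
    by (simp add: cocycle_def cong_0)
qed

lemma coboundaries_eq': "coboundaries m K = RK_class m K ` Collect (exact m K)"
proof (intro equalityI subsetI)
  fix X assume X: "X \<in> coboundaries m K"
  then obtain y where "y \<in> F m" "X = RK_class m K (free_diff y)" by (auto simp: coboundaries_eq)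
  then show "X \<in> RK_class m K ` Collect (exact m K)" using exact_free_diff by blast
qed (auto simp: RK_class_coboundaries exact_in_F)

lemma ideal_coboundaries: "ideal (coboundaries m K) (Z_ring m K)"
proof (rule idealI)
  interpret Z: ring "Z_ring m K" by (rule ring_Z)
  interpret R: ring "RK m K" by (rule ring_RK)
  show "ring (Z_ring m K)" by (rule ring_Z)
  show "subgroup (coboundaries m K) (add_monoid (Z_ring m K))"
  proof (rule Z.add.subgroupI)
    show "coboundaries m K \<subseteq> carrier (Z_ring m K)"
      using exact_cocycle by (auto simp: coboundaries_eq' cocycles_eq)
    show "coboundaries m K \<noteq> {}" using F_simps(5) by (auto simp: coboundaries_eq)
  next
    fix X assume "X \<in> coboundaries m K"
    then obtain x where x: "exact m K x" "X = RK_class m K x" by (auto simp: coboundaries_eq')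
    have "\<ominus>\<^bsub>Z_ring m K\<^esub> X = RK_class m K (- x)"
      using x exact_in_F[OF x(1)] exact_cocycle[OF x(1)]
      by (intro Z.minus_equality) (auto simp: RK_ops F_simps zero_RK cocycles_eq intro!: imageI cocycle_neg)
    then show "\<ominus>\<^bsub>Z_ring m K\<^esub> X \<in> coboundaries m K"
      using exact_scal[OF x(1), of "-1"] by (auto simp: coboundaries_eq')
  next
    fix X Y assume "X \<in> coboundaries m K" "Y \<in> coboundaries m K"
    then show "X \<oplus>\<^bsub>Z_ring m K\<^esub> Y \<in> coboundaries m K"
      by (auto simp: coboundaries_eq' RK_ops exact_in_F intro!: imageI exact_add)
  qed
next
  fix X Y assume "X \<in> coboundaries m K" "Y \<in> carrier (Z_ring m K)"
  then obtain x y where xy: "exact m K x" "X = RK_class m K x" "cocycle m K y" "Y = RK_class m K y"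
    by (auto simp: coboundaries_eq' cocycles_eq)
  show "Y \<otimes>\<^bsub>Z_ring m K\<^esub> X \<in> coboundaries m K" "X \<otimes>\<^bsub>Z_ring m K\<^esub> Y \<in> coboundaries m K"
    using exact_mult[OF xy(1,3)] xy by (simp_all add: coboundaries_eq' RK_ops exact_in_F cocycle_F)
qed

definition H_class :: "nat \<Rightarrow> nat set set \<Rightarrow> free_alg \<Rightarrow> free_alg set set" where
  "H_class m K x = coboundaries m K +>\<^bsub>RK m K\<^esub> RK_class m K x"

lemma H_class_Z: "H_class m K x = coboundaries m K +>\<^bsub>Z_ring m K\<^esub> RK_class m K x"
  by (simp add: H_class_def a_r_coset_def r_coset_def)

lemma H_class_mult:
  assumes "cocycle m K x" "cocycle m K y"
  shows "H_class m K x \<otimes>\<^bsub>H_RZ m K\<^esub> H_class m K y = H_class m K (x * y)"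
proof -
  have "RK_class m K x \<in> carrier (Z_ring m K)" "RK_class m K y \<in> carrier (Z_ring m K)"
    using assms by (auto simp: cocycles_eq)
  from ring_hom_mult[OF ideal.rcos_ring_hom[OF ideal_coboundaries] this] show ?thesis
    using assms by (simp add: H_RZ_def H_class_Z RK_ops cocycle_F)
qed

lemma H_class_1: "\<one>\<^bsub>H_RZ m K\<^esub> = H_class m K 1"
  using ring_hom_one[OF ideal.rcos_ring_hom[OF ideal_coboundaries[of m K]]]
  by (simp add: H_RZ_def H_class_Z RK_ops)

lemma H_class_0:
  assumes "cocycle m K x"
  shows "H_class m K x = \<zero>\<^bsub>H_RZ m K\<^esub> \<longleftrightarrow> exact m K x"
proof -
  interpret ideal "coboundaries m K" "Z_ring m K" by (rule ideal_coboundaries)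
  have x: "RK_class m K x \<in> carrier (Z_ring m K)" using assms by (auto simp: cocycles_eq)
  have "H_class m K x = coboundaries m K \<longleftrightarrow> RK_class m K x \<in> coboundaries m K"
    unfolding H_class_Z using a_rcos_self[OF x] a_coset_join2[OF x a_subgroup] by metis
  then show ?thesis
    using RK_class_coboundaries[OF cocycle_F[OF assms]] by (simp add: H_RZ_def FactRing_def)
qed

lemma H_class_prod_list:
  "(\<And>x. x \<in> set xs \<Longrightarrow> cocycle m K x) \<Longrightarrow>
    foldr (\<otimes>\<^bsub>H_RZ m K\<^esub>) (map (H_class m K) xs) \<one>\<^bsub>H_RZ m K\<^esub> = H_class m K (prod_list xs)"
  by (induction xs) (auto simp: H_class_1 H_class_mult cocycle_prod_list)

lemma H_class_prod_list_0:
  assumes "\<And>x. x \<in> set xs \<Longrightarrow> cocycle m K x"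
  shows "foldr (\<otimes>\<^bsub>H_RZ m K\<^esub>) (map (H_class m K) xs) \<one>\<^bsub>H_RZ m K\<^esub> = \<zero>\<^bsub>H_RZ m K\<^esub> \<longleftrightarrow> exact m K (prod_list xs)"
  using H_class_prod_list[OF assms] H_class_0[OF cocycle_prod_list[OF assms]] by simp

lemma H_part_eq:
  assumes "\<omega> \<subseteq> {1..m}"
  shows "H_part m K p \<omega> = H_class m K ` {x \<in> part K p \<omega>. cocycle m K x}"
proof -
  have "RK_part m K p \<omega> = RK_class m K ` part K p \<omega>"
    by (simp add: RK_part_def part_def)
  moreover have "RK_class m K x \<in> cocycles m K \<longleftrightarrow> cocycle m K x" if "x \<in> part K p \<omega>" for x
    using part_in_F[OF that assms] by (rule RK_class_cocycles)
  ultimately have "RK_part m K p \<omega> \<inter> cocycles m K = RK_class m K ` {x \<in> part K p \<omega>. cocycle m K x}"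
    by auto
  then show ?thesis
    unfolding H_part_def H_class_def Setcompr_eq_image by (simp add: image_image)
qed

text \<open>
  Both passages to a quotient, from the free algebra to \<open>R\<^sup>K\<close> and from cocycles to cohomology,
  are ring homomorphisms. So a product of classes vanishes if and only if the product of
  representatives in the free algebra is a coboundary modulo the ideal.
\<close>

lemma almost_c_symplectic_iff:
  "almost_c_symplectic m K \<longleftrightarrow>
    (\<exists>zs. (\<forall>(x, p, \<omega>)\<in>set zs. p \<in> {1, 2} \<and> \<omega> \<subseteq> {1..m} \<and> x \<in> part K p \<omega> \<and> cocycle m K x) \<and>
      \<not> exact m K (prod_list (map fst zs)) \<and> foldr sym_diff (map (snd \<circ> snd) zs) {} = {1..m})"
  (is "_ = (\<exists>zs. ?P zs)")
proof
  assume "almost_c_symplectic m K"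
  then obtain l \<alpha> d \<omega> where a': "\<forall>i<l. d i \<in> {1, 2} \<and> \<omega> i \<subseteq> {1..m} \<and> \<alpha> i \<in> H_part m K (d i) (\<omega> i)"
    and nz: "foldr (\<otimes>\<^bsub>H_RZ m K\<^esub>) (map \<alpha> [0..<l]) \<one>\<^bsub>H_RZ m K\<^esub> \<noteq> \<zero>\<^bsub>H_RZ m K\<^esub>"
    and sd: "foldr sym_diff (map \<omega> [0..<l]) {} = {1..m}"
    unfolding almost_c_symplectic_def by (elim exE conjE)
  have a: "d i \<in> {1, 2} \<and> \<omega> i \<subseteq> {1..m} \<and> \<alpha> i \<in> H_part m K (d i) (\<omega> i)" if "i < l" for i
    using a' that by blast
  have "\<exists>x. x \<in> part K (d i) (\<omega> i) \<and> cocycle m K x \<and> \<alpha> i = H_class m K x" if "i < l" for i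
    using a[OF that] by (auto simp: H_part_eq)
  then obtain x where x: "\<And>i. i < l \<Longrightarrow> x i \<in> part K (d i) (\<omega> i) \<and> cocycle m K (x i) \<and> \<alpha> i = H_class m K (x i)"
    by metis
  have "map \<alpha> [0..<l] = map (H_class m K) (map x [0..<l])"
    using x by simp
  moreover have coc: "cocycle m K y" if "y \<in> set (map x [0..<l])" for y using x that by auto
  ultimately have "\<not> exact m K (prod_list (map x [0..<l]))"
    using nz H_class_prod_list_0[of "map x [0..<l]", OF coc] by metis
  then have "?P (map (\<lambda>i. (x i, d i, \<omega> i)) [0..<l])"
    using a x sd by (auto simp: comp_def)
  then show "\<exists>zs. ?P zs" ..
next
  assume "\<exists>zs. ?P zs"
  then obtain zs where zs: "?P zs" ..
  define \<alpha> where "\<alpha> i = H_class m K (fst (zs ! i))" for i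
  have nth: "case zs ! i of (x, p, \<omega>) \<Rightarrow> p \<in> {1, 2} \<and> \<omega> \<subseteq> {1..m} \<and> x \<in> part K p \<omega> \<and> cocycle m K x"
    if "i < length zs" for i
    using conjunct1[OF zs] nth_mem[OF that] by (rule bspec)
  have coc: "cocycle m K y" if "y \<in> set (map fst zs)" for y using zs that by auto
  have "map \<alpha> [0..<length zs] = map (H_class m K) (map fst zs)"
    by (rule nth_equalityI) (simp_all add: \<alpha>_def)
  then have "foldr (\<otimes>\<^bsub>H_RZ m K\<^esub>) (map \<alpha> [0..<length zs]) \<one>\<^bsub>H_RZ m K\<^esub> \<noteq> \<zero>\<^bsub>H_RZ m K\<^esub>"
    using H_class_prod_list_0[of "map fst zs", OF coc] zs by metis
  moreover have "map (\<lambda>i. snd (snd (zs ! i))) [0..<length zs] = map (snd \<circ> snd) zs"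
    by (rule nth_equalityI) simp_all
  moreover have "\<forall>i<length zs. fst (snd (zs ! i)) \<in> {1, 2} \<and> snd (snd (zs ! i)) \<subseteq> {1..m} \<and>
      \<alpha> i \<in> H_part m K (fst (snd (zs ! i))) (snd (snd (zs ! i)))"
  proof (intro allI impI)
    fix i assume "i < length zs"
    moreover obtain x p \<omega> where "zs ! i = (x, p, \<omega>)" by (metis surj_pair)
    ultimately show "fst (snd (zs ! i)) \<in> {1, 2} \<and> snd (snd (zs ! i)) \<subseteq> {1..m} \<and>
      \<alpha> i \<in> H_part m K (fst (snd (zs ! i))) (snd (snd (zs ! i)))"
      using nth[of i] by (simp add: \<alpha>_def H_part_eq)
  qed
  ultimately show "almost_c_symplectic m K"
    unfolding almost_c_symplectic_def using conjunct2[OF conjunct2[OF zs]]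
    by (intro exI[of _ "length zs"] exI[of _ \<alpha>] exI[of _ "\<lambda>i. fst (snd (zs ! i))"]
        exI[of _ "\<lambda>i. snd (snd (zs ! i))"]) (simp only: simp_thms)
qed

section \<open>Kuenneth theorem for the join\<close>

definition has_parity :: "free_alg \<Rightarrow> bool" where
  "has_parity x \<longleftrightarrow> twist x = x \<or> twist x = - x"

lemma has_parity_1: "has_parity 1"
  by (simp add: has_parity_def)

lemma has_parity_mult: "has_parity x \<Longrightarrow> has_parity y \<Longrightarrow> has_parity (x * y)"
  by (auto simp: has_parity_def twist_mult)

lemma has_parity_prod_list: "(\<And>x. x \<in> set xs \<Longrightarrow> has_parity x) \<Longrightarrow> has_parity (prod_list xs)"
  by (induction xs) (auto intro: has_parity_1 has_parity_mult)

lemma has_parity_part: "x \<in> part K p \<omega> \<Longrightarrow> finite \<omega> \<Longrightarrow> has_parity x"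
  using twist_part[of x K p \<omega>] by (cases "even p") (auto simp: has_parity_def)

text \<open>
  In degree zero \<open>R\<^sup>K\<^sub>\<omega>\<close> is spanned by \<open>t\<^sub>\<omega>\<close>. For \<open>i \<in> \<omega>\<close> the coefficient of \<open>u\<^sub>i t\<^bsub>\<omega> - {i}\<^esub>\<close> in \<open>d t\<^sub>\<omega>\<close>
  is \<open>1\<close>, and it is a coordinate of \<open>R\<^sup>K\<close> because \<open>i\<close> is a vertex. So \<open>t\<^sub>\<omega>\<close> is a cocycle only for
  empty \<open>\<omega>\<close>. This is the connectedness of the real moment-angle complex.
\<close>

lemma degree_zero:
  assumes "down_closed K" "\<And>i. i \<in> {1..m} \<Longrightarrow> {i} \<in> K" "\<omega> \<subseteq> {1..m}"
    and "x \<in> part K 0 \<omega>" "cocycle m K x"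
  shows "x = 0 \<or> \<omega> = {} \<and> (\<exists>k. x = scal k 1)"
proof -
  have fin: "finite \<omega>" using assms(3) by (rule finite_subset) simp
  have s: "({}, \<omega>) \<in> states m" using assms(3) by (simp add: states_def)
  from assms(4) obtain k where k: "x = scal k (monomial ({}, \<omega>))"
  proof (induction arbitrary: thesis rule: part_induct)
    case zero
    then show ?case by (metis free_alg.scale_zero_left)
  next
    case (add x y c)
    then show ?case by (metis free_alg.scale_left_distrib free_alg.scale_scale)
  next
    case (monomial \<sigma>)
    then have "\<sigma> = {}" using fin finite_subset by fastforce
    then show ?case using monomial.prems[of 1] by simp
  qed
  show ?thesis
  proof (cases "\<omega> = {}")
    case True
    then show ?thesis using k by (auto simp: monomial_def u_prod_def t_prod_def)
  next
    case False
    then obtain i where i: "i \<in> \<omega>" by blast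
    then have i': "i \<in> {1..m}" using assms(3) by blast
    let ?T = "monomial ({}, \<omega> - {i})"
    have s': "({}, \<omega> - {i}) \<in> states m" using assms(3) by (auto simp: states_def)
    have "cong m K (t_gen i * ?T) (monomial ({}, toggle i (\<omega> - {i})))"
      using t_gen_monomial[OF i' s', of K] by simp
    moreover have "toggle i (\<omega> - {i}) = \<omega>" using i by (auto simp: toggle_def)
    ultimately have "cong m K (free_diff (t_gen i * ?T)) (free_diff (monomial ({}, \<omega>)))"
      by (intro cong_free_diff) simp
    from coeff_cong[OF assms(1) this assms(2)[OF i']]
    have "coeff (free_diff (monomial ({}, \<omega>))) ({i}, \<omega>) = coeff (free_diff (t_gen i * ?T)) ({i}, \<omega>)" by simp
    also have "\<dots> = coeff (u_gen i * ?T) ({i}, \<omega>) + coeff (t_gen i * free_diff ?T) ({i}, \<omega>)"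
      by (simp add: free_diff_mult free_diff_gen twist_t_gen coeff_simps)
    also have "coeff (t_gen i * free_diff ?T) ({i}, \<omega>) = - coeff (free_diff ?T) ({i}, \<omega>)"
      by (simp add: coeff_mult act_gens T_op_def)
    also have "coeff (free_diff ?T) ({i}, \<omega>) = 0"
    proof (rule ccontr)
      assume "coeff (free_diff ?T) ({i}, \<omega>) \<noteq> 0"
      moreover have "free_diff ?T \<in> plain 1 (\<omega> - {i})"
        using free_diff_plain[OF monomial_plain[of "\<omega> - {i}" "{}"]] fin by simp
      ultimately have "\<omega> = \<omega> - {i}" using coeff_plain by blast
      with i show False by blast
    qed
    also have "coeff (u_gen i * ?T) ({i}, \<omega>) = 1"
    proof -
      have *: "{j. j = i \<and> j < i} = {}" by auto
      have "\<omega> \<noteq> \<omega> - {i}" using i by blast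
      then show ?thesis
        using i by (simp add: coeff_mult act_gens U_op_def coeff_monomial[OF s'] delta_def *)
    qed
    finally have 1: "coeff (free_diff (monomial ({}, \<omega>))) ({i}, \<omega>) = 1" by simp
    have "coeff (free_diff x) ({i}, \<omega>) = 0"
      using assms(5) coeff_RK_ideal[OF assms(1) _ assms(2)[OF i']] unfolding cocycle_def by blast
    then have "k = 0" using 1 by (simp add: k free_diff_simps coeff_simps)
    then show ?thesis by (simp add: k)
  qed
qed

text \<open>
  A linear functional that separates an element from the coboundaries, with its values regarded as
  multiples of \<open>1\<close>.
\<close>

lemma not_exact_functional:
  assumes "\<not> exact m K a"
  obtains f r where "lin f" "\<And>x. f x = scal (r x) 1" "f a = 1" "\<And>x. exact m K x \<Longrightarrow> f x = 0"
proof -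
  let ?W = "Collect (exact m K)"
  have sub: "free_alg.subspace ?W"
    by (rule free_alg.subspaceI) (auto intro: exact_ideal RK_ideal_simps exact_add exact_scal)
  obtain B where B: "B \<subseteq> ?W" "free_alg.independent B" "?W \<subseteq> free_alg.span B"
    using free_alg.maximal_independent_subset by blast
  have "a \<notin> free_alg.span B"
    using free_alg.span_minimal[OF B(1) sub] assms by blast
  then have ind: "free_alg.independent (insert a B)" and "a \<notin> B"
    using B(2) free_alg.span_base by (auto simp: free_alg.independent_insert)
  obtain f where f: "lin f" "\<And>x. x \<in> insert a B \<Longrightarrow> f x = (if x = a then 1 else 0)"
    and rng: "range f = free_alg.span ((\<lambda>x. if x = a then 1 else 0) ` insert a B)"
    using pair.linear_independent_extend_subspace[OF ind, of "\<lambda>x. if x = a then 1 else 0"] by blast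
  have "(\<lambda>x. if x = a then 1 else 0) ` insert a B \<subseteq> free_alg.span {1}"
    by (auto intro: free_alg.span_base free_alg.span_zero)
  then have "range f \<subseteq> free_alg.span {1}"
    unfolding rng by (intro free_alg.span_minimal) auto
  then have "\<exists>r. f x = scal r 1" for x
    by (auto simp: free_alg.span_singleton)
  then obtain r where "\<And>x. f x = scal (r x) 1" by metis
  moreover have "f x = 0" if "exact m K x" for x
  proof (rule pair.linear_eq_on[OF f(1) pair.linear_zero])
    show "x \<in> free_alg.span B" using B(3) that by blast
    show "f b = 0" if "b \<in> B" for b using f(2)[of b] that \<open>a \<notin> B\<close> by auto
  qed
  ultimately show thesis using that[of f r] f by simp
qed

context two_complexes
begin

lemma cocycle_left: "cocycle m K a \<Longrightarrow> cocycle (m + n) J a"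
  using K_ideal_J F_mono[of m "m + n"] by (auto simp: cocycle_def)

lemma cocycle_shift: "cocycle n L b \<Longrightarrow> cocycle (m + n) J (shift m b)"
  unfolding cocycle_def free_diff_shift using shift_in_F shift_ideal_J by simp

lemma exact_left: "exact m K a \<Longrightarrow> cocycle n L b \<Longrightarrow> exact (m + n) J (a * shift m b)"
proof (rule exact_mult(1)[OF _ cocycle_shift])
  assume "exact m K a"
  then show "exact (m + n) J a"
    unfolding exact_def using cong_J_left F_mono[of m "m + n"] by (metis le_add1 subsetD)
qed

lemma exact_right: "cocycle m K a \<Longrightarrow> exact n L b \<Longrightarrow> exact (m + n) J (a * shift m b)"
proof (rule exact_mult(2)[OF _ cocycle_left])
  assume "exact n L b"
  then obtain y where y: "y \<in> F n" "cong n L b (free_diff y)" by (auto simp: exact_def)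
  from cong_J_right[OF y(2)] show "exact (m + n) J (shift m b)"
    unfolding exact_def by (intro bexI[of _ "shift m y"] shift_in_F y) (simp add: free_diff_shift)
qed

lemma shift_reflects_ideal:
  assumes "x \<in> F n" "shift m x \<in> RK_ideal (m + n) J"
  shows "x \<in> RK_ideal n L"
proof -
  have "coeff x (\<tau>, \<upsilon>) = 0" if t: "(\<tau>, \<upsilon>) \<in> states n" "\<tau> \<in> L" for \<tau> \<upsilon>
  proof -
    have 0: "({}, {}) \<in> states m" by (simp add: states_def)
    have "coeff x (\<tau>, \<upsilon>) = coeff 1 ({}, {}) * coeff x (\<tau>, \<upsilon>)"
      by (simp add: coeff_def act_gens vac_def)
    also have "\<dots> = coeff (1 * shift m x) (join_state m ({}, {}) (\<tau>, \<upsilon>))"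
      by (rule coeff_blocks[symmetric, OF F_simps(6) assms(1) 0 t(1)])
    also have "\<dots> = 0"
      using coeff_RK_ideal[OF down_J assms(2)] block_in_join[of "{}" \<tau>] empty_K t(2) statesD[OF t(1)]
      by (simp add: join_state_def)
    finally show ?thesis .
  qed
  then show ?thesis
    using RK_ideal_iff[OF down_L assms(1)] by blast
qed

text \<open>
  Suppose that \<open>a \<otimes> b = d y\<close>. A functional \<open>f\<close> with \<open>f a = 1\<close> that kills the coboundaries can be
  replaced by its part of the same parity as \<open>a\<close>; then \<open>f \<otimes> 1\<close> commutes with \<open>d\<close> up to sign, and applying
  it gives \<open>b = d (\<plusminus> (f \<otimes> 1) y)\<close>. So \<open>b\<close> would be a coboundary.
\<close>

lemma not_exact_block:
  assumes a: "cocycle m K a" "has_parity a" "\<not> exact m K a" and b: "cocycle n L b" "\<not> exact n L b"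
  shows "\<not> exact (m + n) J (a * shift m b)"
proof
  assume "exact (m + n) J (a * shift m b)"
  then obtain y where y: "y \<in> F (m + n)" "cong (m + n) J (a * shift m b) (free_diff y)"
    by (auto simp: exact_def)
  obtain f r where f: "lin f" "\<And>x. f x = scal (r x) 1" "f a = 1" "\<And>x. exact m K x \<Longrightarrow> f x = 0"
    using not_exact_functional[OF a(3)] by blast
  \<comment> \<open>\<open>e\<close> is the sign by which \<open>twist\<close> acts on \<open>a\<close>, and \<open>g\<close> below is the part of \<open>f\<close> on which it acts by the same sign.\<close>
  obtain e where e: "e = 1 \<or> e = -1" "twist a = scal e a"
    using a(2) by (auto simp: has_parity_def intro: that[of 1] that[of "-1"])
  have ee: "e * e = 1" using e(1) by auto
  define g where "g x = scal (1/2) (f x + scal e (f (twist x)))" for x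
  have lin_g: "lin g"
    unfolding g_def[abs_def] by (intro lin_scal lin_plus lin_compose[OF f(1) lin_twist] f)
  have g_scal: "g x = scal (1/2 * (r x + e * r (twist x))) 1" for x
    by (simp only: g_def f(2) free_alg.scale_scale free_alg.scale_left_distrib[symmetric])
  have "g a = scal (1/2) 1 + scal (1/2) 1"
    by (simp only: g_def e(2) lin_simps[OF f(1)] f(3) free_alg.scale_scale ee free_alg.scale_one
        free_alg.scale_right_distrib)
  also have "\<dots> = 1"
    by (simp flip: free_alg.scale_left_distrib)
  finally have g_a: "g a = 1" .
  have g_twist: "g (twist x) = scal e (g x)" for x
  proof -
    have "e * (1/2 * e) = 1/2" using ee by (simp add: mult.left_commute)
    then show ?thesis
      by (simp add: g_def free_alg.scale_right_distrib mult.commute add.commute)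
  qed
  have g_exact: "g x = 0" if "exact m K x" "exact m K (twist x)" for x
    using f(4)[OF that(1)] f(4)[OF that(2)] by (simp add: g_def)
  have g_diff: "g (free_diff x) = 0" if "x \<in> F m" for x
  proof (rule g_exact)
    show "exact m K (free_diff x)" by (rule exact_free_diff[OF that])
    have "twist (free_diff x) = scal (-1) (free_diff (twist x))" by (simp add: free_diff_twist)
    then show "exact m K (twist (free_diff x))"
      using exact_scal[OF exact_free_diff[OF twist_in_F[OF that]]] by metis
  qed
  have "g x = 0" if "x \<in> RK_ideal m K" for x
    using that by (intro g_exact exact_ideal twist_RK_ideal)
  then have g: "endo m K g"
    unfolding endo_def by (auto simp: lin_g g_scal RK_ideal_simps intro!: F_simps)
  let ?T = "tensor m n g (\<lambda>x. x)"
  note T = endo_tensor[OF g endo_id]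
  have "cong (m + n) J (?T (free_diff y)) (scal e (free_diff (?T y)))"
  proof (rule agree_on_blocks[of "\<lambda>y. ?T (free_diff y)" "\<lambda>y. scal e (free_diff (?T y))", OF _ _ y(1)])
    show "endo (m + n) J (\<lambda>y. ?T (free_diff y))"
      by (rule endo_compose[OF T endo_free_diff])
    show "endo (m + n) J (\<lambda>y. scal e (free_diff (?T y)))"
      using endo_compose[OF endo_free_diff T]
      by (auto simp: endo_def lin_scal F_simps RK_ideal_simps)
    fix s t assume "s \<in> states m" "t \<in> states n"
    define u v where "u = monomial s" and "v = monomial t"
    have uv: "u \<in> F m" "v \<in> F n"
      using \<open>s \<in> states m\<close> \<open>t \<in> states n\<close> by (auto simp: u_def v_def monomial_in_F)
    have "?T (free_diff (u * shift m v)) = ?T (free_diff u * shift m v) + ?T (twist u * shift m (free_diff v))"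
      by (simp add: free_diff_mult free_diff_shift lin_simps[OF endoD(1)[OF T]])
    also have "cong (m + n) J \<dots> (g (free_diff u) * shift m v + g (twist u) * shift m (free_diff v))"
      using uv by (intro cong_add tensor_mult g endo_id free_diff_in_F twist_in_F)
    also have "\<dots> = scal e (free_diff (g u * shift m v))"
      using g_scal[of u]
      by (simp add: g_diff[OF uv(1)] g_twist free_diff_mult free_diff_shift free_diff_simps twist_simps scal_mult)
    also have "cong (m + n) J \<dots> (scal e (free_diff (?T (u * shift m v))))"
      using uv by (intro cong_scal cong_free_diff cong_sym[OF tensor_mult[OF g endo_id]])
    finally show "cong (m + n) J (?T (free_diff (monomial s * shift m (monomial t)))) (scal e (free_diff (?T (monomial s * shift m (monomial t)))))"
      unfolding u_def v_def .
  qed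
  moreover have "cong (m + n) J (?T (a * shift m b)) (g a * shift m b)"
    using a(1) b(1) by (intro tensor_mult g endo_id) (auto simp: cocycle_def)
  moreover have "cong (m + n) J (?T (a * shift m b)) (?T (free_diff y))"
    by (rule endo_cong[OF T y(2)])
  ultimately have 1: "cong (m + n) J (shift m b) (scal e (free_diff (?T y)))"
    unfolding g_a by simp (blast intro: cong_trans cong_sym)
  define y' where "y' = (\<Sum>s\<in>states m. \<Sum>t\<in>states n.
      scal (coeff y (join_state m s t) * (1/2 * (r (monomial s) + e * r (twist (monomial s))))) (monomial t))"
  have "?T y = shift m y'"
    by (simp add: tensor_def y'_def g_scal shift_simps scal_mult)
  moreover have y': "y' \<in> F n"
    unfolding y'_def by (intro F_sum F_simps monomial_in_F)
  ultimately have "shift m (b - scal e (free_diff y')) \<in> RK_ideal (m + n) J"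
    using 1 by (simp add: cong_def shift_simps free_diff_shift)
  then have "b - free_diff (scal e y') \<in> RK_ideal n L"
    using b(1) y' by (simp add: free_diff_simps) (intro shift_reflects_ideal; auto simp: cocycle_def intro!: F_simps free_diff_in_F)
  with y' b(2) show False
    unfolding exact_def cong_def using F_simps(7) by blast
qed

lemma block_commute:
  assumes "x \<in> F m" "y \<in> F n" "has_parity x" "has_parity y"
  obtains e where "e = 1 \<or> e = -1" "cong (m + n) J (shift m y * x) (scal e (x * shift m y))"
proof -
  \<comment> \<open>The averages over \<open>twist\<close> in the Koszul rule collapse for elements of definite parity.\<close>
  have half: "scal (1/2) (x + x) = x" for x
    using free_alg.scale_left_distrib[of "1/2" "1/2" x] by (simp add: free_alg.scale_right_distrib)
  note 2 = half half[of "- x" for x, simplified]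
  have "\<exists>e. (e = 1 \<or> e = -1) \<and> scal (1/2) (x * shift m (y + twist y) + twist x * shift m (y - twist y)) = scal e (x * shift m y)"
    using assms(3,4) unfolding has_parity_def
  proof (elim disjE)
    assume "twist x = x" "twist y = y"
    then show ?thesis by (intro exI[of _ 1]) (simp add: shift_simps distrib_left 2)
  next
    assume "twist x = x" "twist y = - y"
    then show ?thesis by (intro exI[of _ 1]) (simp add: shift_simps distrib_left 2)
  next
    assume "twist x = - x" "twist y = y"
    then show ?thesis by (intro exI[of _ 1]) (simp add: shift_simps distrib_left 2)
  next
    assume "twist x = - x" "twist y = - y"
    then show ?thesis by (intro exI[of _ "-1"]) (simp add: shift_simps distrib_left 2)
  qed
  then show thesis using shift_commute[OF assms(1,2), of J] that by metis
qed

text \<open>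
  Let \<open>\<pi>\<close> be \<open>1 - (d h + h d)\<close> for a contraction \<open>h\<close> of
  the first complex, and \<open>\<pi>'\<close> likewise for the second. The homotopies \<open>h \<otimes> 1\<close> and \<open>1 \<otimes> h'\<close> show that
  \<open>(1 \<otimes> \<pi>') (\<pi> \<otimes> 1) z\<close> is cohomologous to \<open>z\<close>, and expanding \<open>z\<close> in monomials turns it into a sum of
  products of cocycles \<open>\<pi> s\<close> and \<open>\<pi>' t\<close>.
\<close>

lemma kunneth:
  assumes z: "z \<in> part J d \<omega>" "cocycle (m + n) J z" and \<omega>: "\<omega> = \<omega>\<^sub>1 \<union> (+) m ` \<omega>\<^sub>2" "\<omega>\<^sub>1 \<subseteq> {1..m}" "\<omega>\<^sub>2 \<subseteq> {1..n}"
  obtains a b :: "(nat set \<times> nat set) \<times> (nat set \<times> nat set) \<Rightarrow> free_alg" and p q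
  where "exact (m + n) J (z - (\<Sum>i\<in>states m \<times> states n. a i * shift m (b i)))"
    "\<And>i. i \<in> states m \<times> states n \<Longrightarrow> a i \<in> part K (p i) \<omega>\<^sub>1 \<and> b i \<in> part L (q i) \<omega>\<^sub>2 \<and> p i + q i = d \<and>
       cocycle m K (a i) \<and> cocycle n L (b i)"
proof -
  obtain h where h: "endo m K h"
    and h_odd: "\<And>s. s \<in> states m \<Longrightarrow> cong m K (h (twist (monomial s))) (- twist (h (monomial s)))"
    and h_part: "\<And>\<sigma> \<omega>. (\<sigma>, \<omega>) \<in> states m \<Longrightarrow> \<sigma> \<in> K \<Longrightarrow>
      \<exists>x \<in> part K (card \<sigma>) \<omega>. free_diff x \<in> RK_ideal m K \<and>
        cong m K (monomial (\<sigma>, \<omega>) - (free_diff (h (monomial (\<sigma>, \<omega>))) + h (free_diff (monomial (\<sigma>, \<omega>))))) x"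
    by (rule contraction[OF down_K, of m], rule that) blast+
  obtain k where k: "endo n L k"
    and k_part: "\<And>\<sigma> \<omega>. (\<sigma>, \<omega>) \<in> states n \<Longrightarrow> \<sigma> \<in> L \<Longrightarrow>
      \<exists>x \<in> part L (card \<sigma>) \<omega>. free_diff x \<in> RK_ideal n L \<and>
        cong n L (monomial (\<sigma>, \<omega>) - (free_diff (k (monomial (\<sigma>, \<omega>))) + k (free_diff (monomial (\<sigma>, \<omega>))))) x"
    by (rule contraction[OF down_L, of n], rule that) blast+
  define H where "H a = free_diff (h a) + h (free_diff a)" for a
  define H' where "H' b = free_diff (k b) + k (free_diff b)" for b
  have eH: "endo m K H" "endo n L H'"
    unfolding H_def[abs_def] H'_def[abs_def]
    by (intro endo_add endo_compose[OF endo_free_diff] endo_compose[OF _ endo_free_diff] h k)+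
  define \<pi> where "\<pi> a = a - H a" for a
  define \<pi>' where "\<pi>' b = b - H' b" for b
  have e\<pi>: "endo m K \<pi>" "endo n L \<pi>'"
    using eH by (auto simp: \<pi>_def[abs_def] \<pi>'_def[abs_def] endo_def lin_minus[OF lin_ident] F_simps RK_ideal_simps)
  have zF: "z \<in> F (m + n)" and dz: "free_diff z \<in> RK_ideal (m + n) J"
    using z(2) by (auto simp: cocycle_def)
  have id: "cong (m + n) J (tensor m n (\<lambda>x. x) (\<lambda>x. x) x) x" if "x \<in> F (m + n)" for x
    by (rule agree_on_blocks[of "tensor m n (\<lambda>x. x) (\<lambda>x. x)" "\<lambda>x. x", OF endo_tensor[OF endo_id endo_id] endo_id that])
      (intro tensor_mult endo_id monomial_in_F)
  define z1 where "z1 = tensor m n \<pi> (\<lambda>b. b) z"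
  define z2 where "z2 = tensor m n (\<lambda>a. a) \<pi>' z1"
  have z1F: "z1 \<in> F (m + n)"
    unfolding z1_def by (rule endoD(2)[OF endo_tensor[OF e\<pi>(1) endo_id] zF])
  let ?y1 = "tensor m n h (\<lambda>b. b) z" and ?y2 = "tensor m n twist k z1"
  have yF: "?y1 \<in> F (m + n)" "?y2 \<in> F (m + n)"
    using endoD(2)[OF endo_tensor[OF h endo_id] zF] endoD(2)[OF endo_tensor[OF endo_twist k] z1F] .
  have 1: "cong (m + n) J z1 (z - free_diff ?y1)"
  proof -
    have "z1 = tensor m n (\<lambda>x. x) (\<lambda>x. x) z - tensor m n H (\<lambda>b. b) z"
      by (simp add: z1_def tensor_def \<pi>_def left_diff_distrib free_alg.scale_right_diff_distrib sum_subtractf)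
    also have "cong (m + n) J \<dots> (z - (free_diff ?y1 + tensor m n h (\<lambda>b. b) (free_diff z)))"
      unfolding H_def[abs_def] using zF h_odd
      by (intro cong_diff id cong_sym[OF homotopy_left[OF h]])
    also have "cong (m + n) J \<dots> (z - (free_diff ?y1 + 0))"
      using endoD(3)[OF endo_tensor[OF h endo_id] dz] by (intro cong_diff cong_add cong_refl) (simp add: cong_0)
    finally show ?thesis by simp
  qed
  have dz1: "free_diff z1 \<in> RK_ideal (m + n) J"
    using cong_mem[OF cong_free_diff[OF 1]] dz by (simp add: free_diff_simps)
  have 2: "cong (m + n) J z2 (z1 - free_diff ?y2)"
  proof -
    have "z2 = tensor m n (\<lambda>x. x) (\<lambda>x. x) z1 - tensor m n (\<lambda>a. a) H' z1"
      by (simp add: z2_def tensor_def \<pi>'_def right_diff_distrib shift_simps free_alg.scale_right_diff_distrib sum_subtractf)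
    also have "cong (m + n) J \<dots> (z1 - (free_diff ?y2 + tensor m n twist k (free_diff z1)))"
      unfolding H'_def[abs_def] using z1F
      by (intro cong_diff id cong_sym[OF homotopy_right[OF k]])
    also have "cong (m + n) J \<dots> (z1 - (free_diff ?y2 + 0))"
      using endoD(3)[OF endo_tensor[OF endo_twist k] dz1] by (intro cong_diff cong_add cong_refl) (simp add: cong_0)
    finally show ?thesis by simp
  qed
  have "cong (m + n) J (z - z2) (z - (z - free_diff ?y1 - free_diff ?y2))"
    using cong_trans[OF 2 cong_diff[OF 1 cong_refl]] by (intro cong_diff cong_refl)
  then have 3: "cong (m + n) J (z - z2) (free_diff (?y1 + ?y2))"
    by (simp add: free_diff_simps add.commute)
  let ?c = "\<lambda>i. coeff z (join_state m (fst i) (snd i))"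
  note T2 = endo_tensor[OF endo_id e\<pi>(2)]
  have "z2 = (\<Sum>i\<in>states m \<times> states n. scal (?c i) (tensor m n (\<lambda>a. a) \<pi>' (\<pi> (monomial (fst i)) * shift m (monomial (snd i)))))"
    unfolding z2_def z1_def tensor_def[of m n \<pi>]
    by (simp add: lin_simps[OF endoD(1)[OF T2]] sum.cartesian_product split_def)
  also have "cong (m + n) J \<dots> (\<Sum>i\<in>states m \<times> states n. scal (?c i) (\<pi> (monomial (fst i)) * shift m (\<pi>' (monomial (snd i)))))"
    by (intro cong_sum cong_scal tensor_mult endo_id e\<pi>) (auto intro!: endoD(2)[OF e\<pi>(1)] monomial_in_F)
  finally have 4: "cong (m + n) J z2 (\<Sum>i\<in>states m \<times> states n. scal (?c i) (\<pi> (monomial (fst i)) * shift m (\<pi>' (monomial (snd i)))))" .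
  \<comment> \<open>\<open>Q\<close> asserts that the term of index \<open>i\<close> has been written as a product of homogeneous cocycles.\<close>
  define Q where "Q i w \<longleftrightarrow> (case w of (a, b, p, q) \<Rightarrow> a \<in> part K p \<omega>\<^sub>1 \<and> b \<in> part L q \<omega>\<^sub>2 \<and> p + q = d \<and> cocycle m K a \<and> cocycle n L b \<and>
      cong (m + n) J (scal (?c i) (\<pi> (monomial (fst i)) * shift m (\<pi>' (monomial (snd i))))) (a * shift m b))" for i w
  have ex: "\<exists>w. Q i w" if i: "i \<in> states m \<times> states n" for i
  proof (cases "?c i = 0")
    case True
    then show ?thesis
      \<comment> \<open>A vanishing term is the product of zeros, of degrees \<open>0\<close> and \<open>d\<close>.\<close>
      by (intro exI[of _ "(0, 0, 0, d)"]) (simp add: Q_def part_simps cocycle_def F_simps RK_ideal_simps free_diff_simps)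
  next
    case False
    obtain \<sigma> \<omega>' \<tau> \<upsilon> where i': "i = ((\<sigma>, \<omega>'), (\<tau>, \<upsilon>))" by (metis surj_pair)
    have st: "(\<sigma>, \<omega>') \<in> states m" "(\<tau>, \<upsilon>) \<in> states n" using i unfolding i' by auto
    note s = statesD[OF st(1)] and t = statesD[OF st(2)]
    have "\<omega> \<subseteq> {1..m + n}" using \<omega> by auto
    with False coeff_part[OF z(1), of "m + n"] have c: "\<omega>' \<union> (+) m ` \<upsilon> = \<omega>" "\<sigma> \<union> (+) m ` \<tau> \<in> J" "card (\<sigma> \<union> (+) m ` \<tau>) = d"
      unfolding i' join_state_def by auto
    have o: "\<omega>' = \<omega>\<^sub>1" "\<upsilon> = \<omega>\<^sub>2"
      using block_inj[of \<omega>' m \<omega>\<^sub>1 \<upsilon> n \<omega>\<^sub>2] s t \<omega> c(1) by auto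
    have KL: "\<sigma> \<in> K" "\<tau> \<in> L" using block_in_join[of \<sigma> \<tau>] s t c(2) by auto
    have "\<sigma> \<inter> (+) m ` \<tau> = {}"
    proof -
      have "x \<noteq> m + y" if "x \<in> \<sigma>" "y \<in> \<tau>" for x y
      proof -
        have "x \<in> {1..m}" "y \<in> {1..n}" using s t that by blast+
        then show ?thesis by auto
      qed
      then show ?thesis by blast
    qed
    then have d: "card \<sigma> + card \<tau> = d"
      using c(3) s t by (simp add: card_Un_disjoint card_image)
    obtain x where x: "x \<in> part K (card \<sigma>) \<omega>'" "free_diff x \<in> RK_ideal m K" "cong m K (\<pi> (monomial (\<sigma>, \<omega>'))) x"
      using h_part[OF st(1) KL(1)] unfolding \<pi>_def H_def by blast
    obtain w where w: "w \<in> part L (card \<tau>) \<upsilon>" "free_diff w \<in> RK_ideal n L" "cong n L (\<pi>' (monomial (\<tau>, \<upsilon>))) w"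
      using k_part[OF st(2) KL(2)] unfolding \<pi>'_def H'_def by blast
    have xw: "x \<in> F m" "w \<in> F n" using part_in_F[OF x(1)] part_in_F[OF w(1)] s t by auto
    have "cong (m + n) J (scal (?c i) (\<pi> (monomial (fst i)) * shift m (\<pi>' (monomial (snd i))))) (scal (?c i) (x * shift m w))"
      unfolding i' using st x w xw
      by (intro cong_scal cong_J_mult) (auto intro!: endoD(2)[OF e\<pi>(2)] monomial_in_F)
    then have "Q i (scal (?c i) x, w, card \<sigma>, card \<tau>)"
      using x w xw d o by (simp add: Q_def part_simps cocycle_def F_simps RK_ideal_simps free_diff_simps scal_mult)
    then show ?thesis ..
  qed
  then have "\<forall>i\<in>states m \<times> states n. \<exists>w. Q i w" by blast
  from bchoice[OF this] obtain W where W: "\<forall>i\<in>states m \<times> states n. Q i (W i)" by blast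
  define a where "a i = fst (W i)" for i
  define b where "b i = fst (snd (W i))" for i
  define p where "p i = fst (snd (snd (W i)))" for i
  define q where "q i = snd (snd (snd (W i)))" for i
  have ab: "a i \<in> part K (p i) \<omega>\<^sub>1 \<and> b i \<in> part L (q i) \<omega>\<^sub>2 \<and> p i + q i = d \<and> cocycle m K (a i) \<and> cocycle n L (b i) \<and>
      cong (m + n) J (scal (?c i) (\<pi> (monomial (fst i)) * shift m (\<pi>' (monomial (snd i))))) (a i * shift m (b i))"
    if "i \<in> states m \<times> states n" for i
    using bspec[OF W that] by (simp add: Q_def a_def b_def p_def q_def split_def)
  have "cong (m + n) J z2 (\<Sum>i\<in>states m \<times> states n. a i * shift m (b i))"
    by (rule cong_trans[OF 4 cong_sum]) (use ab in simp)
  from cong_trans[OF cong_diff[OF cong_refl cong_sym[OF this]] 3]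
  have "cong (m + n) J (z - (\<Sum>i\<in>states m \<times> states n. a i * shift m (b i))) (free_diff (?y1 + ?y2))" .
  then have "exact (m + n) J (z - (\<Sum>i\<in>states m \<times> states n. a i * shift m (b i)))"
    unfolding exact_def by (rule bexI[OF _ F_simps(1)[OF yF]])
  then show thesis
    by (rule that[of a b p q]) (use ab in simp)
qed

end

section \<open>Joins of almost c-symplectic complexes\<close>

lemma foldr_sym_diff_map:
  assumes "f {} = {}" "\<And>A B. f (sym_diff A B) = sym_diff (f A) (f B)"
  shows "foldr sym_diff (map f xs) {} = f (foldr sym_diff xs {})"
  by (induction xs) (simp_all only: list.map foldr.simps comp_def id_apply assms)

lemma left_block_sym_diff: "foldr sym_diff (map (left_block m) xs) {} = left_block m (foldr sym_diff xs {})"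
  by (rule foldr_sym_diff_map) (auto simp: left_block_def)

lemma right_block_sym_diff: "foldr sym_diff (map (right_block m n) xs) {} = right_block m n (foldr sym_diff xs {})"
  by (rule foldr_sym_diff_map) (auto simp: right_block_def)

lemma foldr_sym_diff_append:
  "foldr sym_diff (xs @ ys) {} = sym_diff (foldr sym_diff xs {}) (foldr sym_diff ys {})"
proof (induction xs)
  case (Cons x xs)
  have "sym_diff x (sym_diff A B) = sym_diff (sym_diff x A) B" for A B :: "'a set" by auto
  with Cons show ?case by (simp only: append_Cons foldr.simps comp_def)
qed simp

text \<open>
  Factors of degree zero in a nonvanishing product are scalars with empty index set. They affect
  neither the vanishing of the product nor the symmetric difference.
\<close>

lemma drop_degree_zero:
  assumes K: "down_closed K" "\<And>i. i \<in> {1..m} \<Longrightarrow> {i} \<in> K"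
    and xs: "\<And>x p \<omega>. (x, p, \<omega>) \<in> set xs \<Longrightarrow> p \<le> 2 \<and> \<omega> \<subseteq> {1..m} \<and> x \<in> part K p \<omega> \<and> cocycle m K x"
    and nz: "\<not> exact m K (prod_list (map fst xs))"
    and sd: "foldr sym_diff (map (snd \<circ> snd) xs) {} = {1..m}"
  shows "almost_c_symplectic m K"
proof -
  define ys where "ys = filter (\<lambda>(x, p, \<omega>). p \<noteq> 0) xs"
  have "\<not> exact m K (c * prod_list (map fst (filter (\<lambda>(x, p, \<omega>). p \<noteq> 0) xs))) \<and>
      foldr sym_diff (map (snd \<circ> snd) (filter (\<lambda>(x, p, \<omega>). p \<noteq> 0) xs)) {} = foldr sym_diff (map (snd \<circ> snd) xs) {}"
    if "\<not> exact m K (c * prod_list (map fst xs))"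
      "\<And>x p \<omega>. (x, p, \<omega>) \<in> set xs \<Longrightarrow> \<omega> \<subseteq> {1..m} \<and> x \<in> part K p \<omega> \<and> cocycle m K x" for c xs
    using that
  proof (induction xs arbitrary: c)
    case (Cons y xs)
    obtain x p \<omega> where y: "y = (x, p, \<omega>)" by (metis surj_pair)
    have x: "\<omega> \<subseteq> {1..m}" "x \<in> part K p \<omega>" "cocycle m K x"
      using Cons.prems(2)[of x p \<omega>] y by auto
    have xs': "\<omega> \<subseteq> {1..m} \<and> x \<in> part K p \<omega> \<and> cocycle m K x" if "(x, p, \<omega>) \<in> set xs" for x p \<omega>
      using Cons.prems(2)[of x p \<omega>] that by simp
    show ?case
    proof (cases "p = 0")
      case False
      have "\<not> exact m K (c * x * prod_list (map fst xs))"
        using Cons.prems(1) y by (simp add: mult.assoc)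
      from Cons.IH[OF this xs'] show ?thesis
        using False by (simp add: y mult.assoc)
    next
      case True
      have "x \<noteq> 0"
        using Cons.prems(1) exact_ideal[OF RK_ideal_simps(1)] by (auto simp: y)
      then obtain k where k: "\<omega> = {}" "x = scal k 1"
        using degree_zero[OF K x(1)] x(2,3) True by blast
      have "\<not> exact m K (c * prod_list (map fst xs))"
        using Cons.prems(1) exact_scal[of m K "c * prod_list (map fst xs)" k] by (auto simp: y k scal_mult)
      from Cons.IH[OF this xs'] show ?thesis
        using True k by (simp add: y)
    qed
  qed simp
  from this[of 1 xs] have ys: "\<not> exact m K (prod_list (map fst ys))" "foldr sym_diff (map (snd \<circ> snd) ys) {} = {1..m}"
    using nz sd xs unfolding ys_def by (simp_all del: foldr_map)
  have "\<forall>(x, p, \<omega>)\<in>set ys. p \<in> {1, 2} \<and> \<omega> \<subseteq> {1..m} \<and> x \<in> part K p \<omega> \<and> cocycle m K x"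
  proof (intro ballI)
    fix y assume y: "y \<in> set ys"
    obtain x p \<omega> where e: "y = (x, p, \<omega>)" by (metis surj_pair)
    have "p \<noteq> 0" "(x, p, \<omega>) \<in> set xs" using y unfolding ys_def e by auto
    with xs[of x p \<omega>] show "case y of (x, p, \<omega>) \<Rightarrow> p \<in> {1, 2} \<and> \<omega> \<subseteq> {1..m} \<and> x \<in> part K p \<omega> \<and> cocycle m K x"
      unfolding e by auto
  qed
  with ys show ?thesis
    unfolding almost_c_symplectic_iff by (intro exI[of _ ys] conjI)
qed

context two_complexes
begin

text \<open>
  By multilinearity, some product of the summands of the factors survives. The cocycle \<open>c\<close> collects the
  factors that have already been replaced.
\<close>

lemma product_expansion:
  assumes "\<forall>(z, d, \<omega>)\<in>set zs. d \<le> 2 \<and> \<omega> \<subseteq> {1..m + n} \<and> z \<in> part J d \<omega> \<and> cocycle (m + n) J z"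
    and "cocycle (m + n) J c" "\<not> exact (m + n) J (c * prod_list (map fst zs))"
  shows "\<exists>ws. map (\<lambda>(a, p, b, q, \<omega>). \<omega>) ws = map (snd \<circ> snd) zs \<and>
    (\<forall>(a, p, b, q, \<omega>)\<in>set ws. p \<le> 2 \<and> q \<le> 2 \<and> a \<in> part K p (left_block m \<omega>) \<and> b \<in> part L q (right_block m n \<omega>) \<and>
      cocycle m K a \<and> cocycle n L b) \<and>
    \<not> exact (m + n) J (c * prod_list (map (\<lambda>(a, p, b, q, \<omega>). a * shift m b) ws))"
  using assms
proof (induction zs arbitrary: c)
  case Nil
  then show ?case by (intro exI[of _ "[]"]) simp
next
  case (Cons y zs)
  obtain z d \<omega> where y: "y = (z, d, \<omega>)" by (metis surj_pair)
  have z: "d \<le> 2" "\<omega> \<subseteq> {1..m + n}" "z \<in> part J d \<omega>" "cocycle (m + n) J z"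
    using Cons.prems(1) by (simp_all add: y)
  have zs: "\<forall>(z, d, \<omega>)\<in>set zs. d \<le> 2 \<and> \<omega> \<subseteq> {1..m + n} \<and> z \<in> part J d \<omega> \<and> cocycle (m + n) J z"
    using Cons.prems(1) by simp
  let ?S = "states m \<times> states n" and ?P = "prod_list (map fst zs)"
  obtain a b :: "(nat set \<times> nat set) \<times> (nat set \<times> nat set) \<Rightarrow> free_alg" and p q
    where ex: "exact (m + n) J (z - (\<Sum>i\<in>?S. a i * shift m (b i)))"
      and ab: "\<And>i. i \<in> ?S \<Longrightarrow> a i \<in> part K (p i) (left_block m \<omega>) \<and> b i \<in> part L (q i) (right_block m n \<omega>) \<and>
        p i + q i = d \<and> cocycle m K (a i) \<and> cocycle n L (b i)"
    by (rule kunneth[OF z(3,4) block_decomposition[OF z(2)] block_subsets]) blast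
  have P: "cocycle (m + n) J ?P"
  proof (rule cocycle_prod_list)
    fix x assume "x \<in> set (map fst zs)"
    then obtain d \<omega> where "(x, d, \<omega>) \<in> set zs" by auto
    from bspec[OF zs this] show "cocycle (m + n) J x" by simp
  qed
  have "\<exists>i\<in>?S. \<not> exact (m + n) J (c * (a i * shift m (b i)) * ?P)"
  proof (rule ccontr)
    assume "\<not> ?thesis"
    then have all: "exact (m + n) J (c * (a i * shift m (b i)) * ?P)" if "i \<in> ?S" for i
      using that by blast
    have "exact (m + n) J (c * (z - (\<Sum>i\<in>?S. a i * shift m (b i))) * ?P + (\<Sum>i\<in>?S. c * (a i * shift m (b i)) * ?P))"
      by (intro exact_add exact_sum all exact_mult ex Cons.prems(2) P)
    also have "c * (z - (\<Sum>i\<in>?S. a i * shift m (b i))) * ?P + (\<Sum>i\<in>?S. c * (a i * shift m (b i)) * ?P) = c * (z * ?P)"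
      by (simp add: right_diff_distrib left_diff_distrib sum_distrib_left sum_distrib_right mult.assoc)
    finally show False using Cons.prems(3) y by simp
  qed
  then obtain i where i: "i \<in> ?S" "\<not> exact (m + n) J (c * (a i * shift m (b i)) * ?P)" by blast
  have "cocycle (m + n) J (c * (a i * shift m (b i)))"
    using ab[OF i(1)] cocycle_mult[OF Cons.prems(2) cocycle_mult[OF cocycle_left cocycle_shift]] by blast
  from Cons.IH[OF zs this i(2)] obtain ws
    where ws: "map (\<lambda>(a, p, b, q, \<omega>). \<omega>) ws = map (snd \<circ> snd) zs"
      "\<forall>(a, p, b, q, \<omega>)\<in>set ws. p \<le> 2 \<and> q \<le> 2 \<and> a \<in> part K p (left_block m \<omega>) \<and> b \<in> part L q (right_block m n \<omega>) \<and>
        cocycle m K a \<and> cocycle n L b"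
      "\<not> exact (m + n) J (c * (a i * shift m (b i)) * prod_list (map (\<lambda>(a, p, b, q, \<omega>). a * shift m b) ws))"
    by (elim exE conjE)
  show ?case
  proof (intro exI[of _ "(a i, p i, b i, q i, \<omega>) # ws"] conjI)
    show "map (\<lambda>(a, p, b, q, \<omega>). \<omega>) ((a i, p i, b i, q i, \<omega>) # ws) = map (snd \<circ> snd) (y # zs)"
      using ws(1) by (simp only: list.map prod.case y comp_apply snd_conv)
    show "\<forall>(a, p, b, q, \<omega>)\<in>set ((a i, p i, b i, q i, \<omega>) # ws). p \<le> 2 \<and> q \<le> 2 \<and>
        a \<in> part K p (left_block m \<omega>) \<and> b \<in> part L q (right_block m n \<omega>) \<and> cocycle m K a \<and> cocycle n L b"
      using ws(2) ab[OF i(1)] z(1) by auto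
    show "\<not> exact (m + n) J (c * prod_list (map (\<lambda>(a, p, b, q, \<omega>). a * shift m b) ((a i, p i, b i, q i, \<omega>) # ws)))"
      using ws(3) by (simp only: list.map prod_list.Cons prod.case mult.assoc not_False_eq_True)
  qed
qed

text \<open>
  Sorting the factors by blocks changes the product by a sign only.
\<close>

lemma block_product:
  assumes "\<And>a p b q \<omega>. (a, p, b, q, \<omega>) \<in> set ws \<Longrightarrow> a \<in> F m \<and> has_parity a \<and> b \<in> F n \<and> has_parity b"
  shows "\<exists>e. cong (m + n) J (prod_list (map (\<lambda>(a, p, b, q, \<omega>). a * shift m b) ws))
    (scal e (prod_list (map fst ws) * shift m (prod_list (map (\<lambda>(a, p, b, q, \<omega>). b) ws))))"
  using assms
proof (induction ws)
  case Nil
  then show ?case by (intro exI[of _ 1]) simp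
next
  case (Cons w ws)
  obtain a p b q \<omega> where w: "w = (a, p, b, q, \<omega>)" by (metis surj_pair)
  let ?P = "prod_list (map (\<lambda>(a, p, b, q, \<omega>). a * shift m b) ws)"
  let ?A = "prod_list (map fst ws)" and ?B = "prod_list (map (\<lambda>(a, p, b, q, \<omega>). b) ws)"
  have ab: "a \<in> F m" "has_parity a" "b \<in> F n" "has_parity b" using Cons.prems[of a p b q \<omega>] w by auto
  have ws: "a \<in> F m \<and> has_parity a \<and> b \<in> F n \<and> has_parity b" if "(a, p, b, q, \<omega>) \<in> set ws" for a p b q \<omega>
    using Cons.prems[of a p b q \<omega>] that by simp
  have A: "?A \<in> F m" "has_parity ?A" and B: "?B \<in> F n"
    using ws by (auto intro!: F_prod_list has_parity_prod_list)
  have F: "a \<in> F (m + n)" "?A \<in> F (m + n)" "shift m b \<in> F (m + n)" "shift m ?B \<in> F (m + n)"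
    using ab A B F_mono[of m "m + n"] by (auto intro: shift_in_F)
  obtain e where e: "cong (m + n) J ?P (scal e (?A * shift m ?B))" using Cons.IH ws by blast
  obtain e' where e': "cong (m + n) J (shift m b * ?A) (scal e' (?A * shift m b))"
    using block_commute[OF A(1) ab(3) A(2) ab(4)] by blast
  have "cong (m + n) J (a * shift m b * ?P) (a * shift m b * scal e (?A * shift m ?B))"
    using F by (intro cong_left e F_simps)
  also have "\<dots> = scal e (a * (shift m b * ?A) * shift m ?B)"
    by (simp add: scal_mult mult.assoc)
  also have "cong (m + n) J \<dots> (scal e (a * scal e' (?A * shift m b) * shift m ?B))"
    using F by (intro cong_scal cong_left cong_right e')
  also have "\<dots> = scal (e * e') (a * ?A * shift m (b * ?B))"
    by (simp add: scal_mult mult.assoc shift_mult)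
  finally show ?case
    unfolding w list.map prod_list.Cons prod.case fst_conv by (rule exI)
qed

lemma shift_part:
  assumes "y \<in> part L p \<omega>" "\<omega> \<subseteq> {1..n}"
  shows "shift m y \<in> part J p ((+) m ` \<omega>)"
  using assms(1)
proof (induction rule: part_induct)
  case (monomial \<tau>)
  have \<tau>: "\<tau> \<subseteq> {1..n}" using monomial(1) assms(2) by blast
  have fin: "finite \<tau>" "finite (\<omega> - \<tau>)" "0 \<notin> \<tau>" "0 \<notin> \<omega> - \<tau>"
    using \<tau> assms(2) finite_subset[of _ "{1..n}"] by auto
  have "(+) m ` (\<omega> - \<tau>) = (+) m ` \<omega> - (+) m ` \<tau>"
    by (simp add: image_set_diff)
  then have "shift m (monomial (\<tau>, \<omega>)) = monomial ((+) m ` \<tau>, (+) m ` \<omega>)"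
    using u_prod_blocks[of "{}" m \<tau>] t_prod_blocks[of "{}" m "\<omega> - \<tau>"] fin
    by (simp add: monomial_def shift_mult u_prod_def t_prod_def)
  moreover have "(+) m ` \<tau> \<in> J" using block_in_join[of "{}" \<tau>] \<tau> monomial(2) empty_K by simp
  moreover have "card ((+) m ` \<tau>) = p" using monomial(3) by (simp add: card_image)
  ultimately show ?case
    using part_simps(5)[of "(+) m ` \<tau>" "(+) m ` \<omega>" J] monomial(1) by (simp add: image_mono)
qed (auto simp: shift_simps part_simps)

lemma part_left: "x \<in> part K p \<omega> \<Longrightarrow> \<omega> \<subseteq> {1..m} \<Longrightarrow> x \<in> part J p \<omega>"
proof (induction rule: part_induct)
  case (monomial \<sigma>)
  then show ?case
    using part_simps(5)[of \<sigma> \<omega> J] block_in_join[of \<sigma> "{}"] empty_L by auto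
qed (auto simp: part_simps)

text \<open>
  The classes of both complexes are taken together. Their product is the exterior product of two
  nonzero classes.
\<close>

lemma join_symplectic:
  assumes "almost_c_symplectic m K" "almost_c_symplectic n L"
  shows "almost_c_symplectic (m + n) J"
proof -
  obtain xs where xs: "\<forall>(x, p, \<omega>)\<in>set xs. p \<in> {1, 2} \<and> \<omega> \<subseteq> {1..m} \<and> x \<in> part K p \<omega> \<and> cocycle m K x"
    "\<not> exact m K (prod_list (map fst xs))" "foldr sym_diff (map (snd \<circ> snd) xs) {} = {1..m}"
    using assms(1) unfolding almost_c_symplectic_iff by blast
  obtain ys where ys: "\<forall>(x, p, \<omega>)\<in>set ys. p \<in> {1, 2} \<and> \<omega> \<subseteq> {1..n} \<and> x \<in> part L p \<omega> \<and> cocycle n L x"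
    "\<not> exact n L (prod_list (map fst ys))" "foldr sym_diff (map (snd \<circ> snd) ys) {} = {1..n}"
    using assms(2) unfolding almost_c_symplectic_iff by blast
  define ys' where "ys' = map (\<lambda>(y, p, \<omega>). (shift m y, p, (+) m ` \<omega>)) ys"
  have xsD: "p \<in> {1, 2} \<and> \<omega> \<subseteq> {1..m} \<and> x \<in> part K p \<omega> \<and> cocycle m K x" if "(x, p, \<omega>) \<in> set xs" for x p \<omega>
    using bspec[OF xs(1) that] by simp
  have ysD: "p \<in> {1, 2} \<and> \<omega> \<subseteq> {1..n} \<and> x \<in> part L p \<omega> \<and> cocycle n L x" if "(x, p, \<omega>) \<in> set ys" for x p \<omega>
    using bspec[OF ys(1) that] by simp
  have x: "cocycle m K x \<and> has_parity x" if "x \<in> set (map fst xs)" for x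
  proof -
    obtain p \<omega> where "(x, p, \<omega>) \<in> set xs" using \<open>x \<in> set (map fst xs)\<close> by auto
    from xsD[OF this] show ?thesis
      using has_parity_part[of x K p \<omega>] finite_subset[of \<omega> "{1..m}"] by simp
  qed
  have y: "cocycle n L y" if "y \<in> set (map fst ys)" for y
  proof -
    obtain p \<omega> where "(y, p, \<omega>) \<in> set ys" using \<open>y \<in> set (map fst ys)\<close> by auto
    from ysD[OF this] show ?thesis by simp
  qed
  have coc: "cocycle m K (prod_list (map fst xs))" "cocycle n L (prod_list (map fst ys))"
    by (rule cocycle_prod_list, use x y in simp)+
  have "has_parity x" if "x \<in> set (map fst xs)" for x
    using x[OF that] by simp
  then have "has_parity (prod_list (map fst xs))" by (rule has_parity_prod_list)
  from not_exact_block[OF coc(1) this xs(2) coc(2) ys(2)]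
  have "\<not> exact (m + n) J (prod_list (map fst (xs @ ys')))"
    by (simp add: ys'_def shift_prod_list comp_def split_def)
  moreover have "p \<in> {1, 2} \<and> \<omega> \<subseteq> {1..m + n} \<and> x \<in> part J p \<omega> \<and> cocycle (m + n) J x"
    if "(x, p, \<omega>) \<in> set (xs @ ys')" for x p \<omega>
  proof -
    from that consider "(x, p, \<omega>) \<in> set xs" | y \<upsilon> where "(y, p, \<upsilon>) \<in> set ys" "x = shift m y" "\<omega> = (+) m ` \<upsilon>"
      unfolding ys'_def by auto
    then show ?thesis
    proof cases
      case 1
      from xsD[OF this] have *: "p \<in> {1, 2}" "\<omega> \<subseteq> {1..m}" "x \<in> part K p \<omega>" "cocycle m K x" by blast+
      moreover have "\<omega> \<subseteq> {1..m + n}" using *(2) by (rule subset_trans) auto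
      ultimately show ?thesis using part_left[OF *(3,2)] cocycle_left[OF *(4)] by blast
    next
      case 2
      from ysD[OF this(1)] have *: "p \<in> {1, 2}" "\<upsilon> \<subseteq> {1..n}" "y \<in> part L p \<upsilon>" "cocycle n L y" by blast+
      moreover have "\<omega> \<subseteq> {1..m + n}" using *(2) 2(3) by auto
      ultimately show ?thesis using shift_part[OF *(3,2)] cocycle_shift[OF *(4)] 2(2,3) by blast
    qed
  qed
  moreover have "foldr sym_diff (map (snd \<circ> snd) (xs @ ys')) {} = {1..m + n}"
  proof -
    have "map (snd \<circ> snd) ys' = map ((`) ((+) m)) (map (snd \<circ> snd) ys)"
      by (simp add: ys'_def comp_def split_def)
    moreover have "foldr sym_diff (map ((`) ((+) m)) (map (snd \<circ> snd) ys)) {} = (+) m ` {1..n}"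
      unfolding ys(3)[symmetric] by (rule foldr_sym_diff_map) (auto simp: image_Un image_set_diff)
    moreover have "sym_diff {1..m} ((+) m ` {1..n}) = {1..m + n}"
      by auto
    ultimately show ?thesis
      unfolding map_append foldr_sym_diff_append xs(3) by simp
  qed
  ultimately show ?thesis
    unfolding almost_c_symplectic_iff by (intro exI[of _ "xs @ ys'"] conjI) (clarify, assumption | assumption)+
qed

text \<open>
  After expansion into exterior products of classes \<open>a\<close> and \<open>b\<close>, the product over all \<open>a\<close> and the product over all \<open>b\<close> are
  nonzero, and restricting index sets to a block commutes with symmetric differences. The degrees of
  \<open>a\<close> and \<open>b\<close> add up to \<open>1\<close> or \<open>2\<close>, so degree zero is the only one that has to be removed.
\<close>

lemma symplectic_factors:
  assumes vK: "\<And>i. i \<in> {1..m} \<Longrightarrow> {i} \<in> K" and vL: "\<And>i. i \<in> {1..n} \<Longrightarrow> {i} \<in> L"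
    and J: "almost_c_symplectic (m + n) J"
  shows "almost_c_symplectic m K" "almost_c_symplectic n L"
proof -
  obtain zs where zs: "\<forall>(z, d, \<omega>)\<in>set zs. d \<in> {1, 2} \<and> \<omega> \<subseteq> {1..m + n} \<and> z \<in> part J d \<omega> \<and> cocycle (m + n) J z"
    "\<not> exact (m + n) J (prod_list (map fst zs))" "foldr sym_diff (map (snd \<circ> snd) zs) {} = {1..m + n}"
    using J unfolding almost_c_symplectic_iff by blast
  have "\<forall>(z, d, \<omega>)\<in>set zs. d \<le> 2 \<and> \<omega> \<subseteq> {1..m + n} \<and> z \<in> part J d \<omega> \<and> cocycle (m + n) J z"
    using zs(1) by fastforce
  from product_expansion[OF this cocycle_1, unfolded mult_1_left, OF zs(2)] obtain ws
    where ws: "map (\<lambda>(a, p, b, q, \<omega>). \<omega>) ws = map (snd \<circ> snd) zs"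
      "\<forall>(a, p, b, q, \<omega>)\<in>set ws. p \<le> 2 \<and> q \<le> 2 \<and> a \<in> part K p (left_block m \<omega>) \<and> b \<in> part L q (right_block m n \<omega>) \<and>
        cocycle m K a \<and> cocycle n L b"
      "\<not> exact (m + n) J (prod_list (map (\<lambda>(a, p, b, q, \<omega>). a * shift m b) ws))"
    by (elim exE conjE)
  let ?A = "prod_list (map fst ws)" and ?B = "prod_list (map (\<lambda>(a, p, b, q, \<omega>). b) ws)"
  have w: "p \<le> 2" "q \<le> 2" "a \<in> part K p (left_block m \<omega>)" "b \<in> part L q (right_block m n \<omega>)" "cocycle m K a" "cocycle n L b"
    if "(a, p, b, q, \<omega>) \<in> set ws" for a p b q \<omega>
    using bspec[OF ws(2) that] by simp_all
  have abF: "a \<in> F m \<and> has_parity a \<and> b \<in> F n \<and> has_parity b" if "(a, p, b, q, \<omega>) \<in> set ws" for a p b q \<omega>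
    using w[OF that] has_parity_part[OF w(3)[OF that]] has_parity_part[OF w(4)[OF that]]
    by (simp add: cocycle_def left_block_def right_block_def)
  have "\<exists>e. cong (m + n) J (prod_list (map (\<lambda>(a, p, b, q, \<omega>). a * shift m b) ws)) (scal e (?A * shift m ?B))"
    by (rule block_product) (erule abF)
  then obtain e
    where e: "cong (m + n) J (prod_list (map (\<lambda>(a, p, b, q, \<omega>). a * shift m b) ws)) (scal e (?A * shift m ?B))"
    by (elim exE)
  have nz: "\<not> exact (m + n) J (?A * shift m ?B)"
  proof
    assume "exact (m + n) J (?A * shift m ?B)"
    then have "exact (m + n) J (scal e (?A * shift m ?B))" by (rule exact_scal)
    with exact_cong[OF e] ws(3) show False by (simp only:)
  qed
  have A: "cocycle m K ?A" and B: "cocycle n L ?B"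
    by (rule cocycle_prod_list, use w(5,6) in auto)+
  have nA: "\<not> exact m K ?A" and nB: "\<not> exact n L ?B"
    using nz exact_left[OF _ B] exact_right[OF A] by blast+
  have sdL: "foldr sym_diff (map (left_block m) (map (\<lambda>(a, p, b, q, \<omega>). \<omega>) ws)) {} = {1..m}"
    unfolding left_block_sym_diff ws(1) zs(3) by (auto simp: left_block_def)
  have sdR: "foldr sym_diff (map (right_block m n) (map (\<lambda>(a, p, b, q, \<omega>). \<omega>) ws)) {} = {1..n}"
    unfolding right_block_sym_diff ws(1) zs(3) by (auto simp: right_block_def)
  show "almost_c_symplectic m K"
  proof (rule drop_degree_zero[where xs = "map (\<lambda>(a, p, b, q, \<omega>). (a, p, left_block m \<omega>)) ws"])
    show "down_closed K" by (rule down_K)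
    show "{i} \<in> K" if "i \<in> {1..m}" for i by (rule vK[OF that])
    show "foldr sym_diff (map (snd \<circ> snd) (map (\<lambda>(a, p, b, q, \<omega>). (a, p, left_block m \<omega>)) ws)) {} = {1..m}"
      using sdL by (simp add: comp_def split_def)
    show "\<not> exact m K (prod_list (map fst (map (\<lambda>(a, p, b, q, \<omega>). (a, p, left_block m \<omega>)) ws)))"
      using nA by (simp add: comp_def split_def)
    fix x p \<omega> assume "(x, p, \<omega>) \<in> set (map (\<lambda>(a, p, b, q, \<omega>). (a, p, left_block m \<omega>)) ws)"
    then obtain b q \<upsilon> where "(x, p, b, q, \<upsilon>) \<in> set ws" "\<omega> = left_block m \<upsilon>" by auto
    then show "p \<le> 2 \<and> \<omega> \<subseteq> {1..m} \<and> x \<in> part K p \<omega> \<and> cocycle m K x"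
      using w[OF \<open>(x, p, b, q, \<upsilon>) \<in> set ws\<close>] block_subsets(1) by simp
  qed
  show "almost_c_symplectic n L"
  proof (rule drop_degree_zero[where xs = "map (\<lambda>(a, p, b, q, \<omega>). (b, q, right_block m n \<omega>)) ws"])
    show "down_closed L" by (rule down_L)
    show "{i} \<in> L" if "i \<in> {1..n}" for i by (rule vL[OF that])
    show "foldr sym_diff (map (snd \<circ> snd) (map (\<lambda>(a, p, b, q, \<omega>). (b, q, right_block m n \<omega>)) ws)) {} = {1..n}"
      using sdR by (simp add: comp_def split_def)
    show "\<not> exact n L (prod_list (map fst (map (\<lambda>(a, p, b, q, \<omega>). (b, q, right_block m n \<omega>)) ws)))"
      using nB by (simp add: comp_def split_def)
    fix x q \<omega> assume "(x, q, \<omega>) \<in> set (map (\<lambda>(a, p, b, q, \<omega>). (b, q, right_block m n \<omega>)) ws)"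
    then obtain a p \<upsilon> where "(a, p, x, q, \<upsilon>) \<in> set ws" "\<omega> = right_block m n \<upsilon>" by auto
    then show "q \<le> 2 \<and> \<omega> \<subseteq> {1..n} \<and> x \<in> part L q \<omega> \<and> cocycle n L x"
      using w[OF \<open>(a, p, x, q, \<upsilon>) \<in> set ws\<close>] block_subsets(2) by simp
  qed
qed

end

section \<open>Boundary complexes of simplicial polytopes\<close>

text \<open>
  A nonempty proper face lies in a facet, which is a simplex, and any set of vertices of a simplex
  spans a face of it.
\<close>

lemma boundary_complex_down_closed:
  assumes "simplicial_polytope P"
  shows "{} \<in> boundary_complex P"
    and "S \<in> boundary_complex P \<Longrightarrow> T \<subseteq> S \<Longrightarrow> T \<in> boundary_complex P"
proof -
  have P: "polytope P" "P \<noteq> {}" "\<And>G. G facet_of P \<Longrightarrow> \<exists>k. k simplex G"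
    using assms by (auto simp: simplicial_polytope_def)
  have empty: "{v. v extreme_point_of {}} = ({} :: 'a set)"
    by (simp add: extreme_point_of_def)
  then show "{} \<in> boundary_complex P"
    using P(2) empty_face_of[of P] unfolding boundary_complex_def by blast
  assume "S \<in> boundary_complex P" and TS: "T \<subseteq> S"
  then obtain E where E: "E face_of P" "E \<noteq> P" "S = {v. v extreme_point_of E}"
    by (auto simp: boundary_complex_def)
  show "T \<in> boundary_complex P"
  proof (cases "E = {}")
    case True
    then show ?thesis using E(3) TS empty \<open>{} \<in> boundary_complex P\<close> by auto
  next
    case False
    then obtain G where G: "G facet_of P" "E \<subseteq> G"
      using face_of_polyhedron_subset_facet[OF polytope_imp_polyhedron[OF P(1)] E(1)] E(2) by blast
    then obtain C where C: "\<not> affine_dependent C" "G = convex hull C"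
      using P(3) unfolding simplex by blast
    have GP: "G face_of P" using G(1) by (rule facet_of_imp_face_of)
    then have "E face_of G"
      using E(1) G(2) face_of_subset face_of_imp_subset by blast
    then obtain c where c: "c \<subseteq> C" "E = convex hull c"
      using face_of_convex_hull_affine_independent[OF C(1)] C(2) by auto
    have "\<not> affine_dependent c" using C(1) c(1) affine_dependent_subset by blast
    then have Sc: "S = c"
      using E(3) c(2) extreme_point_of_convex_hull_affine_independent by blast
    have "\<not> affine_dependent T" using C(1) c(1) TS Sc affine_dependent_subset by blast
    then have T: "T = {v. v extreme_point_of (convex hull T)}"
      using extreme_point_of_convex_hull_affine_independent by blast
    have "T \<subseteq> C" using c(1) TS Sc by blast
    then have "convex hull T face_of G"
      using face_of_convex_hull_affine_independent[OF C(1)] C(2) by blast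
    then have "convex hull T face_of P" using GP face_of_trans by blast
    moreover have "convex hull T \<noteq> P"
    proof
      assume "convex hull T = P"
      then have "P \<subseteq> E" using c(2) TS Sc hull_mono by blast
      then show False using E(1,2) face_of_imp_subset by blast
    qed
    ultimately show ?thesis using T unfolding boundary_complex_def by blast
  qed
qed

text \<open>
  An extreme point of a face is a face of the polytope; it is a proper one since the face
  containing it is.
\<close>

lemma boundary_complex_vertex:
  assumes "x \<in> \<Union>(boundary_complex P)"
  shows "{x} \<in> boundary_complex P"
proof -
  obtain E where E: "E face_of P" "E \<noteq> P" "x extreme_point_of E"
    using assms by (auto simp: boundary_complex_def)
  have "{x} face_of P"
    using E by (meson face_of_singleton face_of_trans)
  moreover have "{x} \<noteq> P"
    using E face_of_imp_subset[OF E(1)] by (auto simp: extreme_point_of_def)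
  moreover have "{x} = {v. v extreme_point_of {x}}"
    by (auto simp: extreme_point_of_def)
  ultimately show ?thesis
    unfolding boundary_complex_def by blast
qed

lemma labelled_boundary_complex:
  assumes "simplicial_polytope P" "labelled_boundary m K P"
  shows "down_closed K" "{} \<in> K" "K \<subseteq> Pow {1..m}" "i \<in> {1..m} \<Longrightarrow> {i} \<in> K"
proof -
  obtain v where v: "bij_betw v {1..m} (\<Union>(boundary_complex P))"
    and K: "K = {\<sigma>. \<sigma> \<subseteq> {1..m} \<and> v ` \<sigma> \<in> boundary_complex P}"
    using assms(2) by (auto simp: labelled_boundary_def)
  show "down_closed K"
    unfolding down_closed_def
  proof (intro ballI allI impI)
    fix \<sigma> \<tau> assume "\<sigma> \<in> K" "\<tau> \<subseteq> \<sigma>"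
    then show "\<tau> \<in> K"
      using boundary_complex_down_closed(2)[OF assms(1), of "v ` \<sigma>" "v ` \<tau>"] unfolding K by blast
  qed
  show "{} \<in> K" "K \<subseteq> Pow {1..m}"
    using boundary_complex_down_closed(1)[OF assms(1)] unfolding K by auto
  show "{i} \<in> K" if "i \<in> {1..m}"
    using boundary_complex_vertex[of "v i" P] bij_betwE[OF v] that unfolding K by simp
qed

theorem proposition4p15:
  fixes P :: "'a::euclidean_space set" and Q :: "'b::euclidean_space set"
    and K L :: "nat set set" and m n :: nat
  assumes "simplicial_polytope P" and "labelled_boundary m K P"
    and "simplicial_polytope Q" and "labelled_boundary n L Q"
  shows "almost_c_symplectic (m + n) (simplicial_join m K L) \<longleftrightarrow>
         almost_c_symplectic m K \<and> almost_c_symplectic n L"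
proof -
  note K = labelled_boundary_complex[OF assms(1,2)]
  note L = labelled_boundary_complex[OF assms(3,4)]
  interpret two_complexes m n K L
    by unfold_locales (fact K(1-3) L(1-3))+
  show ?thesis
    using join_symplectic symplectic_factors[OF K(4) L(4)] by blast
qed

end
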